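(* Let $G$ and $H$ be finite groups of coprime orders. Then $$R^*_{\mathbb C}(G\times H)\cong R^*_{\mathbb C}(G)\otimes_{\mathbb Z}R^*_{\mathbb C}(H)$$ as graded rings.
   Context: Let $G$ be a finite group. $R_{\mathbb C}(G)$ is the ring of virtual complex characters of $G$ (the free abelian group on the irreducible complex characters, with product induced by tensor product), with augmentation $\epsilon:R_{\mathbb C}(G)\to\mathbb Z$ the degree map and $I=\ker\epsilon$. Exterior powers of representations give maps $\lambda^n$ on characters, extended to $R_{\mathbb C}(G)$ by requiring $\lambda^0=1$ and $\lambda^n(x+y)=\sum_{i+j=n}\lambda^i(x)\lambda^j(y)$. Put $\gamma^n(x)=\lambda^n(x+n-1)$. Let $\Gamma^n\subseteq R_{\mathbb C}(G)$ be the additive subgroup generated by all products $\gamma^{i_1}(x_1)\cdots\gamma^{i_r}(x_r)$ with $x_j\in I$ and $\sum_j i_j\ge n$; then $\Gamma^0=R_{\mathbb C}(G)$, $\Gamma^1=I$, $\Gamma^m\Gamma^n\subseteq\Gamma^{m+n}$. The graded character ring is $R^*_{\mathbb C}(G)=\bigoplus_{n\ge0}\Gamma^n/\Gamma^{n+1}$. *)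

theory Defs
  imports
    "HOL-Algebra.QuotRing"
    "HOL-Algebra.Product_Groups"
    "HOL-Algebra.Free_Abelian_Groups"
    "Jordan_Normal_Form.VS_Connect"
begin

section \<open>Complex representations and their characters\<close>

definition GL_complex :: "nat \<Rightarrow> complex mat monoid"
  where "GL_complex d = units_of (ring_mat TYPE(complex) d ())"

definition representation :: "('a, 'm) monoid_scheme \<Rightarrow> nat \<Rightarrow> ('a \<Rightarrow> complex mat) \<Rightarrow> bool"
  where "representation G d \<rho> \<longleftrightarrow> \<rho> \<in> Group.hom G (GL_complex d)"

definition irreducible_representation ::
    "('a, 'm) monoid_scheme \<Rightarrow> nat \<Rightarrow> ('a \<Rightarrow> complex mat) \<Rightarrow> bool"
  where "irreducible_representation G d \<rho> \<longleftrightarrow>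
    representation G d \<rho> \<and> d > 0 \<and>
    (\<forall>W. VectorSpace.subspace class_ring W (module_vec TYPE(complex) d) \<longrightarrow>
         (\<forall>g\<in>carrier G. \<forall>w\<in>W. \<rho> g *\<^sub>v w \<in> W) \<longrightarrow>
         W = {0\<^sub>v d} \<or> W = carrier_vec d)"

definition mat_trace :: "complex mat \<Rightarrow> complex"
  where "mat_trace A = (\<Sum>i<dim_row A. A $$ (i, i))"

text \<open>Functions on a group are represented by functions on the ambient type that vanish
  off the carrier.\<close>

definition rep_character ::
    "('a, 'm) monoid_scheme \<Rightarrow> ('a \<Rightarrow> complex mat) \<Rightarrow> 'a \<Rightarrow> complex"
  where "rep_character G \<rho> = (\<lambda>g. if g \<in> carrier G then mat_trace (\<rho> g) else 0)"

definition irreducible_characters :: "('a, 'm) monoid_scheme \<Rightarrow> ('a \<Rightarrow> complex) set"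
  where "irreducible_characters G =
    {rep_character G \<rho> | \<rho> d. irreducible_representation G d \<rho>}"

definition function_ring :: "('a, 'm) monoid_scheme \<Rightarrow> ('a \<Rightarrow> complex) ring"
  where "function_ring G =
    \<lparr>carrier = {f. \<forall>g. g \<notin> carrier G \<longrightarrow> f g = 0},
     mult = (\<lambda>f h g. f g * h g),
     one = (\<lambda>g. if g \<in> carrier G then 1 else 0),
     ring.zero = (\<lambda>g. 0),
     add = (\<lambda>f h g. f g + h g)\<rparr>"

text \<open>The ring of virtual characters. The irreducible characters of a finite group are linearly
  independent functions, so the additive group they generate is free on them; the trace of a
  tensor product of representations is the pointwise product of the traces.\<close>

definition character_ring :: "('a, 'm) monoid_scheme \<Rightarrow> ('a \<Rightarrow> complex) ring"
  where "character_ring G =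
    (function_ring G)
      \<lparr>carrier := generate (add_monoid (function_ring G)) (irreducible_characters G)\<rparr>"

text \<open>The degree of a representation is the value of its character at the identity, so the degree
  map is evaluation at the identity.\<close>

definition augmentation_ideal :: "('a, 'm) monoid_scheme \<Rightarrow> ('a \<Rightarrow> complex) set"
  where "augmentation_ideal G = {x \<in> carrier (character_ring G). x \<one>\<^bsub>G\<^esub> = 0}"


section \<open>Exterior powers and the gamma filtration\<close>

text \<open>The matrix of the \<open>n\<close>-th exterior power of the endomorphism \<open>A\<close> of the \<open>d\<close>-dimensional space,
  in the basis of wedge products of \<open>n\<close> standard basis vectors. This basis is indexed by
  the strictly increasing lists of length \<open>n\<close> over \<open>{0..<d}\<close>; the entries are the \<open>n \<times> n\<close> minors
  of \<open>A\<close>.\<close>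

definition exterior_basis :: "nat \<Rightarrow> nat \<Rightarrow> nat list list"
  where "exterior_basis d n = filter (\<lambda>s. length s = n) (subseqs [0..<d])"

definition exterior_power_mat :: "nat \<Rightarrow> complex mat \<Rightarrow> complex mat"
  where "exterior_power_mat n A =
    (let B = exterior_basis (dim_row A) n in
     mat (length B) (length B)
       (\<lambda>(a, b). det (mat n n (\<lambda>(i, j). A $$ (B ! a ! i, B ! b ! j)))))"

definition lambda_operations ::
    "('a, 'm) monoid_scheme \<Rightarrow> (nat \<Rightarrow> ('a \<Rightarrow> complex) \<Rightarrow> ('a \<Rightarrow> complex)) \<Rightarrow> bool"
  where "lambda_operations G L \<longleftrightarrow>
    (\<forall>n. L n \<in> carrier (character_ring G) \<rightarrow>\<^sub>E carrier (character_ring G)) \<and>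
    (\<forall>n d \<rho>. representation G d \<rho> \<longrightarrow>
       L n (rep_character G \<rho>) = rep_character G (\<lambda>g. exterior_power_mat n (\<rho> g))) \<and>
    (\<forall>x\<in>carrier (character_ring G). L 0 x = \<one>\<^bsub>character_ring G\<^esub>) \<and>
    (\<forall>n. \<forall>x\<in>carrier (character_ring G). \<forall>y\<in>carrier (character_ring G).
       L n (x \<oplus>\<^bsub>character_ring G\<^esub> y) =
       (\<Oplus>\<^bsub>character_ring G\<^esub>i\<in>{..n}. L i x \<otimes>\<^bsub>character_ring G\<^esub> L (n - i) y))"

text \<open>For a finite group there is exactly one such family: every virtual character is a difference
  of two characters, and the formal series with constant term \<open>1\<close> are invertible.\<close>

definition lambda_op ::
    "('a, 'm) monoid_scheme \<Rightarrow> nat \<Rightarrow> ('a \<Rightarrow> complex) \<Rightarrow> ('a \<Rightarrow> complex)"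
  where "lambda_op G = (THE L. lambda_operations G L)"

definition gamma_op ::
    "('a, 'm) monoid_scheme \<Rightarrow> nat \<Rightarrow> ('a \<Rightarrow> complex) \<Rightarrow> ('a \<Rightarrow> complex)"
  where "gamma_op G n x =
    lambda_op G n
      (x \<oplus>\<^bsub>character_ring G\<^esub> add_pow (character_ring G) (int n - 1) \<one>\<^bsub>character_ring G\<^esub>)"

definition gamma_product ::
    "('a, 'm) monoid_scheme \<Rightarrow> (nat \<times> ('a \<Rightarrow> complex)) list \<Rightarrow> ('a \<Rightarrow> complex)"
  where "gamma_product G ps =
    foldr (\<lambda>(i, x) p. gamma_op G i x \<otimes>\<^bsub>character_ring G\<^esub> p) ps \<one>\<^bsub>character_ring G\<^esub>"

definition gamma_filtration :: "('a, 'm) monoid_scheme \<Rightarrow> nat \<Rightarrow> ('a \<Rightarrow> complex) set"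
  where "gamma_filtration G n =
    generate (add_monoid (character_ring G))
      {gamma_product G ps | ps.
         snd ` set ps \<subseteq> augmentation_ideal G \<and> n \<le> sum_list (map fst ps)}"


section \<open>Graded rings\<close>

record 'a graded_ring = "'a ring" +
  homogeneous :: "nat \<Rightarrow> 'a set"

definition graded_ring_iso ::
    "('a, 'm) graded_ring_scheme \<Rightarrow> ('b, 'n) graded_ring_scheme \<Rightarrow> ('a \<Rightarrow> 'b) set"
  where "graded_ring_iso A B =
    {h \<in> ring_iso A B. \<forall>n. h ` homogeneous A n = homogeneous B n}"

definition graded_piece :: "('a, 'm) monoid_scheme \<Rightarrow> nat \<Rightarrow> ('a \<Rightarrow> complex) set monoid"
  where "graded_piece G n =
    (add_monoid (character_ring G))\<lparr>carrier := gamma_filtration G n\<rparr> Mod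
      gamma_filtration G (Suc n)"

text \<open>The direct sum of the graded pieces; the product of the classes of
  \<open>a\<close> in degree \<open>i\<close> and \<open>b\<close> in degree \<open>j\<close> is the class of \<open>a b\<close> in degree \<open>i + j\<close>.\<close>

definition graded_character_ring ::
    "('a, 'm) monoid_scheme \<Rightarrow> (nat \<Rightarrow> ('a \<Rightarrow> complex) set) graded_ring"
  where "graded_character_ring G =
    (let S = sum_group UNIV (graded_piece G) in
     \<lparr>carrier = carrier S,
      mult = (\<lambda>x y n.
        finprod (graded_piece G n)
          (\<lambda>i. rcoset_mult (character_ring G) (gamma_filtration G (Suc n)) (x i) (y (n - i)))
          {..n}),
      one = (\<lambda>n. if n = 0
        then gamma_filtration G (Suc 0) +>\<^bsub>character_ring G\<^esub> \<one>\<^bsub>character_ring G\<^esub>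
        else \<one>\<^bsub>graded_piece G n\<^esub>),
      ring.zero = \<one>\<^bsub>S\<^esub>,
      add = mult S,
      homogeneous = (\<lambda>n. {x \<in> carrier S. \<forall>m. m \<noteq> n \<longrightarrow> x m = \<one>\<^bsub>graded_piece G m\<^esub>})\<rparr>)"


section \<open>Tensor products over the integers\<close>

text \<open>The free abelian group on pairs of elements is made into a ring by
  \<open>(a, b) (a', b') = (a a', b b')\<close>. The subgroup generated by the bilinearity relations is
  an ideal when the factors are rings, and the quotient is the tensor product ring.\<close>

definition free_pair_ring ::
    "('a, 'm) ring_scheme \<Rightarrow> ('b, 'n) ring_scheme \<Rightarrow> (('a \<times> 'b) \<Rightarrow>\<^sub>0 int) ring"
  where "free_pair_ring A B =
    \<lparr>carrier = carrier (free_Abelian_group (carrier A \<times> carrier B)),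
     mult = (\<lambda>c d.
       frag_extend (\<lambda>(a, b).
         frag_extend (\<lambda>(a', b'). frag_of (a \<otimes>\<^bsub>A\<^esub> a', b \<otimes>\<^bsub>B\<^esub> b')) d) c),
     one = frag_of (\<one>\<^bsub>A\<^esub>, \<one>\<^bsub>B\<^esub>),
     ring.zero = 0,
     add = (+)\<rparr>"

definition tensor_relations ::
    "('a, 'm) ring_scheme \<Rightarrow> ('b, 'n) ring_scheme \<Rightarrow> (('a \<times> 'b) \<Rightarrow>\<^sub>0 int) set"
  where "tensor_relations A B =
    {frag_of (a \<oplus>\<^bsub>A\<^esub> a', b) - frag_of (a, b) - frag_of (a', b) | a a' b.
       a \<in> carrier A \<and> a' \<in> carrier A \<and> b \<in> carrier B} \<union>
    {frag_of (a, b \<oplus>\<^bsub>B\<^esub> b') - frag_of (a, b) - frag_of (a, b') | a b b'.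
       a \<in> carrier A \<and> b \<in> carrier B \<and> b' \<in> carrier B}"

definition tensor_kernel ::
    "('a, 'm) ring_scheme \<Rightarrow> ('b, 'n) ring_scheme \<Rightarrow> (('a \<times> 'b) \<Rightarrow>\<^sub>0 int) set"
  where "tensor_kernel A B =
    generate (add_monoid (free_pair_ring A B)) (tensor_relations A B)"

definition tensor_ring ::
    "('a, 'm) ring_scheme \<Rightarrow> ('b, 'n) ring_scheme \<Rightarrow> (('a \<times> 'b) \<Rightarrow>\<^sub>0 int) set ring"
  where "tensor_ring A B = free_pair_ring A B Quot tensor_kernel A B"

definition pure_tensor ::
    "('a, 'm) ring_scheme \<Rightarrow> ('b, 'n) ring_scheme \<Rightarrow> 'a \<Rightarrow> 'b \<Rightarrow> (('a \<times> 'b) \<Rightarrow>\<^sub>0 int) set"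
  where "pure_tensor A B a b = tensor_kernel A B +>\<^bsub>free_pair_ring A B\<^esub> frag_of (a, b)"

text \<open>The total grading. There is no Koszul sign in the multiplication: these graded rings are
  commutative in the ungraded sense.\<close>

definition graded_tensor ::
    "('a, 'm) graded_ring_scheme \<Rightarrow> ('b, 'n) graded_ring_scheme \<Rightarrow>
     (('a \<times> 'b) \<Rightarrow>\<^sub>0 int) set graded_ring"
  where "graded_tensor A B =
    ring.extend (tensor_ring A B)
      (graded_ring.fields
        (\<lambda>n. generate (add_monoid (tensor_ring A B))
          {pure_tensor A B a b | a b i j.
             a \<in> homogeneous A i \<and> b \<in> homogeneous B j \<and> i + j = n}))"

end

theory Submission
  imports
    Defs
    "HOL-Library.Function_Algebras"
    "HOL-Computational_Algebra.Group_Closure"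
    "HOL-Computational_Algebra.Formal_Power_Series"
    "Jordan_Normal_Form.Schur_Decomposition"
begin

text \<open>
  On characters the exterior powers satisfy
  \<open>\<Sum>\<^sub>n \<lambda>\<^sup>n(x)(g) t\<^sup>n = exp (\<Sum>\<^sub>k (-1)\<^sup>k x(g\<^sup>k\<^sup>+\<^sup>1) t\<^sup>k\<^sup>+\<^sup>1 / (k + 1))\<close>. The right-hand side makes sense for every
  function \<open>x\<close>, is multiplicative in \<open>x\<close> and commutes with pullback along group homomorphisms, so it
  gives the unique lambda operations, and pullback preserves the gamma filtration.

  If \<open>x\<close> has degree \<open>0\<close> and \<open>\<rho>\<close> is the regular character, then \<open>x \<rho> = 0\<close>, so \<open>|G| x = x (|G| - \<rho>)\<close>
  lies one step further down the filtration: the positive degree part of the graded ring of \<open>G\<close> is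
  killed by \<open>|G|\<close>. For coprime orders the tensor product of the two positive degree parts therefore
  vanishes. In the same way a virtual character of \<open>G \<times> H\<close> restricting to \<open>0\<close> on \<open>G\<close> and on \<open>H\<close> is
  killed by the inflations of both regular characters, hence lies in every \<open>\<Gamma>\<^sup>n\<close>. So in each
  positive degree restriction and inflation identify the graded ring of \<open>G \<times> H\<close> with the direct sum
  of those of \<open>G\<close> and \<open>H\<close>, and the isomorphism is
  \<open>w \<mapsto> w|\<^sub>G \<otimes> 1 + 1 \<otimes> (w|\<^sub>H)\<^sub>+\<close>, where \<open>+\<close> drops the component of degree \<open>0\<close>.
  The irreducible characters of \<open>G \<times> H\<close> are never needed.
\<close>

section \<open>Exterior powers of matrices\<close>

text \<open>Virtual characters are functions here, so representations enter only through traces. The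
  bridge from the minors that define exterior powers to the exponential formula is Cauchy-Binet: it
  makes exterior powers multiplicative, hence compatible with similarity, and Schur
  triangularization then leaves elementary symmetric functions of the eigenvalues, tied to power
  sums by Newton's identities. The formula stays inside the ring because the trace of any
  representation is an integral combination of irreducible characters, by block triangularization.

  Both graded rings are quotients, of sequences on one side and of formal sums on the other.
  Computations use representatives, up to the next filtration step or up to the tensor relations.
  Injectivity is tested by additive functionals on formal sums, \<open>a \<otimes> b\<close> to
  \<open>deg b * a_n\<close> and to \<open>deg a * b_n\<close>, which respect the relations and
  detect the two restrictions degree by degree. Surjectivity comes from an explicit preimage of each
  pure tensor.\<close>

lemma sorted_wrt_subseqs: "ys \<in> set (subseqs xs) \<Longrightarrow> sorted_wrt P xs \<Longrightarrow> sorted_wrt P ys"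
proof (induction xs arbitrary: ys)
  case (Cons x xs)
  have sub: "set zs \<subseteq> set xs" if "zs \<in> set (subseqs xs)" for zs
    using that subseqs_powset[of xs] by blast
  show ?case using Cons sub by (auto simp: Let_def) blast
qed simp

lemma set_subseqs_strict_sorted:
  fixes xs :: "'a::linorder list"
  assumes "sorted_wrt (<) xs"
  shows "set (subseqs xs) = {ys. sorted_wrt (<) ys \<and> set ys \<subseteq> set xs}"
proof (intro equalityI subsetI)
  fix ys assume "ys \<in> set (subseqs xs)"
  then show "ys \<in> {ys. sorted_wrt (<) ys \<and> set ys \<subseteq> set xs}"
    using sorted_wrt_subseqs[OF _ assms] subseqs_powset[of xs] by blast
next
  fix ys assume ys: "ys \<in> {ys. sorted_wrt (<) ys \<and> set ys \<subseteq> set xs}"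
  then obtain zs where zs: "zs \<in> set (subseqs xs)" "set zs = set ys"
    using subset_subseqs[of "set ys" xs] by auto
  have "zs = ys" using ys zs sorted_wrt_subseqs[OF zs(1) assms] strict_sorted_equal by blast
  then show "ys \<in> set (subseqs xs)" using zs by simp
qed

lemma set_exterior_basis:
  "set (exterior_basis d n) = {K. sorted_wrt (<) K \<and> set K \<subseteq> {0..<d} \<and> length K = n}"
proof -
  have "sorted_wrt (<) [0..<d]" by simp
  from set_subseqs_strict_sorted[OF this] show ?thesis
    unfolding exterior_basis_def by auto
qed

lemma distinct_exterior_basis: "distinct (exterior_basis d n)"
proof -
  have "distinct (map set (subseqs [0..<d]))" by (rule distinct_set_subseqs) simp
  then show ?thesis unfolding exterior_basis_def
    by (simp add: distinct_map)
qed

text \<open>An injection of \<open>{0..<n}\<close> into \<open>{0..<d}\<close> is determined by its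
  image, listed increasingly as \<open>K\<close>, together with the permutation \<open>p\<close>
  that tells in which order the entries of \<open>K\<close> are taken. Sorting the terms of an
  expansion by image turns it into a sum over \<open>n\<close>-element index sets.\<close>

lemma bij_betw_injections:
  "bij_betw (\<lambda>(K, p). \<lambda>i\<in>{0..<n}. K ! p i)
     (set (exterior_basis d n) \<times> {p. p permutes {0..<n}})
     {f \<in> {0..<n} \<rightarrow>\<^sub>E {0..<d}. inj_on f {0..<n}}"
proof (rule bij_betw_imageI)
  let ?F = "\<lambda>(K, p). \<lambda>i\<in>{0..<n}. K ! p i"
  have lt: "p i < n" if "p permutes {0..<n}" "i < n" for p i
    using that permutes_in_image[OF that(1), of i] by auto
  have img: "(\<lambda>i. K ! p i) ` {0..<n} = set K" if "p permutes {0..<n}" "length K = n" for K :: "nat list" and p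
  proof -
    have "(\<lambda>i. K ! p i) ` {0..<n} = (!) K ` (p ` {0..<n})" by (simp add: image_image)
    also have "\<dots> = (!) K ` {0..<length K}" using permutes_image[OF that(1)] that(2) by simp
    also have "\<dots> = set K" using nth_image[of "length K" K] by (simp add: atLeast0LessThan)
    finally show ?thesis .
  qed
  show "inj_on ?F (set (exterior_basis d n) \<times> {p. p permutes {0..<n}})"
  proof (rule inj_onI, clarsimp simp: set_exterior_basis)
    fix K K' :: "nat list" and p p'
    assume K: "sorted_wrt (<) K" "n = length K" and K': "sorted_wrt (<) K'" "length K' = length K"
      and p: "p permutes {0..<length K}" and p': "p' permutes {0..<length K}"
      and eq: "(\<lambda>i\<in>{0..<length K}. K ! p i) = (\<lambda>i\<in>{0..<length K}. K' ! p' i)"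
    have eq': "K ! p i = K' ! p' i" if "i < length K" for i using fun_cong[OF eq, of i] that by simp
    have "(\<lambda>i. K ! p i) ` {0..<length K} = (\<lambda>i. K' ! p' i) ` {0..<length K}"
      using eq' by (intro image_cong) auto
    then have "set K = set K'" using img K(2) K'(2) p p' by simp
    then have KK: "K = K'" using strict_sorted_equal K K' by blast
    have "distinct K" using K(1) by (simp add: strict_sorted_iff)
    then have "p i = p' i" if "i < length K" for i
      using eq'[OF that] lt p p' that K(2) unfolding KK
      by (metis KK nth_eq_iff_index_eq)
    moreover have "p i = p' i" if "\<not> i < length K" for i
      using that p p' by (simp add: permutes_def)
    ultimately show "K = K' \<and> p = p'" using KK by blast
  qed
  show "?F ` (set (exterior_basis d n) \<times> {p. p permutes {0..<n}}) =
      {f \<in> {0..<n} \<rightarrow>\<^sub>E {0..<d}. inj_on f {0..<n}}"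
  proof (intro equalityI subsetI)
    fix f assume "f \<in> ?F ` (set (exterior_basis d n) \<times> {p. p permutes {0..<n}})"
    then obtain K p where f: "f = (\<lambda>i\<in>{0..<n}. K ! p i)" and K: "sorted_wrt (<) K" "length K = n"
      "set K \<subseteq> {0..<d}" and p: "p permutes {0..<n}" by (auto simp: set_exterior_basis)
    have dK: "distinct K" using K(1) by (simp add: strict_sorted_iff)
    have "f \<in> {0..<n} \<rightarrow>\<^sub>E {0..<d}"
      unfolding f using K lt[OF p] by (auto dest!: nth_mem)
    moreover have "inj_on f {0..<n}"
    proof (rule inj_onI)
      fix i j assume ij: "i \<in> {0..<n}" "j \<in> {0..<n}" "f i = f j"
      then have "p i = p j" using dK lt[OF p] K(2) by (simp add: f nth_eq_iff_index_eq)
      then show "i = j" using permutes_inj[OF p] by (simp add: inj_def)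
    qed
    ultimately show "f \<in> {f \<in> {0..<n} \<rightarrow>\<^sub>E {0..<d}. inj_on f {0..<n}}" by simp
  next
    fix f assume f: "f \<in> {f \<in> {0..<n} \<rightarrow>\<^sub>E {0..<d}. inj_on f {0..<n}}"
    define K where "K = sorted_list_of_set (f ` {0..<n})"
    have K: "sorted_wrt (<) K" "set K = f ` {0..<n}" "length K = n"
      using f by (simp_all add: K_def card_image)
    have dK: "distinct K" using K(1) by (simp add: strict_sorted_iff)
    \<comment> \<open>\<open>p i\<close> is the position of \<open>f i\<close> in the sorted image;
      outside \<open>{0..<n}\<close> it is the identity, as \<open>permutes\<close> demands.\<close>
    define p where "p i = (if i < n then (THE j. j < n \<and> K ! j = f i) else i)" for i
    have ex1: "\<exists>!j. j < n \<and> K ! j = f i" if "i < n" for i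
    proof -
      have "f i \<in> set K" using that K by auto
      then show ?thesis using dK K(3) by (metis in_set_conv_nth nth_eq_iff_index_eq)
    qed
    have p: "p i < n" "K ! p i = f i" if "i < n" for i
      using theI'[OF ex1[OF that]] that by (simp_all add: p_def)
    have "inj_on p {0..<n}"
      using p f by (intro inj_onI) (metis (mono_tags, lifting) atLeastLessThan_iff inj_onD mem_Collect_eq)
    moreover have "p ` {0..<n} \<subseteq> {0..<n}" using p by auto
    ultimately have "bij_betw p {0..<n} {0..<n}"
      by (simp add: bij_betw_def endo_inj_surj)
    then have perm: "p permutes {0..<n}"
      by (rule bij_imp_permutes) (simp add: p_def)
    have "f = ?F (K, p)"
      using f p by (auto simp: fun_eq_iff PiE_def extensional_def restrict_def)
    moreover have "K \<in> set (exterior_basis d n)" using K f by (auto simp: set_exterior_basis)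
    ultimately show "f \<in> ?F ` (set (exterior_basis d n) \<times> {p. p permutes {0..<n}})"
      using perm by blast
  qed
qed

lemma det_as_sum:
  "det (mat n n f) = (\<Sum>p | p permutes {0..<n}. of_int (sign p) * (\<Prod>i = 0..<n. f (i, p i)))"
proof -
  have "(\<Prod>i = 0..<n. mat n n f $$ (i, p i)) = (\<Prod>i = 0..<n. f (i, p i))" if "p permutes {0..<n}" for p
    using permutes_in_image[OF that] by (intro prod.cong) auto
  then show ?thesis by (simp add: det_def)
qed

text \<open>Expanding the product of the inner sums yields one term for every function
  \<open>f\<close> from the row indices to \<open>{0..<d}\<close>, weighted by the determinant
  \<open>D f\<close> of the chosen rows of \<open>Y\<close>. Repeated rows kill the non-injective
  \<open>f\<close>; the injective ones are grouped by image, and the permutation contributes the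
  sign that rebuilds the minor of \<open>X\<close>.\<close>

theorem Cauchy_Binet:
  fixes X Y :: "nat \<Rightarrow> nat \<Rightarrow> 'a::comm_ring_1"
  shows "det (mat n n (\<lambda>(i, j). \<Sum>k<d. X i k * Y k j)) =
    (\<Sum>K\<in>set (exterior_basis d n).
       det (mat n n (\<lambda>(i, j). X i (K ! j))) * det (mat n n (\<lambda>(i, j). Y (K ! i) j)))"
proof -
  let ?P = "{p. p permutes {0..<n}}"
  define D where "D f = det (mat n n (\<lambda>(i, j). Y (f i) j))" for f :: "nat \<Rightarrow> nat"
  have D_cong: "D f = D g" if "\<And>i. i < n \<Longrightarrow> f i = g i" for f g
    unfolding D_def using that by (intro arg_cong[where f = det]) (auto intro!: eq_matI)
  have D_noninj: "D f = 0" if "\<not> inj_on f {0..<n}" for f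
  proof -
    from that obtain i j where ij: "i < n" "j < n" "i \<noteq> j" "f i = f j" by (auto simp: inj_on_def)
    show ?thesis unfolding D_def
      by (rule det_identical_rows[of _ n i j]) (use ij in \<open>auto intro!: eq_vecI\<close>)
  qed
  have D_perm: "D (\<lambda>i. K ! p i) = of_int (sign p) * D (\<lambda>i. K ! i)" if p: "p \<in> ?P" for K p
  proof -
    have "mat n n (\<lambda>(i, j). Y (K ! p i) j) =
        mat n n (\<lambda>(i, j). mat n n (\<lambda>(i, j). Y (K ! i) j) $$ (p i, j))"
      using permutes_in_image[of p "{0..<n}"] p by (intro eq_matI) auto
    then show ?thesis unfolding D_def using det_permute_rows[of "mat n n (\<lambda>(i, j). Y (K ! i) j)" n p] p
      by simp
  qed
  have fin: "finite ({0..<n} \<rightarrow>\<^sub>E {0..<d})" by (intro finite_PiE) auto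
  have "det (mat n n (\<lambda>(i, j). \<Sum>k<d. X i k * Y k j)) =
      (\<Sum>p\<in>?P. of_int (sign p) * (\<Prod>i = 0..<n. \<Sum>k\<in>{0..<d}. X i k * Y k (p i)))"
    by (simp add: det_as_sum atLeast0LessThan)
  also have "\<dots> = (\<Sum>p\<in>?P. \<Sum>f\<in>{0..<n} \<rightarrow>\<^sub>E {0..<d}.
      (\<Prod>i = 0..<n. X i (f i)) * (of_int (sign p) * (\<Prod>i = 0..<n. Y (f i) (p i))))"
    by (subst prod_sum_PiE) (auto simp: sum_distrib_left prod.distrib ac_simps)
  also have "\<dots> = (\<Sum>f\<in>{0..<n} \<rightarrow>\<^sub>E {0..<d}. (\<Prod>i = 0..<n. X i (f i)) * D f)"
    by (subst sum.swap) (simp add: D_def det_as_sum sum_distrib_left)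
  also have "\<dots> = (\<Sum>f\<in>{f \<in> {0..<n} \<rightarrow>\<^sub>E {0..<d}. inj_on f {0..<n}}. (\<Prod>i = 0..<n. X i (f i)) * D f)"
    by (rule sum.mono_neutral_right[OF fin]) (auto simp: D_noninj)
  also have "\<dots> = (\<Sum>(K, p)\<in>set (exterior_basis d n) \<times> ?P.
      (\<Prod>i = 0..<n. X i (K ! p i)) * D (\<lambda>i. K ! p i))"
  proof -
    have "D (\<lambda>i\<in>{0..<n}. K ! p i) = D (\<lambda>i. K ! p i)" for K :: "nat list" and p
      by (rule D_cong) simp
    then show ?thesis
      by (subst sum.reindex_bij_betw[OF bij_betw_injections, symmetric]) (simp add: case_prod_unfold)
  qed
  also have "\<dots> = (\<Sum>K\<in>set (exterior_basis d n). \<Sum>p\<in>?P.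
      (of_int (sign p) * (\<Prod>i = 0..<n. X i (K ! p i))) * D (\<lambda>i. K ! i))"
    by (subst sum.cartesian_product[symmetric]) (auto intro!: sum.cong simp: D_perm)
  also have "\<dots> = (\<Sum>K\<in>set (exterior_basis d n).
      det (mat n n (\<lambda>(i, j). X i (K ! j))) * D (\<lambda>i. K ! i))"
    by (simp add: det_as_sum sum_distrib_right)
  finally show ?thesis by (simp add: D_def)
qed

section \<open>Functoriality of the exterior power matrices\<close>

lemma exterior_power_mat_carrier [simp]:
  assumes "A \<in> carrier_mat d d"
  shows "exterior_power_mat n A \<in> carrier_mat (length (exterior_basis d n)) (length (exterior_basis d n))"
  using assms by (simp add: exterior_power_mat_def Let_def)

lemma exterior_power_mat_index:
  assumes "A \<in> carrier_mat d d" "a < length (exterior_basis d n)" "b < length (exterior_basis d n)"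
  shows "exterior_power_mat n A $$ (a, b) =
    det (mat n n (\<lambda>(i, j). A $$ (exterior_basis d n ! a ! i, exterior_basis d n ! b ! j)))"
  using assms by (simp add: exterior_power_mat_def Let_def)

lemma exterior_basis_nth:
  assumes "a < length (exterior_basis d n)"
  shows "sorted_wrt (<) (exterior_basis d n ! a)" "length (exterior_basis d n ! a) = n"
    "i < n \<Longrightarrow> exterior_basis d n ! a ! i < d"
proof -
  have *: "exterior_basis d n ! a \<in> set (exterior_basis d n)" using assms by simp
  then show "sorted_wrt (<) (exterior_basis d n ! a)" and l: "length (exterior_basis d n ! a) = n"
    unfolding set_exterior_basis by auto
  show "exterior_basis d n ! a ! i < d" if "i < n"
    using * that l nth_mem[of i "exterior_basis d n ! a"] unfolding set_exterior_basis by fastforce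
qed

lemma exterior_power_mat_mult:
  assumes A: "A \<in> carrier_mat d d" and B: "B \<in> carrier_mat d d"
  shows "exterior_power_mat n (A * B) = exterior_power_mat n A * exterior_power_mat n B"
proof (rule eq_matI)
  let ?B = "exterior_basis d n"
  fix a b assume "a < dim_row (exterior_power_mat n A * exterior_power_mat n B)"
    "b < dim_col (exterior_power_mat n A * exterior_power_mat n B)"
  then have ab: "a < length ?B" "b < length ?B"
    using exterior_power_mat_carrier[OF A, of n] exterior_power_mat_carrier[OF B, of n] by auto
  have "exterior_power_mat n (A * B) $$ (a, b) =
      det (mat n n (\<lambda>(i, j). \<Sum>k<d. A $$ (?B ! a ! i, k) * B $$ (k, ?B ! b ! j)))"
    unfolding exterior_power_mat_index[OF mult_carrier_mat[OF A B] ab]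
    using A B exterior_basis_nth(3)[OF ab(1)] exterior_basis_nth(3)[OF ab(2)]
    by (intro arg_cong[where f = det] eq_matI)
      (auto simp: scalar_prod_def atLeast0LessThan intro!: sum.cong)
  also have "\<dots> = (\<Sum>K\<in>set ?B. det (mat n n (\<lambda>(i, j). A $$ (?B ! a ! i, K ! j))) *
      det (mat n n (\<lambda>(i, j). B $$ (K ! i, ?B ! b ! j))))"
    by (rule Cauchy_Binet)
  also have "\<dots> = (\<Sum>c<length ?B. det (mat n n (\<lambda>(i, j). A $$ (?B ! a ! i, ?B ! c ! j))) *
      det (mat n n (\<lambda>(i, j). B $$ (?B ! c ! i, ?B ! b ! j))))"
    using sum.reindex_bij_betw[OF bij_betw_nth[OF distinct_exterior_basis refl refl]] by (rule sym)
  also have "\<dots> = (exterior_power_mat n A * exterior_power_mat n B) $$ (a, b)"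
    using ab exterior_power_mat_carrier[OF A, of n] exterior_power_mat_carrier[OF B, of n]
    by (auto simp: scalar_prod_def atLeast0LessThan exterior_power_mat_index[OF A]
        exterior_power_mat_index[OF B] intro!: sum.cong)
  finally show "exterior_power_mat n (A * B) $$ (a, b) =
      (exterior_power_mat n A * exterior_power_mat n B) $$ (a, b)" .
qed (use A B in \<open>simp_all add: exterior_power_mat_def Let_def\<close>)

lemma exterior_power_mat_one: "exterior_power_mat n (1\<^sub>m d) = 1\<^sub>m (length (exterior_basis d n))"
proof (rule eq_matI)
  let ?B = "exterior_basis d n"
  fix a b assume "a < dim_row (1\<^sub>m (length ?B))" "b < dim_col (1\<^sub>m (length ?B))"
  then have ab: "a < length ?B" "b < length ?B" by auto
  note nth = exterior_basis_nth[OF ab(1)] exterior_basis_nth[OF ab(2)]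
  have dist: "distinct (?B ! a)" "distinct (?B ! b)" using nth by (simp_all add: strict_sorted_iff)
  have eq: "exterior_power_mat n (1\<^sub>m d) $$ (a, b) =
      det (mat n n (\<lambda>(i, j). if ?B ! a ! i = ?B ! b ! j then 1 else 0))"
    unfolding exterior_power_mat_index[OF one_carrier_mat ab] using nth
    by (intro arg_cong[where f = det] eq_matI) auto
  show "exterior_power_mat n (1\<^sub>m d) $$ (a, b) = 1\<^sub>m (length ?B) $$ (a, b)"
  proof (cases "a = b")
    case True
    then have "mat n n (\<lambda>(i, j). if ?B ! a ! i = ?B ! b ! j then 1 else 0) = (1\<^sub>m n :: complex mat)"
      using dist nth by (intro eq_matI) (auto simp: nth_eq_iff_index_eq)
    then show ?thesis using True ab eq by simp
  next
    case False
    then have ne: "?B ! a \<noteq> ?B ! b" using distinct_exterior_basis ab by (simp add: nth_eq_iff_index_eq)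
    \<comment> \<open>Two different increasing lists of equal length cannot have nested sets of
      entries, so some entry of the row list is missing from the column list; the corresponding row
      of the minor is zero.\<close>
    have "\<not> set (?B ! a) \<subseteq> set (?B ! b)"
    proof
      assume "set (?B ! a) \<subseteq> set (?B ! b)"
      moreover have "card (set (?B ! a)) = card (set (?B ! b))" using dist nth by (simp add: distinct_card)
      ultimately have "set (?B ! a) = set (?B ! b)" by (simp add: card_subset_eq)
      then show False using ne strict_sorted_equal nth by metis
    qed
    then obtain i where i: "i < n" "?B ! a ! i \<notin> set (?B ! b)" using nth by (metis in_set_conv_nth subsetI)
    have "(\<Prod>i = 0..<n. if ?B ! a ! i = ?B ! b ! p i then 1 else (0::complex)) = 0"
      if "p permutes {0..<n}" for p
    proof (rule prod_zero)
      have "p i < n" using permutes_in_image[OF that, of i] i by auto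
      then have "?B ! a ! i \<noteq> ?B ! b ! p i" using i nth by (metis nth_mem)
      then show "\<exists>i\<in>{0..<n}. (if ?B ! a ! i = ?B ! b ! p i then 1 else (0::complex)) = 0"
        using i by (intro bexI[of _ i]) auto
    qed simp
    then have "exterior_power_mat n (1\<^sub>m d) $$ (a, b) = 0"
      unfolding eq det_as_sum by (intro sum.neutral ballI) (simp only: mem_Collect_eq prod.case mult_zero_right)
    then show ?thesis using False ab by simp
  qed
qed (auto simp: exterior_power_mat_def Let_def)

section \<open>Traces of exterior powers\<close>

lemma mat_trace_mult_commute:
  assumes "A \<in> carrier_mat n m" "B \<in> carrier_mat m n"
  shows "mat_trace (A * B) = mat_trace (B * A)"
proof -
  have "mat_trace (A * B) = (\<Sum>i<n. \<Sum>k<m. A $$ (i, k) * B $$ (k, i))"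
    using assms by (auto simp: mat_trace_def scalar_prod_def atLeast0LessThan intro!: sum.cong)
  also have "\<dots> = (\<Sum>k<m. \<Sum>i<n. B $$ (k, i) * A $$ (i, k))"
    by (subst sum.swap) (simp add: mult.commute)
  also have "\<dots> = mat_trace (B * A)"
    using assms by (auto simp: mat_trace_def scalar_prod_def atLeast0LessThan intro!: sum.cong)
  finally show ?thesis .
qed

lemma mat_trace_conjugate:
  assumes "P \<in> carrier_mat n n" "Q \<in> carrier_mat n n" "B \<in> carrier_mat n n" "Q * P = 1\<^sub>m n"
  shows "mat_trace (P * B * Q) = mat_trace B"
proof -
  have "mat_trace (P * B * Q) = mat_trace (Q * (P * B))"
    using assms by (intro mat_trace_mult_commute[of _ n n]) auto
  also have "Q * (P * B) = Q * P * B" using assms by (intro assoc_mult_mat[symmetric]) auto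
  finally show ?thesis using assms by simp
qed

lemma mat_trace_similar:
  assumes "similar_mat A B"
  shows "mat_trace A = mat_trace B"
proof -
  obtain P Q where wit: "similar_mat_wit A B P Q" using assms unfolding similar_mat_def by blast
  define n where "n = dim_row A"
  note w = similar_mat_witD[OF n_def wit]
  show ?thesis unfolding w(3) by (rule mat_trace_conjugate[OF w(6,7,5,2)])
qed

lemma similar_mat_exterior_power:
  assumes "similar_mat A B"
  shows "similar_mat (exterior_power_mat n A) (exterior_power_mat n B)"
proof -
  obtain P Q where wit: "similar_mat_wit A B P Q" using assms unfolding similar_mat_def by blast
  define d where "d = dim_row A"
  note w = similar_mat_witD[OF d_def wit]
  note c = w(4-7) and eq = w(1-3)
  let ?E = "exterior_power_mat n"
  have PQ: "?E P * ?E Q = 1\<^sub>m (length (exterior_basis d n))"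
    "?E Q * ?E P = 1\<^sub>m (length (exterior_basis d n))"
    using c eq by (simp_all add: exterior_power_mat_mult[of _ d, symmetric] exterior_power_mat_one)
  have "?E A = ?E P * ?E B * ?E Q"
    unfolding eq(3) using c by (simp only: exterior_power_mat_mult[OF mult_carrier_mat] exterior_power_mat_mult)
  from similar_mat_witI[OF PQ this] have "similar_mat_wit (?E A) (?E B) (?E P) (?E Q)"
    by (blast intro: exterior_power_mat_carrier c)
  then show ?thesis unfolding similar_mat_def by blast
qed

text \<open>Restricting an upper triangular matrix to an increasing list of indices leaves it upper
  triangular, so each diagonal minor is the product of its diagonal. The right-hand side is the
  \<open>n\<close>-th elementary symmetric function of the diagonal entries of
  \<open>T\<close>.\<close>

lemma mat_trace_exterior_power_upper_triangular:
  assumes T: "T \<in> carrier_mat d d" "upper_triangular T"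
  shows "mat_trace (exterior_power_mat n T) =
    (\<Sum>K\<leftarrow>exterior_basis d n. \<Prod>i\<leftarrow>K. T $$ (i, i))"
proof -
  let ?B = "exterior_basis d n"
  have "exterior_power_mat n T $$ (a, a) = (\<Prod>i\<leftarrow>?B ! a. T $$ (i, i))" if a: "a < length ?B" for a
  proof -
    note nth = exterior_basis_nth[OF a]
    let ?M = "mat n n (\<lambda>(i, j). T $$ (?B ! a ! i, ?B ! a ! j))"
    have "upper_triangular ?M"
    proof (rule upper_triangularI)
      fix i j assume "j < i" "i < dim_row ?M"
      then have ij: "j < i" "i < n" by auto
      then have "?B ! a ! j < ?B ! a ! i" using nth(1,2) by (simp add: sorted_wrt_iff_nth_less)
      then show "?M $$ (i, j) = 0" using ij nth(3)[of i] T by (auto dest: upper_triangularD)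
    qed
    then have "det ?M = prod_list (diag_mat ?M)" by (rule det_upper_triangular[where n = n]) simp
    also have "diag_mat ?M = map (\<lambda>i. T $$ (i, i)) (?B ! a)"
      using nth(2) by (intro nth_equalityI) (auto simp: diag_mat_def)
    finally show ?thesis using exterior_power_mat_index[OF T(1) a a] by simp
  qed
  then have "mat_trace (exterior_power_mat n T) = (\<Sum>a<length ?B. \<Prod>i\<leftarrow>?B ! a. T $$ (i, i))"
    using exterior_power_mat_carrier[OF T(1), of n] by (auto simp: mat_trace_def)
  also have "\<dots> = (\<Sum>K\<leftarrow>?B. \<Prod>i\<leftarrow>K. T $$ (i, i))"
    by (simp add: sum_list_sum_nth atLeast0LessThan)
  finally show ?thesis .
qed

section \<open>Newton's identities as power series\<close>

no_notation vec_index (infixl "$" 100)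
unbundle fps_syntax

text \<open>\<open>p k\<close> stands for the power sum of exponent \<open>k + 1\<close>;
  integration supplies both the shift and the denominator \<open>k + 1\<close> in the exponent. If
  the \<open>p k\<close> are the power sums of a finite list, this is the generating series of its
  elementary symmetric functions.\<close>

definition lambda_series :: "(nat \<Rightarrow> complex) \<Rightarrow> complex fps"
  where "lambda_series p = fps_exp 1 oo fps_integral0 (Abs_fps (\<lambda>k. (-1) ^ k * p k))"

lemma lambda_series_nth_0 [simp]: "lambda_series p $ 0 = 1"
  by (simp add: lambda_series_def)

lemma fps_deriv_lambda_series:
  "fps_deriv (lambda_series p) = lambda_series p * Abs_fps (\<lambda>k. (-1) ^ k * p k)"
  unfolding lambda_series_def
  by (subst fps_compose_deriv) (simp_all add: fps_deriv_fps_integral)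

text \<open>Comparing coefficients of \<open>E' = E Q\<close> expresses \<open>m + 1\<close> times
  the coefficient of degree \<open>m + 1\<close> through lower coefficients, and characteristic zero
  allows the division. Identities between exponential series thus reduce to logarithmic derivatives
  and constant terms.\<close>

lemma fps_log_deriv_unique:
  fixes E F Q :: "'a::field_char_0 fps"
  assumes "fps_deriv E = E * Q" "fps_deriv F = F * Q" "E $ 0 = F $ 0"
  shows "E = F"
proof -
  have "E $ n = F $ n" for n
  proof (induction n rule: less_induct)
    case (less n)
    show ?case
    proof (cases n)
      case (Suc m)
      have "of_nat (Suc m) * E $ Suc m = (\<Sum>i=0..m. E $ i * Q $ (m - i))"
        using arg_cong[OF assms(1), of "\<lambda>f. f $ m"] by (simp add: fps_mult_nth)
      also have "\<dots> = (\<Sum>i=0..m. F $ i * Q $ (m - i))"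
        using less Suc by (intro sum.cong) auto
      also have "\<dots> = of_nat (Suc m) * F $ Suc m"
        using arg_cong[OF assms(2), of "\<lambda>f. f $ m"] by (simp add: fps_mult_nth)
      finally show ?thesis using Suc by (simp del: of_nat_Suc)
    qed (use assms in simp)
  qed
  then show ?thesis by (simp add: fps_eq_iff)
qed

lemma lambda_series_eqI:
  assumes "fps_deriv E = E * Abs_fps (\<lambda>k. (-1) ^ k * p k)" "E $ 0 = 1"
  shows "lambda_series p = E"
  using fps_log_deriv_unique[OF fps_deriv_lambda_series assms(1)] assms(2) by simp

lemma lambda_series_add: "lambda_series (\<lambda>k. p k + q k) = lambda_series p * lambda_series q"
proof (rule lambda_series_eqI)
  have "Abs_fps (\<lambda>k. (-1) ^ k * (p k + q k)) =
      Abs_fps (\<lambda>k. (-1) ^ k * p k) + Abs_fps (\<lambda>k. (-1) ^ k * q k)"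
    by (simp add: fps_eq_iff algebra_simps)
  then show "fps_deriv (lambda_series p * lambda_series q) =
      lambda_series p * lambda_series q * Abs_fps (\<lambda>k. (-1) ^ k * (p k + q k))"
    by (simp add: fps_deriv_lambda_series algebra_simps)
qed simp

lemma lambda_series_0 [simp]: "lambda_series (\<lambda>k. 0) = 1"
  by (rule lambda_series_eqI) (simp_all add: fps_eq_iff)

text \<open>The case of a single eigenvalue: the logarithmic derivative of \<open>1 + c t\<close> is
  a geometric series.\<close>

lemma lambda_series_power: "lambda_series (\<lambda>k. c ^ Suc k) = 1 + fps_const c * fps_X"
proof (rule lambda_series_eqI)
  show "fps_deriv (1 + fps_const c * fps_X) =
      (1 + fps_const c * fps_X) * Abs_fps (\<lambda>k. (-1) ^ k * c ^ Suc k)"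
  proof (rule fps_ext)
    fix n show "fps_deriv (1 + fps_const c * fps_X) $ n =
      ((1 + fps_const c * fps_X) * Abs_fps (\<lambda>k. (-1) ^ k * c ^ Suc k)) $ n"
      by (cases n) (simp_all add: distrib_right mult.assoc)
  qed
qed simp

lemma lambda_series_sum_list_power:
  "lambda_series (\<lambda>k. \<Sum>x\<leftarrow>xs. c x ^ Suc k) = (\<Prod>x\<leftarrow>xs. 1 + fps_const (c x) * fps_X)"
proof (induction xs)
  case (Cons x xs)
  then show ?case using lambda_series_add[of "\<lambda>k. c x ^ Suc k" "\<lambda>k. \<Sum>x\<leftarrow>xs. c x ^ Suc k"]
    by (simp only: list.map prod_list.Cons sum_list.Cons lambda_series_power)
qed simp

lemma lambda_series_of_nat: "lambda_series (\<lambda>k. of_nat d) = (1 + fps_X) ^ d"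
  using lambda_series_sum_list_power[of "\<lambda>_. 1" "[0..<d]"]
  by (simp add: map_replicate_const sum_list_replicate)

text \<open>The recursion of \<open>subseqs\<close> at its head, take it or leave it, matches
  multiplication by one factor \<open>1 + c x t\<close>.\<close>

lemma prod_list_fps_nth:
  fixes c :: "'b \<Rightarrow> 'a::comm_ring_1"
  shows "(\<Prod>x\<leftarrow>xs. 1 + fps_const (c x) * fps_X) $ n =
    (\<Sum>K\<leftarrow>filter (\<lambda>K. length K = n) (subseqs xs). \<Prod>x\<leftarrow>K. c x)"
proof (induction xs arbitrary: n)
  case (Cons x xs)
  show ?case
  proof (cases n)
    case (Suc m)
    have "(\<Prod>x\<leftarrow>x # xs. 1 + fps_const (c x) * fps_X) $ n =
        (\<Prod>x\<leftarrow>xs. 1 + fps_const (c x) * fps_X) $ n +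
        c x * (\<Prod>x\<leftarrow>xs. 1 + fps_const (c x) * fps_X) $ m"
      using Suc by (simp add: distrib_right mult.assoc)
    then show ?thesis unfolding Cons.IH using Suc
      by (simp add: Let_def filter_map o_def sum_list_const_mult)
  qed (use Cons.IH[of 0] in \<open>simp_all add: Let_def filter_map o_def distrib_right mult.assoc\<close>)
qed simp

lemma upper_triangular_mult:
  fixes A B :: "'a::semiring_0 mat"
  assumes A: "A \<in> carrier_mat n n" "upper_triangular A" and B: "B \<in> carrier_mat n n" "upper_triangular B"
  shows "upper_triangular (A * B)" "i < n \<Longrightarrow> (A * B) $$ (i, i) = A $$ (i, i) * B $$ (i, i)"
proof -
  have zero: "A $$ (i, k) * B $$ (k, j) = 0" if "i < n" "j < n" "k < n" "k < i \<or> j < k" for i j k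
    using that upper_triangularD[OF A(2), of k i] upper_triangularD[OF B(2), of j k] A(1) B(1) by auto
  show "upper_triangular (A * B)"
  proof (rule upper_triangularI)
    fix i j assume ij: "j < i" "i < dim_row (A * B)"
    have "A $$ (i, k) * B $$ (k, j) = 0" if "k < n" for k
      by (rule zero) (use ij A(1) that in auto)
    then show "(A * B) $$ (i, j) = 0" using ij A(1) B(1)
      by (simp add: scalar_prod_def)
  qed
  show "(A * B) $$ (i, i) = A $$ (i, i) * B $$ (i, i)" if i: "i < n"
  proof -
    have "(A * B) $$ (i, i) = (\<Sum>k = 0..<n. A $$ (i, k) * B $$ (k, i))"
      using i A(1) B(1) by (simp add: scalar_prod_def)
    also have "\<dots> = (\<Sum>k\<in>{i}. A $$ (i, k) * B $$ (k, i))"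
    proof (rule sum.mono_neutral_right)
      show "\<forall>k\<in>{0..<n} - {i}. A $$ (i, k) * B $$ (k, i) = 0"
      proof
        fix k assume "k \<in> {0..<n} - {i}"
        then show "A $$ (i, k) * B $$ (k, i) = 0" using zero[of i i k] i by force
      qed
    qed (use i in auto)
    finally show ?thesis by simp
  qed
qed

lemma upper_triangular_pow:
  fixes A :: "'a::semiring_1 mat"
  assumes A: "A \<in> carrier_mat n n" "upper_triangular A"
  shows "upper_triangular (A ^\<^sub>m k) \<and> (\<forall>i<n. (A ^\<^sub>m k) $$ (i, i) = A $$ (i, i) ^ k)"
proof (induction k)
  case (Suc k)
  then show ?case using upper_triangular_mult[OF pow_carrier_mat[OF A(1)] _ A, of k]
    by (auto simp: power_commutes)
qed (use A in auto)

text \<open>Both sides are invariant under similarity, so \<open>A\<close> may be replaced by an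
  upper triangular \<open>T\<close>. There the left side is an elementary symmetric function of the
  diagonal, the right side is formed from the power sums of the diagonal, and both are a coefficient
  of the product of the factors \<open>1 + T $$ (i, i) t\<close>.\<close>

lemma mat_trace_exterior_power_mat:
  assumes A: "A \<in> carrier_mat d d"
  shows "mat_trace (exterior_power_mat n A) = lambda_series (\<lambda>k. mat_trace (A ^\<^sub>m Suc k)) $ n"
proof -
  obtain es where "char_poly A = (\<Prod>a\<leftarrow>es. [:- a, 1:])" using char_poly_factorized[OF A] by blast
  from schur_decomposition_exists[OF A this]
  obtain T where T: "T \<in> carrier_mat d d" "upper_triangular T" "similar_mat A T" by blast
  have pow: "mat_trace (A ^\<^sub>m k) = (\<Sum>i\<leftarrow>[0..<d]. T $$ (i, i) ^ k)" for k
  proof -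
    have "mat_trace (A ^\<^sub>m k) = mat_trace (T ^\<^sub>m k)"
      using T(3) similar_mat_wit_pow unfolding similar_mat_def by (blast intro: mat_trace_similar[unfolded similar_mat_def])
    also have "\<dots> = (\<Sum>i<d. T $$ (i, i) ^ k)"
      using upper_triangular_pow[OF T(1,2), of k] T(1) by (simp add: mat_trace_def pow_mat_dim_square[OF T(1)])
    finally show ?thesis by (simp add: sum_list_sum_nth atLeast0LessThan)
  qed
  have "mat_trace (exterior_power_mat n A) = mat_trace (exterior_power_mat n T)"
    by (rule mat_trace_similar[OF similar_mat_exterior_power[OF T(3)]])
  also have "\<dots> = (\<Prod>i\<leftarrow>[0..<d]. 1 + fps_const (T $$ (i, i)) * fps_X) $ n"
    by (simp add: mat_trace_exterior_power_upper_triangular[OF T(1,2)] exterior_basis_def prod_list_fps_nth)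
  finally show ?thesis unfolding pow lambda_series_sum_list_power .
qed

section \<open>Characters of representations\<close>

notation vec_index (infixl "$v" 100)

text \<open>The matrix of the inverse element inverts the matrix of \<open>g\<close>, so
  invertibility follows from multiplicativity and the value at the identity.\<close>

lemma (in group) representation_iff:
  "representation G d \<rho> \<longleftrightarrow>
    (\<forall>g\<in>carrier G. \<rho> g \<in> carrier_mat d d) \<and>
    (\<forall>g\<in>carrier G. \<forall>h\<in>carrier G. \<rho> (g \<otimes> h) = \<rho> g * \<rho> h) \<and> \<rho> \<one> = 1\<^sub>m d"
    (is "_ \<longleftrightarrow> ?R")
proof
  let ?M = "ring_mat TYPE(complex) d ()"
  interpret M: ring ?M by (rule ring_mat)
  interpret GL: group "GL_complex d" unfolding GL_complex_def by (rule M.units_group)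
  have carr: "carrier (GL_complex d) \<subseteq> carrier_mat d d"
    by (auto simp: GL_complex_def units_of_def Units_def ring_mat_simps)
  have mult: "x \<otimes>\<^bsub>GL_complex d\<^esub> y = x * y" for x y
    by (simp add: GL_complex_def units_of_def ring_mat_simps)
  have one: "\<one>\<^bsub>GL_complex d\<^esub> = 1\<^sub>m d"
    by (simp add: GL_complex_def units_of_def ring_mat_simps)
  {
    assume "representation G d \<rho>"
    then have hom: "\<rho> \<in> hom G (GL_complex d)" by (simp add: representation_def)
    interpret group_hom G "GL_complex d" \<rho> using hom by unfold_locales
    show ?R using hom carr hom_one by (auto simp: hom_def mult one)
  }
  assume R: ?R
  have "\<rho> g \<in> carrier (GL_complex d)" if g: "g \<in> carrier G" for g
  proof -
    have "\<rho> (inv g) * \<rho> g = 1\<^sub>m d" "\<rho> g * \<rho> (inv g) = 1\<^sub>m d"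
      using R g by (metis inv_closed l_inv, metis inv_closed r_inv)
    then show ?thesis using R g
      by (auto simp: GL_complex_def units_of_def Units_def ring_mat_simps intro!: bexI[of _ "\<rho> (inv g)"])
  qed
  then show "representation G d \<rho>"
    unfolding representation_def using R by (auto simp: hom_def mult)
qed

section \<open>Characters as integral combinations of irreducible characters\<close>

definition principal_block :: "'a mat \<Rightarrow> nat list \<Rightarrow> 'a mat"
  where "principal_block M xs = mat (length xs) (length xs) (\<lambda>(i, j). M $$ (xs ! i, xs ! j))"

lemma principal_block_carrier [simp]: "principal_block M xs \<in> carrier_mat (length xs) (length xs)"
  by (simp add: principal_block_def)

lemma principal_block_mult:
  fixes M N :: "'a::semiring_0 mat"
  assumes M: "M \<in> carrier_mat d d" and N: "N \<in> carrier_mat d d"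
    and xs: "distinct xs" "set xs \<subseteq> {..<d}"
    and zero: "\<And>a b c. a \<in> set xs \<Longrightarrow> b \<in> set xs \<Longrightarrow> c < d \<Longrightarrow> c \<notin> set xs \<Longrightarrow>
      M $$ (a, c) = 0 \<or> N $$ (c, b) = 0"
  shows "principal_block (M * N) xs = principal_block M xs * principal_block N xs"
proof (rule eq_matI)
  fix i j assume "i < dim_row (principal_block M xs * principal_block N xs)"
    "j < dim_col (principal_block M xs * principal_block N xs)"
  then have ij: "i < length xs" "j < length xs" by (simp_all add: principal_block_def)
  then have lt: "xs ! i < d" "xs ! j < d" using xs nth_mem by blast+
  have "principal_block (M * N) xs $$ (i, j) = (\<Sum>c<d. M $$ (xs ! i, c) * N $$ (c, xs ! j))"
    using ij lt M N by (simp add: principal_block_def scalar_prod_def atLeast0LessThan)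
  also have "\<dots> = (\<Sum>c\<in>set xs. M $$ (xs ! i, c) * N $$ (c, xs ! j))"
  proof (rule sum.mono_neutral_right)
    show "\<forall>c\<in>{..<d} - set xs. M $$ (xs ! i, c) * N $$ (c, xs ! j) = 0"
      using zero[of "xs ! i" "xs ! j"] ij by fastforce
  qed (use xs in auto)
  also have "\<dots> = (\<Sum>k<length xs. M $$ (xs ! i, xs ! k) * N $$ (xs ! k, xs ! j))"
    using sum.reindex_bij_betw[OF bij_betw_nth[OF xs(1) refl refl]] by (rule sym)
  also have "\<dots> = (principal_block M xs * principal_block N xs) $$ (i, j)"
    using ij by (simp add: principal_block_def scalar_prod_def atLeast0LessThan)
  finally show "principal_block (M * N) xs $$ (i, j) =
    (principal_block M xs * principal_block N xs) $$ (i, j)" .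
qed (simp_all add: principal_block_def)

lemma principal_block_one:
  assumes "distinct xs" "set xs \<subseteq> {..<d}"
  shows "principal_block (1\<^sub>m d) xs = 1\<^sub>m (length xs)"
proof (rule eq_matI)
  fix i j assume "i < dim_row (1\<^sub>m (length xs))" "j < dim_col (1\<^sub>m (length xs))"
  then have ij: "i < length xs" "j < length xs" by auto
  moreover from ij have "xs ! i < d" "xs ! j < d" using assms nth_mem by blast+
  ultimately show "principal_block (1\<^sub>m d) xs $$ (i, j) = 1\<^sub>m (length xs) $$ (i, j)"
    using assms(1) by (simp add: principal_block_def nth_eq_iff_index_eq)
qed (simp_all add: principal_block_def)

lemma mat_trace_principal_block:
  assumes "distinct xs"
  shows "mat_trace (principal_block M xs) = (\<Sum>i\<in>set xs. M $$ (i, i))"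
  using sum.reindex_bij_betw[OF bij_betw_nth[OF assms refl refl], of "\<lambda>i. M $$ (i, i)"]
  by (simp add: mat_trace_def principal_block_def)

lemma subspace_module_vecD:
  assumes "VectorSpace.subspace class_ring W (module_vec TYPE('a::field) d)"
  shows "W \<subseteq> carrier_vec d" "0\<^sub>v d \<in> W" "v \<in> W \<Longrightarrow> w \<in> W \<Longrightarrow> v + w \<in> W" "v \<in> W \<Longrightarrow> c \<cdot>\<^sub>v v \<in> W"
  using assms unfolding VectorSpace.subspace_def submodule_def
  by (auto simp: module_vec_simps class_ring_simps)

lemma subspace_mult_mat_vec_closed:
  assumes sub: "VectorSpace.subspace class_ring W (module_vec TYPE('a::field) d)"
    and P: "P \<in> carrier_mat d m" and cols: "\<And>j. j < m \<Longrightarrow> col P j \<in> W" and c: "c \<in> carrier_vec m"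
  shows "P *\<^sub>v c \<in> W"
proof -
  note W = subspace_module_vecD[OF sub]
  have "P *\<^sub>v vec m (\<lambda>i. if i < k then c $v i else 0) \<in> W" if "k \<le> m" for k
    using that
  proof (induction k)
    case 0
    have "P *\<^sub>v vec m (\<lambda>i. if i < 0 then c $v i else 0) = 0\<^sub>v d"
      using P by (intro eq_vecI) (auto simp: scalar_prod_def)
    then show ?case using W(2) by simp
  next
    case (Suc k)
    have "P *\<^sub>v vec m (\<lambda>i. if i < Suc k then c $v i else 0) =
        P *\<^sub>v vec m (\<lambda>i. if i < k then c $v i else 0) + c $v k \<cdot>\<^sub>v col P k"
    proof (rule eq_vecI)
      fix i assume "i < dim_vec (P *\<^sub>v vec m (\<lambda>i. if i < k then c $v i else 0) + c $v k \<cdot>\<^sub>v col P k)"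
      then have i: "i < d" using P by simp
      have "(\<Sum>j = 0..<m. P $$ (i, j) * (if j < Suc k then c $v j else 0)) =
          (\<Sum>j = 0..<m. P $$ (i, j) * (if j < k then c $v j else 0) + (if j = k then P $$ (i, k) * c $v k else 0))"
        by (intro sum.cong) (auto simp: less_Suc_eq)
      then show "(P *\<^sub>v vec m (\<lambda>i. if i < Suc k then c $v i else 0)) $v i =
          (P *\<^sub>v vec m (\<lambda>i. if i < k then c $v i else 0) + c $v k \<cdot>\<^sub>v col P k) $v i"
        using i P Suc.prems by (simp add: scalar_prod_def sum.distrib mult.commute)
    qed (use P in simp)
    then show ?case using Suc W(3,4) cols by simp
  qed
  moreover have "vec m (\<lambda>i. if i < m then c $v i else 0) = c" using c by (intro eq_vecI) auto
  ultimately show ?thesis using order_refl by metis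
qed

lemma invertible_mat_inverseE:
  fixes P :: "'a::field mat"
  assumes "P \<in> carrier_mat d d" "det P \<noteq> 0"
  obtains Q where "Q \<in> carrier_mat d d" "P * Q = 1\<^sub>m d" "Q * P = 1\<^sub>m d"
  using det_non_zero_imp_unit[OF assms, of undefined] unfolding Units_def
  by (auto simp: ring_mat_simps)

text \<open>A matrix adapted to \<open>W\<close> is obtained from the identity by exchanging, as long as possible, a
  column for a vector of \<open>W\<close>; \<open>I\<close> is the set of exchanged columns.\<close>
lemma subspace_adapted_basis:
  fixes W :: "'a::field vec set"
  assumes sub: "VectorSpace.subspace class_ring W (module_vec TYPE('a) d)"
    and ne: "W \<noteq> {0\<^sub>v d}" "W \<noteq> carrier_vec d"
  obtains P Q I where "P \<in> carrier_mat d d" "Q \<in> carrier_mat d d" "P * Q = 1\<^sub>m d" "Q * P = 1\<^sub>m d"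
    "I \<noteq> {}" "I \<subset> {..<d}" "\<And>j. j \<in> I \<Longrightarrow> col P j \<in> W"
    "\<And>v i. v \<in> W \<Longrightarrow> i < d \<Longrightarrow> i \<notin> I \<Longrightarrow> (Q *\<^sub>v v) $v i = 0"
proof -
  note W = subspace_module_vecD[OF sub]
  define good where "good P I \<longleftrightarrow> P \<in> carrier_mat d d \<and> det P \<noteq> 0 \<and> I \<subseteq> {..<d} \<and> (\<forall>j\<in>I. col P j \<in> W)"
    for P :: "'a mat" and I
  have good0: "good (1\<^sub>m d) {}" by (simp add: good_def)
  have bound: "card J < Suc d" if "\<exists>P. good P J" for J
  proof -
    from that have "J \<subseteq> {..<d}" unfolding good_def by blast
    then show ?thesis using card_mono[of "{..<d}" J] by simp
  qed
  have "\<exists>I. (\<exists>P. good P I) \<and> (\<forall>J. (\<exists>P. good P J) \<longrightarrow> card J \<le> card I)"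
    using ex_has_greatest_nat[of "\<lambda>J. \<exists>P. good P J" "{}" card "Suc d"] good0 bound by blast
  then obtain P I where good: "good P I" and max: "\<And>P' J. good P' J \<Longrightarrow> card J \<le> card I" by blast
  from good have P: "P \<in> carrier_mat d d" "det P \<noteq> 0" and I: "I \<subseteq> {..<d}" "\<And>j. j \<in> I \<Longrightarrow> col P j \<in> W"
    by (auto simp: good_def)
  obtain Q where Q: "Q \<in> carrier_mat d d" "P * Q = 1\<^sub>m d" "Q * P = 1\<^sub>m d"
    using invertible_mat_inverseE[OF P] .
  have PQ: "P *\<^sub>v (Q *\<^sub>v v) = v" if "v \<in> carrier_vec d" for v
    using that P Q by (simp flip: assoc_mult_mat_vec[of _ d d _ d])
  have coord: "(Q *\<^sub>v v) $v i = 0" if v: "v \<in> W" and i: "i < d" "i \<notin> I" for v i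
  proof (rule ccontr)
    assume nz: "(Q *\<^sub>v v) $v i \<noteq> 0"
    have v': "v \<in> carrier_vec d" using v W(1) by blast
    \<comment> \<open>Cramer's rule: putting \<open>v\<close> in place of column \<open>i\<close>
      multiplies the determinant by the coordinate of \<open>v\<close> at \<open>i\<close>. A
      nonzero coordinate would permit one more exchange, against the maximality of
      \<open>I\<close>.\<close>
    have "det (replace_col P (P *\<^sub>v (Q *\<^sub>v v)) i) = (Q *\<^sub>v v) $v i * det P"
      using P(1) Q(1) v' i by (intro cramer_lemma_mat[of _ d]) auto
    then have "det (replace_col P v i) \<noteq> 0" using nz P(2) PQ[OF v'] by simp
    moreover have "col (replace_col P v i) j = (if j = i then v else col P j)" if "j < d" for j
      using that P(1) v' by (auto simp: replace_col_def intro!: eq_vecI)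
    moreover have "replace_col P v i \<in> carrier_mat d d" using P(1) by (simp add: replace_col_def)
    ultimately have "good (replace_col P v i) (insert i I)"
      unfolding good_def using I i v by (metis insert_iff insert_subset lessThan_iff subset_iff)
    from max[OF this] show False
      using i finite_subset[OF I(1)] by simp
  qed
  have "I \<noteq> {}"
  proof
    assume "I = {}"
    have "v = 0\<^sub>v d" if "v \<in> W" for v
    proof -
      have v': "v \<in> carrier_vec d" using that W(1) by blast
      have "Q *\<^sub>v v = 0\<^sub>v d" using coord[OF that] \<open>I = {}\<close> Q(1) by (intro eq_vecI) auto
      then show ?thesis using PQ[OF v'] P(1) by auto
    qed
    then show False using ne(1) W(2) by blast
  qed
  moreover have "I \<noteq> {..<d}"
  proof
    assume "I = {..<d}"
    then have "P *\<^sub>v (Q *\<^sub>v v) \<in> W" if "v \<in> carrier_vec d" for v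
      using that I(2) Q(1) by (intro subspace_mult_mat_vec_closed[OF sub P(1)]) auto
    then show False using PQ ne(2) W(1) by auto
  qed
  ultimately show ?thesis using that[OF P(1) Q _ _ I(2) coord] I(1) by blast
qed

text \<open>The disjunction in the hypothesis serves both diagonal blocks of a block triangular
  representation: for the block of the invariant subspace the second factor vanishes, for the block
  of the quotient the first.\<close>

lemma (in group) principal_block_representation:
  assumes M: "representation G d M" and xs: "distinct xs" "set xs \<subseteq> {..<d}"
    and zero: "\<And>g h a b c. g \<in> carrier G \<Longrightarrow> h \<in> carrier G \<Longrightarrow> a \<in> set xs \<Longrightarrow> b \<in> set xs \<Longrightarrow>
      c < d \<Longrightarrow> c \<notin> set xs \<Longrightarrow> M g $$ (a, c) = 0 \<or> M h $$ (c, b) = 0"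
  shows "representation G (length xs) (\<lambda>g. principal_block (M g) xs)"
proof -
  note rep = M[unfolded representation_iff]
  have "principal_block (M (g \<otimes> h)) xs = principal_block (M g) xs * principal_block (M h) xs"
    if gh: "g \<in> carrier G" "h \<in> carrier G" for g h
    using principal_block_mult[OF _ _ xs, of "M g" "M h"] zero[OF gh] rep gh by simp
  then show ?thesis using rep by (simp add: representation_iff principal_block_one[OF xs])
qed

text \<open>Strong induction on the dimension. In a basis adapted to a proper nonzero invariant
  subspace the matrices become block triangular, the two diagonal blocks are representations of
  smaller dimension, and the trace is the sum of their traces.\<close>

theorem (in group) rep_character_in_group_closure:
  assumes "representation G d \<rho>"
  shows "rep_character G \<rho> \<in> group_closure (irreducible_characters G)"
  using assms
proof (induction d arbitrary: \<rho> rule: less_induct)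
  case (less d)
  note rep = less.prems[unfolded representation_iff]
  consider "d = 0" | "irreducible_representation G d \<rho>" | "d > 0" "\<not> irreducible_representation G d \<rho>"
    by blast
  then show ?case
  proof cases
    case 1
    \<comment> \<open>Dimension 0 is excluded from irreducibility, so it is treated apart; its
      character is an empty trace.\<close>
    then have "rep_character G \<rho> = 0" using rep by (auto simp: rep_character_def mat_trace_def fun_eq_iff)
    then show ?thesis by (simp only: zero_in_group_closure)
  next
    case 2
    then show ?thesis by (auto intro!: group_closure.base simp: irreducible_characters_def)
  next
    case 3
    then obtain W where sub: "VectorSpace.subspace class_ring W (module_vec TYPE(complex) d)"
      and inv: "\<And>g w. g \<in> carrier G \<Longrightarrow> w \<in> W \<Longrightarrow> \<rho> g *\<^sub>v w \<in> W"
      and ne: "W \<noteq> {0\<^sub>v d}" "W \<noteq> carrier_vec d"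
      using less.prems unfolding irreducible_representation_def by blast
    obtain P Q I where PQ: "P \<in> carrier_mat d d" "Q \<in> carrier_mat d d" "P * Q = 1\<^sub>m d" "Q * P = 1\<^sub>m d"
      and I: "I \<noteq> {}" "I \<subset> {..<d}" and col: "\<And>j. j \<in> I \<Longrightarrow> col P j \<in> W"
      and coord: "\<And>v i. v \<in> W \<Longrightarrow> i < d \<Longrightarrow> i \<notin> I \<Longrightarrow> (Q *\<^sub>v v) $v i = 0"
      using subspace_adapted_basis[OF sub ne] by metis
    define M where "M g = Q * \<rho> g * P" for g
    have M: "M g \<in> carrier_mat d d" if "g \<in> carrier G" for g using that rep PQ by (auto simp: M_def)
    have "M (g \<otimes> h) = M g * M h" if gh: "g \<in> carrier G" "h \<in> carrier G" for g h
    proof -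
      have c: "\<rho> g \<in> carrier_mat d d" "\<rho> h \<in> carrier_mat d d" using rep gh by auto
      have "M g * M h = Q * \<rho> g * (P * Q) * (\<rho> h * P)"
        using c PQ(1,2) by (simp add: M_def assoc_mult_mat[of _ d d _ d _ d])
      also have "\<dots> = Q * (\<rho> g * \<rho> h) * P"
        using c PQ by (simp add: assoc_mult_mat[of _ d d _ d _ d])
      finally show ?thesis using rep gh by (simp add: M_def)
    qed
    moreover have "M \<one> = 1\<^sub>m d" using rep PQ by (simp add: M_def)
    ultimately have repM: "representation G d M" using M by (simp add: representation_iff)
    \<comment> \<open>Column \<open>j\<close> of \<open>P\<close> lies in the invariant subspace
      \<open>W\<close>, hence so does its image under \<open>\<rho> g\<close>, whose adapted
      coordinates outside \<open>I\<close> vanish. This is the block triangular shape of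
      \<open>M g\<close>.\<close>
    have zero: "M g $$ (i, j) = 0" if "g \<in> carrier G" "j \<in> I" "i < d" "i \<notin> I" for g i j
    proof -
      have c: "\<rho> g \<in> carrier_mat d d" "j < d" using rep that I by auto
      have "M g $$ (i, j) = col (M g) j $v i"
        using carrier_matD[OF M[OF that(1)]] that(3) c(2) by simp
      also have "col (M g) j = Q * \<rho> g *\<^sub>v col P j"
        unfolding M_def using c PQ by (intro col_mult2[of _ d d _ d]) auto
      also have "Q * \<rho> g *\<^sub>v col P j = Q *\<^sub>v (\<rho> g *\<^sub>v col P j)"
        using c PQ by (intro assoc_mult_mat_vec[of _ d d _ d]) auto
      also have "\<dots> $v i = 0" using inv col that by (intro coord) auto
      finally show ?thesis .
    qed
    have fin: "finite I" using I(2) finite_subset by blast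
    define xs where "xs = sorted_list_of_set I"
    define ys where "ys = sorted_list_of_set ({..<d} - I)"
    have xs: "distinct xs" "set xs = I" "length xs = card I" using fin by (simp_all add: xs_def)
    have ys: "distinct ys" "set ys = {..<d} - I" "length ys = d - card I"
      using fin I(2) by (auto simp: ys_def card_Diff_subset)
    have card: "0 < card I" "card I < d"
      using fin I psubset_card_mono[OF _ I(2)] by (auto simp: card_gt_0_iff)
    have "representation G (length xs) (\<lambda>g. principal_block (M g) xs)"
      using xs I(2) zero by (intro principal_block_representation[OF repM]) auto
    moreover have "representation G (length ys) (\<lambda>g. principal_block (M g) ys)"
      using ys I(2) zero by (intro principal_block_representation[OF repM]) auto
    ultimately have "rep_character G (\<lambda>g. principal_block (M g) xs) \<in> group_closure (irreducible_characters G)"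
      "rep_character G (\<lambda>g. principal_block (M g) ys) \<in> group_closure (irreducible_characters G)"
      using less.IH[of "length xs"] less.IH[of "length ys"] card by (simp_all add: xs(3) ys(3))
    moreover have "rep_character G \<rho> =
      rep_character G (\<lambda>g. principal_block (M g) xs) + rep_character G (\<lambda>g. principal_block (M g) ys)"
    proof
      fix g
      show "rep_character G \<rho> g = (rep_character G (\<lambda>g. principal_block (M g) xs) +
        rep_character G (\<lambda>g. principal_block (M g) ys)) g"
      proof (cases "g \<in> carrier G")
        case True
        have "mat_trace (\<rho> g) = mat_trace (M g)" unfolding M_def
          using True rep PQ by (intro mat_trace_conjugate[symmetric]) auto
        also have "\<dots> = (\<Sum>i\<in>I. M g $$ (i, i)) + (\<Sum>i\<in>{..<d} - I. M g $$ (i, i))"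
          using M[OF True] I(2) sum.subset_diff[of I "{..<d}" "\<lambda>i. M g $$ (i, i)"]
          by (auto simp: mat_trace_def)
        also have "\<dots> = mat_trace (principal_block (M g) xs) + mat_trace (principal_block (M g) ys)"
          using xs ys by (simp add: mat_trace_principal_block)
        finally show ?thesis using True by (simp add: rep_character_def)
      qed (simp add: rep_character_def)
    qed
    ultimately show ?thesis by (simp only: group_closure_add)
  qed
qed

section \<open>Tensor products of representations\<close>

definition kronecker_mat :: "complex mat \<Rightarrow> complex mat \<Rightarrow> complex mat"
  where "kronecker_mat A B = mat (dim_row A * dim_row B) (dim_col A * dim_col B)
    (\<lambda>(i, j). A $$ (i div dim_row B, j div dim_col B) * B $$ (i mod dim_row B, j mod dim_col B))"

lemma kronecker_mat_carrier [simp]: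
  assumes "A \<in> carrier_mat m n" "B \<in> carrier_mat p q"
  shows "kronecker_mat A B \<in> carrier_mat (m * p) (n * q)"
  using assms by (auto simp: kronecker_mat_def)

lemma div_mod_less_mult: "(i::nat) < m * n \<Longrightarrow> i div n < m \<and> i mod n < n"
  by (cases "n = 0") (simp_all add: less_mult_imp_div_less)

lemma sum_div_mod_product:
  fixes f :: "nat \<Rightarrow> nat \<Rightarrow> 'a::comm_monoid_add"
  shows "(\<Sum>k<m * n. f (k div n) (k mod n)) = (\<Sum>i<m. \<Sum>j<n. f i j)"
proof -
  have "(\<Sum>k\<in>{i * n..<i * n + n}. f (k div n) (k mod n)) = (\<Sum>j<n. f i j)" for i
    using sum.shift_bounds_nat_ivl[of "\<lambda>k. f (k div n) (k mod n)" 0 "i * n" n]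
    by (simp add: add.commute atLeast0LessThan)
  then show ?thesis by (simp flip: sum.nat_group)
qed

lemma kronecker_mat_mult:
  assumes "A \<in> carrier_mat m m" "B \<in> carrier_mat n n" "C \<in> carrier_mat m m" "D \<in> carrier_mat n n"
  shows "kronecker_mat (A * C) (B * D) = kronecker_mat A B * kronecker_mat C D"
proof (rule eq_matI)
  fix i j assume "i < dim_row (kronecker_mat A B * kronecker_mat C D)"
    "j < dim_col (kronecker_mat A B * kronecker_mat C D)"
  then have ij: "i < m * n" "j < m * n" using assms by (auto simp: kronecker_mat_def)
  note dm = div_mod_less_mult[OF ij(1)] div_mod_less_mult[OF ij(2)]
  have "(kronecker_mat A B * kronecker_mat C D) $$ (i, j) =
      (\<Sum>k<m * n. (A $$ (i div n, k div n) * B $$ (i mod n, k mod n)) *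
        (C $$ (k div n, j div n) * D $$ (k mod n, j mod n)))"
    using assms ij by (simp add: kronecker_mat_def scalar_prod_def atLeast0LessThan)
  also have "\<dots> = (\<Sum>k<m. \<Sum>l<n. (A $$ (i div n, k) * B $$ (i mod n, l)) *
        (C $$ (k, j div n) * D $$ (l, j mod n)))"
    by (rule sum_div_mod_product)
  also have "\<dots> = (\<Sum>k<m. A $$ (i div n, k) * C $$ (k, j div n)) *
      (\<Sum>l<n. B $$ (i mod n, l) * D $$ (l, j mod n))"
    by (simp add: sum_product ac_simps)
  also have "\<dots> = kronecker_mat (A * C) (B * D) $$ (i, j)"
    using assms ij dm by (simp add: kronecker_mat_def scalar_prod_def atLeast0LessThan)
  finally show "kronecker_mat (A * C) (B * D) $$ (i, j) = (kronecker_mat A B * kronecker_mat C D) $$ (i, j)"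
    by simp
qed (use assms in \<open>auto simp: kronecker_mat_def\<close>)

lemma kronecker_mat_one: "kronecker_mat (1\<^sub>m m) (1\<^sub>m n) = 1\<^sub>m (m * n)"
proof (rule eq_matI)
  fix i j assume "i < dim_row (1\<^sub>m (m * n))" "j < dim_col (1\<^sub>m (m * n))"
  then have ij: "i < m * n" "j < m * n" by auto
  have "i = j \<longleftrightarrow> i div n = j div n \<and> i mod n = j mod n" by (metis div_mult_mod_eq)
  then show "kronecker_mat (1\<^sub>m m) (1\<^sub>m n) $$ (i, j) = 1\<^sub>m (m * n) $$ (i, j)"
    using ij div_mod_less_mult[OF ij(1)] div_mod_less_mult[OF ij(2)] by (auto simp: kronecker_mat_def)
qed (simp_all add: kronecker_mat_def)

lemma mat_trace_kronecker:
  assumes "A \<in> carrier_mat m m" "B \<in> carrier_mat n n"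
  shows "mat_trace (kronecker_mat A B) = mat_trace A * mat_trace B"
  using assms sum_div_mod_product[where f = "\<lambda>i j. A $$ (i, i) * B $$ (j, j)" and m = m and n = n]
  by (simp add: mat_trace_def kronecker_mat_def sum_product)

text \<open>The record-based \<open>generate\<close> and the class-based
  \<open>group_closure\<close> are identified once, for every additive record that uses the addition
  of its type. Subgroups of functions and of formal sums can then be handled by ordinary arithmetic,
  with closure under differences as the only thing to check.\<close>

lemma generate_eq_group_closure:
  fixes M :: "('a::ab_group_add, 'm) monoid_scheme"
  assumes M: "monoid.mult M = (+)" "monoid.one M = 0" "0 \<in> carrier M"
    and diff: "\<And>x y. x \<in> carrier M \<Longrightarrow> y \<in> carrier M \<Longrightarrow> x - y \<in> carrier M"
    and S: "S \<subseteq> carrier M"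
  shows "generate M S = group_closure S"
proof -
  have neg: "- x \<in> carrier M" if "x \<in> carrier M" for x using diff[OF M(3) that] by simp
  have add: "x + y \<in> carrier M" if "x \<in> carrier M" "y \<in> carrier M" for x y
    using diff[OF that(1) neg[OF that(2)]] by simp
  interpret M: group M
    by (rule groupI) (auto simp: M add.assoc intro: add intro!: bexI[OF _ neg])
  have inv: "inv\<^bsub>M\<^esub> x = - x" if "x \<in> carrier M" for x
    using M.inv_equality[of "- x" x] that neg by (simp add: M)
  have "generate M S \<subseteq> group_closure S"
  proof
    fix x assume "x \<in> generate M S"
    then show "x \<in> group_closure S"
      by induction (use subsetD[OF S] in \<open>auto simp: M inv intro: group_closure.base group_closure_add\<close>)
  qed
  moreover have "group_closure S \<subseteq> generate M S"
  proof
    fix x assume "x \<in> group_closure S"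
    then show "x \<in> generate M S"
    proof induction
      case (base s)
      then show ?case using generate.one[of M S] by (auto simp: M intro: generate.incl)
    next
      case (diff s t)
      have "inv\<^bsub>M\<^esub> t \<in> generate M S" "t \<in> carrier M"
        using M.generate_m_inv_closed[OF S diff.IH(2)] M.generate_in_carrier[OF S diff.IH(2)] by auto
      then show ?case using generate.eng[OF diff.IH(1), of "- t"] by (simp add: inv M)
    qed
  qed
  ultimately show ?thesis by blast
qed

lemma group_closure_subset:
  assumes "\<And>s. s \<in> S \<Longrightarrow> s \<in> A" "0 \<in> A" "\<And>x y. x \<in> A \<Longrightarrow> y \<in> A \<Longrightarrow> x - y \<in> A"
  shows "group_closure S \<subseteq> A"
proof
  fix x assume "x \<in> group_closure S"
  then show "x \<in> A" by induction (use assms in auto)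
qed

section \<open>The ring of virtual characters\<close>

definition trivial_character :: "('a, 'm) monoid_scheme \<Rightarrow> 'a \<Rightarrow> complex"
  where "trivial_character G = (\<lambda>g. if g \<in> carrier G then 1 else 0)"

lemma trivial_character_apply [simp]:
  "g \<in> carrier G \<Longrightarrow> trivial_character G g = 1" "g \<notin> carrier G \<Longrightarrow> trivial_character G g = 0"
  by (simp_all add: trivial_character_def)

lemma character_ring_simps [simp]:
  "monoid.mult (character_ring G) = (*)" "ring.add (character_ring G) = (+)"
  "ring.zero (character_ring G) = 0" "monoid.one (character_ring G) = trivial_character G"
  by (simp_all add: character_ring_def function_ring_def zero_fun_def trivial_character_def fun_eq_iff)

lemma irreducible_characters_off_carrier:
  "x \<in> irreducible_characters G \<Longrightarrow> g \<notin> carrier G \<Longrightarrow> x g = 0"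
  by (auto simp: irreducible_characters_def rep_character_def)

lemma carrier_character_ring: "carrier (character_ring G) = group_closure (irreducible_characters G)"
proof -
  have "carrier (character_ring G) = generate (add_monoid (function_ring G)) (irreducible_characters G)"
    by (simp add: character_ring_def)
  also have "\<dots> = group_closure (irreducible_characters G)"
    by (rule generate_eq_group_closure)
      (auto simp: function_ring_def fun_eq_iff irreducible_characters_off_carrier)
  finally show ?thesis .
qed

lemma character_ring_zero_closed [simp]: "0 \<in> carrier (character_ring G)"
  by (simp add: carrier_character_ring del: zero_fun_apply)

lemma character_ring_diff_closed [intro]:
  "x \<in> carrier (character_ring G) \<Longrightarrow> y \<in> carrier (character_ring G) \<Longrightarrow> x - y \<in> carrier (character_ring G)"
  by (simp add: carrier_character_ring group_closure.diff)

lemma character_ring_uminus_closed [intro]: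
  "x \<in> carrier (character_ring G) \<Longrightarrow> - x \<in> carrier (character_ring G)"
  by (simp add: carrier_character_ring)

lemma character_ring_add_closed [intro]:
  "x \<in> carrier (character_ring G) \<Longrightarrow> y \<in> carrier (character_ring G) \<Longrightarrow> x + y \<in> carrier (character_ring G)"
  by (simp add: carrier_character_ring group_closure_add)

lemma character_ring_subsetI:
  assumes "irreducible_characters G \<subseteq> A" "0 \<in> A" "\<And>x y. x \<in> A \<Longrightarrow> y \<in> A \<Longrightarrow> x - y \<in> A"
  shows "carrier (character_ring G) \<subseteq> A"
  unfolding carrier_character_ring using assms by (intro group_closure_subset) auto

lemma character_ring_off_carrier:
  assumes "x \<in> carrier (character_ring G)" "g \<notin> carrier G"
  shows "x g = 0"
proof -
  have "carrier (character_ring G) \<subseteq> {x. x g = 0}"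
    by (rule character_ring_subsetI) (use assms(2) in \<open>auto simp: irreducible_characters_off_carrier\<close>)
  then show ?thesis using assms(1) by blast
qed

context group
begin

lemma representationD:
  assumes "representation G d \<rho>"
  shows "g \<in> carrier G \<Longrightarrow> \<rho> g \<in> carrier_mat d d"
    "g \<in> carrier G \<Longrightarrow> h \<in> carrier G \<Longrightarrow> \<rho> (g \<otimes> h) = \<rho> g * \<rho> h" "\<rho> \<one> = 1\<^sub>m d"
  using assms by (auto simp: representation_iff)

lemma rep_character_closed: "representation G d \<rho> \<Longrightarrow> rep_character G \<rho> \<in> carrier (character_ring G)"
  by (simp add: carrier_character_ring rep_character_in_group_closure)

lemma irreducible_charactersE:
  assumes "x \<in> irreducible_characters G"
  obtains d \<rho> where "representation G d \<rho>" "x = rep_character G \<rho>"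
  using assms by (auto simp: irreducible_characters_def irreducible_representation_def)

lemma kronecker_representation:
  assumes \<rho>: "representation G d \<rho>" and \<sigma>: "representation G e \<sigma>"
  shows "representation G (d * e) (\<lambda>g. kronecker_mat (\<rho> g) (\<sigma> g))"
    and "rep_character G (\<lambda>g. kronecker_mat (\<rho> g) (\<sigma> g)) = rep_character G \<rho> * rep_character G \<sigma>"
  using representationD[OF \<rho>] representationD[OF \<sigma>]
  by (auto simp: representation_iff kronecker_mat_mult[of _ d _ e] kronecker_mat_one rep_character_def
      mat_trace_kronecker[of _ d _ e] fun_eq_iff)

lemma character_ring_mult_closed [intro]:
  assumes x: "x \<in> carrier (character_ring G)" and y: "y \<in> carrier (character_ring G)"
  shows "x * y \<in> carrier (character_ring G)"
proof -
  let ?R = "carrier (character_ring G)"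
  \<comment> \<open>Products are bilinear, so closure is shown with the left factor irreducible and
    the right one arbitrary, and then extended to an arbitrary left factor.\<close>
  have irr: "?R \<subseteq> {y. x * y \<in> ?R}" if "x \<in> irreducible_characters G" for x
  proof (rule character_ring_subsetI)
    show "irreducible_characters G \<subseteq> {y. x * y \<in> ?R}"
      using that kronecker_representation rep_character_closed
      by (metis (no_types, lifting) irreducible_charactersE mem_Collect_eq subsetI)
  qed (auto simp: right_diff_distrib)
  have "?R \<subseteq> {x. x * y \<in> ?R}"
  proof (rule character_ring_subsetI)
    show "irreducible_characters G \<subseteq> {x. x * y \<in> ?R}" using irr y by blast
  qed (auto simp: left_diff_distrib)
  then show ?thesis using x by blast
qed

lemma trivial_character_closed [simp]: "trivial_character G \<in> carrier (character_ring G)"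
proof -
  have "representation G 1 (\<lambda>_. 1\<^sub>m 1)" by (simp add: representation_iff)
  moreover have "rep_character G (\<lambda>_. 1\<^sub>m 1) = trivial_character G"
    by (auto simp: rep_character_def trivial_character_def mat_trace_def)
  ultimately show ?thesis using rep_character_closed by metis
qed

lemma trivial_character_mult [simp]:
  "x \<in> carrier (character_ring G) \<Longrightarrow> trivial_character G * x = x"
  "x \<in> carrier (character_ring G) \<Longrightarrow> x * trivial_character G = x"
  by (auto simp: fun_eq_iff trivial_character_def character_ring_off_carrier)

lemma character_at_one_int:
  assumes "x \<in> carrier (character_ring G)"
  shows "x \<one> \<in> \<int>"
proof -
  have "carrier (character_ring G) \<subseteq> {x. x \<one> \<in> \<int>}"
  proof (rule character_ring_subsetI)
    show "irreducible_characters G \<subseteq> {x. x \<one> \<in> \<int>}"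
      by (auto elim!: irreducible_charactersE dest!: representationD(3)
          simp: rep_character_def mat_trace_def)
  qed auto
  then show ?thesis using assms by blast
qed

text \<open>This is the character of the regular representation: its matrices permute the basis
  indexed by the enumeration \<open>e\<close> of the group through left translation, and the trace
  counts the solutions \<open>x\<close> of \<open>g x = x\<close>.\<close>

lemma regular_character_closed:
  assumes "finite (carrier G)"
  shows "(\<lambda>g. if g = \<one> then of_nat (Coset.order G) else 0) \<in> carrier (character_ring G)"
proof -
  define m where "m = Coset.order G"
  obtain e where e: "bij_betw e {0..<m} (carrier G)"
    using ex_bij_betw_nat_finite[OF assms] by (auto simp: m_def Coset.order_def)
  have ec: "e i \<in> carrier G" if "i < m" for i using e that by (auto simp: bij_betw_def)
  have einj: "e i = e j \<longleftrightarrow> i = j" if "i < m" "j < m" for i j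
    using e that by (auto simp: bij_betw_def inj_on_def)
  define \<rho> where "\<rho> g = mat m m (\<lambda>(i, j). if e i = g \<otimes> e j then 1 else 0 :: complex)" for g
  have "\<rho> (g \<otimes> h) = \<rho> g * \<rho> h" if gh: "g \<in> carrier G" "h \<in> carrier G" for g h
  proof (rule eq_matI)
    fix i j assume "i < dim_row (\<rho> g * \<rho> h)" "j < dim_col (\<rho> g * \<rho> h)"
    then have ij: "i < m" "j < m" by (simp_all add: \<rho>_def)
    obtain l where l: "l < m" "e l = h \<otimes> e j"
      using e gh(2) ec[OF ij(2)] unfolding bij_betw_def by (metis atLeastLessThan_iff imageE m_closed)
    have "(\<rho> g * \<rho> h) $$ (i, j) =
        (\<Sum>k = 0..<m. (if e i = g \<otimes> e k then 1 else 0) * (if e k = h \<otimes> e j then 1 else 0))"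
      using ij by (simp add: \<rho>_def scalar_prod_def)
    also have "\<dots> = (\<Sum>k = 0..<m. if k = l then (if e i = g \<otimes> e l then 1 else 0) else 0)"
      using l einj by (intro sum.cong) (auto simp flip: l(2))
    also have "\<dots> = \<rho> (g \<otimes> h) $$ (i, j)"
      using ij l gh ec by (simp add: \<rho>_def m_assoc)
    finally show "\<rho> (g \<otimes> h) $$ (i, j) = (\<rho> g * \<rho> h) $$ (i, j)" by simp
  qed (simp_all add: \<rho>_def)
  moreover have "\<rho> \<one> = 1\<^sub>m m" using ec einj by (auto simp: \<rho>_def intro!: eq_matI)
  ultimately have "representation G m \<rho>" by (simp add: representation_iff \<rho>_def)
  moreover have "rep_character G \<rho> = (\<lambda>g. if g = \<one> then of_nat (Coset.order G) else 0)"
  proof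
    fix g show "rep_character G \<rho> g = (if g = \<one> then of_nat (Coset.order G) else 0)"
    proof (cases "g \<in> carrier G")
      case True
      then have "e i = g \<otimes> e i \<longleftrightarrow> g = \<one>" if "i < m" for i
        using ec[OF that] by (metis r_cancel_one')
      then show ?thesis using True by (simp add: rep_character_def mat_trace_def \<rho>_def m_def)
    qed (auto simp: rep_character_def)
  qed
  ultimately show ?thesis using rep_character_closed by metis
qed

end

text \<open>Restriction to a subgroup and inflation along a projection are both instances. The
  cut-off keeps to the convention that functions on a group vanish outside its carrier.\<close>

definition pullback_character :: "('a, 'm) monoid_scheme \<Rightarrow> ('a \<Rightarrow> 'b) \<Rightarrow> ('b \<Rightarrow> complex) \<Rightarrow> 'a \<Rightarrow> complex"
  where "pullback_character G \<phi> x = (\<lambda>g. if g \<in> carrier G then x (\<phi> g) else 0)"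

lemma pullback_character_simps [simp]:
  "pullback_character G \<phi> 0 = 0"
  "pullback_character G \<phi> (x + y) = pullback_character G \<phi> x + pullback_character G \<phi> y"
  "pullback_character G \<phi> (x - y) = pullback_character G \<phi> x - pullback_character G \<phi> y"
  "pullback_character G \<phi> (x * y) = pullback_character G \<phi> x * pullback_character G \<phi> y"
  by (auto simp: pullback_character_def fun_eq_iff)

context group_hom
begin

lemma pullback_representation:
  assumes "representation H d \<rho>"
  shows "representation G d (\<lambda>g. \<rho> (h g))"
    and "pullback_character G h (rep_character H \<rho>) = rep_character G (\<lambda>g. \<rho> (h g))"
  using assms
  by (auto simp: G.representation_iff H.representation_iff pullback_character_def rep_character_def)

lemma pullback_character_closed [intro]:
  assumes "x \<in> carrier (character_ring H)"
  shows "pullback_character G h x \<in> carrier (character_ring G)"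
proof -
  have "carrier (character_ring H) \<subseteq> {x. pullback_character G h x \<in> carrier (character_ring G)}"
  proof (rule character_ring_subsetI)
    show "irreducible_characters H \<subseteq> {x. pullback_character G h x \<in> carrier (character_ring G)}"
      using pullback_representation G.rep_character_closed
      by (metis (no_types, lifting) H.irreducible_charactersE mem_Collect_eq subsetI)
  qed auto
  then show ?thesis using assms by blast
qed

lemma pullback_trivial_character [simp]:
  "pullback_character G h (trivial_character H) = trivial_character G"
  by (auto simp: pullback_character_def trivial_character_def)

end

section \<open>Lambda and gamma operations\<close>

definition lambda_char ::
    "('a, 'm) monoid_scheme \<Rightarrow> nat \<Rightarrow> ('a \<Rightarrow> complex) \<Rightarrow> 'a \<Rightarrow> complex"
  where "lambda_char G n x =
    (\<lambda>g. if g \<in> carrier G then lambda_series (\<lambda>k. x (g [^]\<^bsub>G\<^esub> Suc k)) $ n else 0)"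

lemma lambda_char_0 [simp]: "lambda_char G 0 x = trivial_character G"
  by (auto simp: lambda_char_def trivial_character_def)

lemma lambda_char_add:
  "lambda_char G n (x + y) = (\<Sum>i\<le>n. lambda_char G i x * lambda_char G (n - i) y)"
proof
  fix g
  have sum_apply: "(\<Sum>i\<le>n. f i) g = (\<Sum>i\<le>n. f i g)" for f :: "nat \<Rightarrow> 'a \<Rightarrow> complex"
    by (induction n) simp_all
  show "lambda_char G n (x + y) g = (\<Sum>i\<le>n. lambda_char G i x * lambda_char G (n - i) y) g"
    by (simp add: sum_apply lambda_char_def lambda_series_add fps_mult_nth atLeast0AtMost)
qed

context group
begin

lemma lambda_char_1:
  assumes "x \<in> carrier (character_ring G)"
  shows "lambda_char G 1 x = x"
proof
  fix g
  have "lambda_series p $ Suc 0 = p 0" for p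
    using arg_cong[OF fps_deriv_lambda_series[of p], of "\<lambda>f. f $ 0"] by simp
  then show "lambda_char G 1 x g = x g"
    using assms by (simp add: lambda_char_def character_ring_off_carrier)
qed

lemma exterior_power_representation:
  assumes "representation G d \<rho>"
  shows "representation G (length (exterior_basis d n)) (\<lambda>g. exterior_power_mat n (\<rho> g))"
  using representationD[OF assms]
  by (auto simp: representation_iff exterior_power_mat_mult[of _ d] exterior_power_mat_one)

lemma lambda_char_rep_character:
  assumes "representation G d \<rho>"
  shows "lambda_char G n (rep_character G \<rho>) = rep_character G (\<lambda>g. exterior_power_mat n (\<rho> g))"
proof -
  note rep = representationD[OF assms]
  have pow: "\<rho> (g [^] k) = \<rho> g ^\<^sub>m k" if g: "g \<in> carrier G" for g and k :: nat
  proof (induction k)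
    case (Suc k)
    then show ?case using g rep(2)[of "g [^] k" g] by simp
  qed (use rep g carrier_matD(1)[OF rep(1)[OF g]] in simp)
  show ?thesis
  proof
    fix g show "lambda_char G n (rep_character G \<rho>) g = rep_character G (\<lambda>g. exterior_power_mat n (\<rho> g)) g"
    proof (cases "g \<in> carrier G")
      case True
      have "rep_character G \<rho> (g [^] k) = mat_trace (\<rho> g ^\<^sub>m k)" for k :: nat
        using True by (simp add: rep_character_def pow)
      then have "lambda_char G n (rep_character G \<rho>) g = lambda_series (\<lambda>k. mat_trace (\<rho> g ^\<^sub>m Suc k)) $ n"
        using True unfolding lambda_char_def by presburger
      then show ?thesis using True mat_trace_exterior_power_mat[OF rep(1)[OF True]]
        by (simp add: rep_character_def)
    qed (simp add: lambda_char_def rep_character_def)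
  qed
qed

lemma character_ring_sum_closed:
  "(\<And>i. i \<in> A \<Longrightarrow> f i \<in> carrier (character_ring G)) \<Longrightarrow> sum f A \<in> carrier (character_ring G)"
  by (induction A rule: infinite_finite_induct) (auto simp del: zero_fun_apply plus_fun_apply)

text \<open>Writing \<open>x = (x - y) + y\<close>, the addition formula gives the
  \<open>n\<close>-th operation on \<open>x - y\<close> as the one on \<open>x\<close> minus
  products of lower operations on \<open>x - y\<close> with operations on \<open>y\<close>. The
  elements whose operations all stay in the ring therefore form a subgroup, and it contains the
  irreducible characters because exterior powers are representations.\<close>

lemma lambda_char_closed:
  assumes "x \<in> carrier (character_ring G)"
  shows "lambda_char G n x \<in> carrier (character_ring G)"
proof -
  let ?R = "carrier (character_ring G)"
  let ?A = "{x. \<forall>n. lambda_char G n x \<in> ?R}"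
  have "?R \<subseteq> ?A"
  proof (rule character_ring_subsetI)
    show "irreducible_characters G \<subseteq> ?A"
    proof
      fix x assume "x \<in> irreducible_characters G"
      then obtain d \<rho> where \<rho>: "representation G d \<rho>" "x = rep_character G \<rho>"
        by (rule irreducible_charactersE)
      show "x \<in> ?A"
        using rep_character_closed[OF exterior_power_representation[OF \<rho>(1)]]
        by (simp add: \<rho>(2) lambda_char_rep_character[OF \<rho>(1)])
    qed
    have "lambda_char G n 0 = (if n = 0 then trivial_character G else 0)" for n
      by (auto simp: lambda_char_def trivial_character_def fun_eq_iff)
    then show "0 \<in> ?A" by (simp del: zero_fun_apply)
  next
    fix x y assume x: "x \<in> ?A" and y: "y \<in> ?A"
    have "lambda_char G n (x - y) \<in> ?R" for n
    proof (induction n rule: less_induct)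
      case (less n)
      have "lambda_char G n x = (\<Sum>i\<le>n. lambda_char G i (x - y) * lambda_char G (n - i) y)"
        using lambda_char_add[of G n "x - y" y] by simp
      also have "\<dots> = (\<Sum>i<n. lambda_char G i (x - y) * lambda_char G (n - i) y) +
          lambda_char G n (x - y) * trivial_character G"
        by (simp flip: lessThan_Suc_atMost del: plus_fun_apply times_fun_apply)
      also have "lambda_char G n (x - y) * trivial_character G = lambda_char G n (x - y)"
        by (auto simp: lambda_char_def trivial_character_def)
      finally have eq: "lambda_char G n x =
          (\<Sum>i<n. lambda_char G i (x - y) * lambda_char G (n - i) y) + lambda_char G n (x - y)" .
      have "lambda_char G n (x - y) =
          lambda_char G n x - (\<Sum>i<n. lambda_char G i (x - y) * lambda_char G (n - i) y)"
        unfolding eq by (simp only: add_diff_cancel_left')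
      moreover have "(\<Sum>i<n. lambda_char G i (x - y) * lambda_char G (n - i) y) \<in> ?R"
        using less y by (intro character_ring_sum_closed character_ring_mult_closed)
          (simp_all only: lessThan_iff mem_Collect_eq)
      ultimately show ?case using x by (simp only: mem_Collect_eq character_ring_diff_closed)
    qed
    then show "x - y \<in> ?A" by blast
  qed
  then show ?thesis using assms by blast
qed

lemma cring_character_ring: "cring (character_ring G)"
proof (rule cringI)
  show "abelian_group (character_ring G)"
    by (rule abelian_groupI)
      (auto simp: algebra_simps simp del: zero_fun_apply plus_fun_apply intro!: bexI[of _ "- x" for x])
  show "comm_monoid (character_ring G)"
    by (rule comm_monoidI) (auto simp: mult.assoc mult.commute simp del: times_fun_apply)
qed (simp add: distrib_right)

lemma character_ring_a_inv [simp]: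
  assumes "x \<in> carrier (character_ring G)"
  shows "a_inv (character_ring G) x = - x"
proof -
  interpret character: cring "character_ring G" by (rule cring_character_ring)
  show ?thesis using character.minus_equality[of "- x" x] assms by auto
qed

lemma character_ring_finsum:
  assumes "finite A" "\<And>i. i \<in> A \<Longrightarrow> f i \<in> carrier (character_ring G)"
  shows "finsum (character_ring G) f A = sum f A"
  using assms
proof (induction A rule: finite_induct)
  case empty
  interpret character: cring "character_ring G" by (rule cring_character_ring)
  show ?case by (simp add: character.finsum_empty del: zero_fun_apply)
next
  case (insert a A)
  interpret character: cring "character_ring G" by (rule cring_character_ring)
  from insert have "f \<in> A \<rightarrow> carrier (character_ring G)" by auto
  then show ?case using insert by (simp add: character.finsum_insert del: plus_fun_apply)
qed

text \<open>The restriction reflects the extensional function space in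
  \<open>lambda_operations\<close>, which fixes the values off the ring and so makes uniqueness
  possible.\<close>

lemma lambda_operations_lambda_char:
  "lambda_operations G (\<lambda>n. restrict (lambda_char G n) (carrier (character_ring G)))"
  unfolding lambda_operations_def
proof (intro conjI allI ballI impI)
  fix n x y assume xy: "x \<in> carrier (character_ring G)" "y \<in> carrier (character_ring G)"
  let ?L = "\<lambda>n. restrict (lambda_char G n) (carrier (character_ring G))"
  have "(\<Oplus>\<^bsub>character_ring G\<^esub>i\<in>{..n}. ?L i x \<otimes>\<^bsub>character_ring G\<^esub> ?L (n - i) y) =
      (\<Sum>i\<le>n. ?L i x * ?L (n - i) y)"
    using xy lambda_char_closed by (subst character_ring_finsum) auto
  then show "?L n (x \<oplus>\<^bsub>character_ring G\<^esub> y) =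
      (\<Oplus>\<^bsub>character_ring G\<^esub>i\<in>{..n}. ?L i x \<otimes>\<^bsub>character_ring G\<^esub> ?L (n - i) y)"
    using xy lambda_char_add[of G n x y] by (simp add: character_ring_add_closed del: plus_fun_apply times_fun_apply)
qed (simp_all add: lambda_char_closed rep_character_closed lambda_char_rep_character)

text \<open>The addition formula determines the operations on a difference from those on its two
  terms, so agreement on the irreducible characters spreads to the whole ring.\<close>

lemma lambda_operations_unique:
  assumes "lambda_operations G L"
  shows "L = (\<lambda>n. restrict (lambda_char G n) (carrier (character_ring G)))"
proof -
  let ?R = "carrier (character_ring G)"
  have closed: "L n \<in> ?R \<rightarrow>\<^sub>E ?R" for n using assms by (simp add: lambda_operations_def)
  then have closed': "x \<in> ?R \<Longrightarrow> L n x \<in> ?R" for n x by blast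
  have rep: "L n (rep_character G \<rho>) = lambda_char G n (rep_character G \<rho>)" if "representation G d \<rho>" for n d \<rho>
    using assms that lambda_char_rep_character[OF that] unfolding lambda_operations_def by metis
  have L0: "L 0 x = trivial_character G" if "x \<in> ?R" for x
    using assms that by (simp add: lambda_operations_def)
  have add: "L n (x + y) = (\<Sum>i\<le>n. L i x * L (n - i) y)" if "x \<in> ?R" "y \<in> ?R" for n x y
  proof -
    have "L n (x + y) = (\<Oplus>\<^bsub>character_ring G\<^esub>i\<in>{..n}. L i x * L (n - i) y)"
      using assms that unfolding lambda_operations_def by simp
    then show ?thesis
      using that closed' character_ring_finsum[of "{..n}" "\<lambda>i. L i x * L (n - i) y"] by (simp add: character_ring_mult_closed)
  qed
  have agree: "?R \<subseteq> {x \<in> ?R. \<forall>n. L n x = lambda_char G n x}"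
  proof (rule character_ring_subsetI)
    show "irreducible_characters G \<subseteq> {x \<in> ?R. \<forall>n. L n x = lambda_char G n x}"
      using rep rep_character_closed by (auto elim!: irreducible_charactersE)
    \<comment> \<open>The value at the zero function comes from the zero-dimensional representation,
      to which the exterior power clause applies.\<close>
    have "representation G 0 (\<lambda>_. 1\<^sub>m 0)" "rep_character G (\<lambda>_. 1\<^sub>m 0) = 0"
      by (auto simp: representation_iff rep_character_def mat_trace_def fun_eq_iff)
    then show "0 \<in> {x \<in> ?R. \<forall>n. L n x = lambda_char G n x}" using rep by force
  next
    fix x y assume x: "x \<in> {x \<in> ?R. \<forall>n. L n x = lambda_char G n x}"
      and y: "y \<in> {x \<in> ?R. \<forall>n. L n x = lambda_char G n x}"
    have xy: "x - y \<in> ?R" using x y by auto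
    have yL: "L k y = lambda_char G k y" for k using y by simp
    have "L n (x - y) = lambda_char G n (x - y)" for n
    proof (induction n rule: less_induct)
      case (less n)
      let ?S = "\<Sum>i<n. lambda_char G i (x - y) * lambda_char G (n - i) y"
      have "L n x = (\<Sum>i\<le>n. L i (x - y) * L (n - i) y)"
        using add[OF xy, of y n] y by simp
      also have "\<dots> = (\<Sum>i<n. L i (x - y) * L (n - i) y) + L n (x - y) * L 0 y"
        by (simp flip: lessThan_Suc_atMost del: plus_fun_apply times_fun_apply)
      also have "L n (x - y) * L 0 y = L n (x - y)"
        using L0[of y] y closed'[OF xy] by simp
      also have "(\<Sum>i<n. L i (x - y) * L (n - i) y) = ?S"
        using less.IH yL by (intro sum.cong refl) (simp only: lessThan_iff)
      finally have 1: "L n x = ?S + L n (x - y)" .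
      have "lambda_char G n x = (\<Sum>i\<le>n. lambda_char G i (x - y) * lambda_char G (n - i) y)"
        using lambda_char_add[of G n "x - y" y] by simp
      also have "\<dots> = ?S + lambda_char G n (x - y) * lambda_char G 0 y"
        by (simp flip: lessThan_Suc_atMost del: plus_fun_apply times_fun_apply lambda_char_0)
      also have "lambda_char G n (x - y) * lambda_char G 0 y = lambda_char G n (x - y)"
        using lambda_char_closed[OF xy] by simp
      finally have "lambda_char G n x = ?S + lambda_char G n (x - y)" .
      then have "?S + L n (x - y) = ?S + lambda_char G n (x - y)" using 1 x by simp
      then show ?case by (rule add_left_imp_eq)
    qed
    then show "x - y \<in> {x \<in> ?R. \<forall>n. L n x = lambda_char G n x}" using xy by blast
  qed
  show ?thesis
  proof (rule ext)
    fix n show "L n = restrict (lambda_char G n) ?R"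
    proof
      fix x show "L n x = restrict (lambda_char G n) ?R x"
      proof (cases "x \<in> ?R")
        case True
        then show ?thesis using agree by (metis (mono_tags, lifting) mem_Collect_eq restrict_apply' subsetD)
      next
        case False
        then show ?thesis using PiE_arb[OF closed False] by (metis restrict_apply)
      qed
    qed
  qed
qed

lemma lambda_op_eq:
  assumes "x \<in> carrier (character_ring G)"
  shows "lambda_op G n x = lambda_char G n x"
proof -
  have "lambda_op G = (\<lambda>n. restrict (lambda_char G n) (carrier (character_ring G)))"
    unfolding lambda_op_def
    using lambda_operations_lambda_char lambda_operations_unique by (rule the_equality)
  then show ?thesis using assms by simp
qed

lemma character_ring_add_pow:
  assumes x: "x \<in> carrier (character_ring G)"
  shows "add_pow (character_ring G) (k::int) x = (\<lambda>g. of_int k * x g)"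
proof -
  interpret character: cring "character_ring G" by (rule cring_character_ring)
  have nat: "add_pow (character_ring G) n x = (\<lambda>g. of_nat n * x g)" for n :: nat
    by (induction n) (auto simp: add_pow_def nat_pow_def fun_eq_iff algebra_simps)
  have closed: "add_pow (character_ring G) n x \<in> carrier (character_ring G)" for n :: nat
    using x by (rule character.add.nat_pow_closed)
  show ?thesis
  proof (cases "k \<ge> 0")
    case True
    then show ?thesis using nat[of "nat k"] add_pow_int_ge[of k "character_ring G" x] by simp
  next
    case False
    then show ?thesis using nat[of "nat (- k)"] closed[of "nat (- k)"] add_pow_int_lt[of k "character_ring G" x]
      by (simp add: fun_eq_iff)
  qed
qed

lemma gamma_op_eq:
  assumes "x \<in> carrier (character_ring G)"
  shows "gamma_op G n x = lambda_char G n (x + (\<lambda>g. (of_nat n - 1) * trivial_character G g))"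
    and "gamma_op G n x \<in> carrier (character_ring G)"
proof -
  interpret character: cring "character_ring G" by (rule cring_character_ring)
  have "x \<oplus>\<^bsub>character_ring G\<^esub> add_pow (character_ring G) (int n - 1) \<one>\<^bsub>character_ring G\<^esub>
      \<in> carrier (character_ring G)"
    using assms by (intro character.a_closed character.add.int_pow_closed) auto
  then show "gamma_op G n x = lambda_char G n (x + (\<lambda>g. (of_nat n - 1) * trivial_character G g))"
    and "gamma_op G n x \<in> carrier (character_ring G)"
    using character_ring_add_pow[OF trivial_character_closed, of "int n - 1"]
    by (simp_all add: gamma_op_def lambda_op_eq lambda_char_closed del: plus_fun_apply)
qed

text \<open>At the identity all power sums of \<open>x + n - 1\<close> equal \<open>n - 1\<close>,
  so the series there is \<open>(1 + t)^(n - 1)\<close>, whose coefficient of degree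
  \<open>n\<close> vanishes. For \<open>n = 0\<close> the value is 1.\<close>

lemma gamma_op_at_one:
  assumes "x \<in> augmentation_ideal G" "n > 0"
  shows "gamma_op G n x \<one> = 0"
proof -
  have "x \<one> = 0" "x \<in> carrier (character_ring G)" using assms by (auto simp: augmentation_ideal_def)
  moreover have "lambda_series (\<lambda>k. of_nat n - 1) $ n = 0"
    using lambda_series_of_nat[of "n - 1"] assms(2)
      binomial_gbinomial[of "n - 1" n, where ?'a = complex]
    by (simp add: of_nat_diff binomial_eq_0 flip: fps_binomial_of_nat)
  ultimately show ?thesis by (simp add: gamma_op_eq(1) lambda_char_def)
qed

lemma gamma_op_1: "x \<in> carrier (character_ring G) \<Longrightarrow> gamma_op G 1 x = x"
  using lambda_char_1[of x] by (simp add: gamma_op_eq(1) plus_fun_def)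

end

context group_hom
begin

lemma pullback_lambda_char:
  "lambda_char G n (pullback_character G h x) = pullback_character G h (lambda_char H n x)"
  by (auto simp: lambda_char_def pullback_character_def fun_eq_iff hom_nat_pow simp del: nat_pow_Suc)

lemma pullback_gamma_op:
  assumes "x \<in> carrier (character_ring H)"
  shows "gamma_op G n (pullback_character G h x) = pullback_character G h (gamma_op H n x)"
proof -
  have "pullback_character G h x + (\<lambda>g. (of_nat n - 1) * trivial_character G g) =
      pullback_character G h (x + (\<lambda>g. (of_nat n - 1) * trivial_character H g))"
    by (auto simp: pullback_character_def fun_eq_iff)
  then show ?thesis
    using assms pullback_character_closed[OF assms]
    by (simp add: G.gamma_op_eq(1) H.gamma_op_eq(1) pullback_lambda_char del: plus_fun_apply pullback_character_simps)
qed

end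

section \<open>The gamma filtration\<close>

declare plus_fun_apply [simp del] minus_apply [simp del] zero_fun_apply [simp del] times_fun_apply [simp del]

lemmas fun_apply_simps = plus_fun_apply minus_apply zero_fun_apply times_fun_apply

definition gamma_generators :: "('a, 'm) monoid_scheme \<Rightarrow> nat \<Rightarrow> ('a \<Rightarrow> complex) set"
  where "gamma_generators G n =
    {gamma_product G ps | ps. snd ` set ps \<subseteq> augmentation_ideal G \<and> n \<le> sum_list (map fst ps)}"

lemma diff_closed_imp_group_closed:
  fixes A :: "'a::ab_group_add set"
  assumes "0 \<in> A" "\<And>x y. x \<in> A \<Longrightarrow> y \<in> A \<Longrightarrow> x - y \<in> A"
  shows "x \<in> A \<Longrightarrow> - x \<in> A" "x \<in> A \<Longrightarrow> y \<in> A \<Longrightarrow> x + y \<in> A"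
proof -
  show neg: "- x \<in> A" if "x \<in> A" for x using assms(2)[OF assms(1) that] by simp
  show "x + y \<in> A" if "x \<in> A" "y \<in> A" using assms(2)[OF that(1) neg[OF that(2)]] by simp
qed

text \<open>Bezout in the form \<open>a m = b n + 1\<close> gives
  \<open>z = a (m z) - b (n z)\<close>; this form requires \<open>m > 0\<close>. Multiples are
  written as constant sums so that the lemma serves functions and formal sums alike.\<close>

lemma coprime_multiples_mem:
  fixes A :: "'a::ab_group_add set"
  assumes A: "0 \<in> A" "\<And>x y. x \<in> A \<Longrightarrow> y \<in> A \<Longrightarrow> x - y \<in> A"
    and mem: "(\<Sum>i<m. z) \<in> A" "(\<Sum>i<n. z) \<in> A" and coprime: "coprime m n" and "m > (0::nat)"
  shows "z \<in> A"
proof -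
  have add: "(\<Sum>i<k + l. x) = (\<Sum>i<k. x) + (\<Sum>i<l. x)" for k l :: nat and x :: 'a
    by (induction l) (simp_all add: add_ac)
  have mult: "(\<Sum>i<k * l. x) = (\<Sum>i<k. \<Sum>j<l. x)" for k l :: nat and x :: 'a
    by (induction k) (simp_all add: add add_ac)
  have closed: "(\<Sum>i<k. x) \<in> A" if "x \<in> A" for k :: nat and x
    using that by (induction k) (simp_all add: A(1) diff_closed_imp_group_closed(2)[OF A])
  obtain a b where ab: "a * m = b * n + 1"
    using bezout_nat[of m n] \<open>m > 0\<close> coprime by (metis coprime_imp_gcd_eq_1 mult.commute not_gr0)
  have "(\<Sum>i<a. \<Sum>j<m. z) = (\<Sum>i<b. \<Sum>j<n. z) + z"
    by (simp only: mult[symmetric] ab add) simp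
  then have "z = (\<Sum>i<a. \<Sum>j<m. z) - (\<Sum>i<b. \<Sum>j<n. z)" by simp
  then show ?thesis using A(2)[OF closed[OF mem(1)] closed[OF mem(2)]] by metis
qed

lemma of_nat_mult_fun: "of_nat n * (x :: 'a \<Rightarrow> complex) = (\<lambda>g. of_nat n * x g)"
  by (simp add: fun_eq_iff fun_apply_simps)

context group
begin

abbreviation (input) "\<Gamma> \<equiv> gamma_filtration G"

lemma gamma_product_simps [simp]:
  "gamma_product G [] = trivial_character G"
  "gamma_product G (p # ps) = gamma_op G (fst p) (snd p) * gamma_product G ps"
  by (simp_all add: gamma_product_def case_prod_unfold)

lemma augmentation_ideal_closed: "x \<in> augmentation_ideal G \<Longrightarrow> x \<in> carrier (character_ring G)"
  by (simp add: augmentation_ideal_def)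

lemma gamma_product_closed:
  "snd ` set ps \<subseteq> augmentation_ideal G \<Longrightarrow> gamma_product G ps \<in> carrier (character_ring G)"
  by (induction ps) (auto intro!: character_ring_mult_closed gamma_op_eq(2) simp: augmentation_ideal_closed)

lemma gamma_product_append:
  assumes "snd ` set ps \<subseteq> augmentation_ideal G" "snd ` set qs \<subseteq> augmentation_ideal G"
  shows "gamma_product G (ps @ qs) = gamma_product G ps * gamma_product G qs"
  using assms(1)
  by (induction ps) (simp_all add: gamma_product_closed[OF assms(2)] mult.assoc)

lemma gamma_generators_closed: "gamma_generators G n \<subseteq> carrier (character_ring G)"
  using gamma_product_closed by (auto simp: gamma_generators_def)

lemma gamma_filtration_eq: "\<Gamma> n = group_closure (gamma_generators G n)"
proof -
  have "\<Gamma> n = generate (add_monoid (character_ring G)) (gamma_generators G n)"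
    by (simp add: gamma_filtration_def gamma_generators_def)
  also have "\<dots> = group_closure (gamma_generators G n)"
    using gamma_generators_closed by (intro generate_eq_group_closure) auto
  finally show ?thesis .
qed

lemma gamma_filtration_zero [simp]: "0 \<in> \<Gamma> n"
  by (simp add: gamma_filtration_eq)

lemma gamma_filtration_diff: "x \<in> \<Gamma> n \<Longrightarrow> y \<in> \<Gamma> n \<Longrightarrow> x - y \<in> \<Gamma> n"
  by (simp add: gamma_filtration_eq group_closure.diff)

lemma gamma_filtration_add: "x \<in> \<Gamma> n \<Longrightarrow> y \<in> \<Gamma> n \<Longrightarrow> x + y \<in> \<Gamma> n"
  by (simp add: gamma_filtration_eq group_closure_add)

lemma gamma_filtration_uminus [simp]: "- x \<in> \<Gamma> n \<longleftrightarrow> x \<in> \<Gamma> n"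
  by (simp add: gamma_filtration_eq)

lemma gamma_filtration_sum:
  "(\<And>i. i \<in> A \<Longrightarrow> f i \<in> \<Gamma> n) \<Longrightarrow> sum f A \<in> \<Gamma> n"
  by (induction A rule: infinite_finite_induct) (simp_all add: gamma_filtration_add)

lemma gamma_filtration_subsetI:
  assumes "\<And>ps. snd ` set ps \<subseteq> augmentation_ideal G \<Longrightarrow> n \<le> sum_list (map fst ps) \<Longrightarrow> gamma_product G ps \<in> A"
    "0 \<in> A" "\<And>x y. x \<in> A \<Longrightarrow> y \<in> A \<Longrightarrow> x - y \<in> A"
  shows "\<Gamma> n \<subseteq> A"
  unfolding gamma_filtration_eq using assms by (intro group_closure_subset) (auto simp: gamma_generators_def)

lemma gamma_product_in_filtration:
  "snd ` set ps \<subseteq> augmentation_ideal G \<Longrightarrow> n \<le> sum_list (map fst ps) \<Longrightarrow> gamma_product G ps \<in> \<Gamma> n"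
  unfolding gamma_filtration_eq by (rule group_closure.base) (auto simp: gamma_generators_def)

lemma gamma_filtration_closed: "x \<in> \<Gamma> n \<Longrightarrow> x \<in> carrier (character_ring G)"
  by (rule subsetD[OF gamma_filtration_subsetI]) (auto intro: gamma_product_closed)

lemma gamma_filtration_antimono: "m \<le> n \<Longrightarrow> \<Gamma> n \<subseteq> \<Gamma> m"
  by (rule gamma_filtration_subsetI) (auto intro: gamma_product_in_filtration gamma_filtration_diff)

text \<open>Generators are multiplied by concatenating their lists, which adds the weights;
  bilinearity extends this to one factor and then to the other.\<close>

lemma gamma_filtration_mult:
  assumes "x \<in> \<Gamma> m" "y \<in> \<Gamma> n"
  shows "x * y \<in> \<Gamma> (m + n)"
proof -
  have gen: "\<Gamma> n \<subseteq> {y. gamma_product G ps * y \<in> \<Gamma> (m + n)}"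
    if ps: "snd ` set ps \<subseteq> augmentation_ideal G" "m \<le> sum_list (map fst ps)" for ps
  proof (rule gamma_filtration_subsetI)
    fix qs assume qs: "snd ` set qs \<subseteq> augmentation_ideal G" "n \<le> sum_list (map fst qs)"
    have "gamma_product G (ps @ qs) \<in> \<Gamma> (m + n)"
      using ps qs by (intro gamma_product_in_filtration) auto
    then show "gamma_product G qs \<in> {y. gamma_product G ps * y \<in> \<Gamma> (m + n)}"
      using ps qs by (simp add: gamma_product_append)
  qed (simp_all add: right_diff_distrib gamma_filtration_diff)
  have "\<Gamma> m \<subseteq> {x. x * y \<in> \<Gamma> (m + n)}"
    using gen assms(2)
    by (intro gamma_filtration_subsetI) (auto simp: left_diff_distrib gamma_filtration_diff)
  then show ?thesis using assms(1) by blast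
qed

lemma augmentation_ideal_subset_gamma_1: "augmentation_ideal G \<subseteq> \<Gamma> 1"
proof
  fix x assume x: "x \<in> augmentation_ideal G"
  then have "gamma_product G [(1, x)] = x"
    using augmentation_ideal_closed[OF x] gamma_op_1 by simp
  then show "x \<in> \<Gamma> 1" using gamma_product_in_filtration[of "[(1, x)]" 1] x by simp
qed

lemma gamma_filtration_1: "\<Gamma> 1 = augmentation_ideal G"
proof
  show "\<Gamma> 1 \<subseteq> augmentation_ideal G"
  proof (rule gamma_filtration_subsetI)
    fix ps :: "(nat \<times> ('a \<Rightarrow> complex)) list"
    assume ps: "snd ` set ps \<subseteq> augmentation_ideal G" "1 \<le> sum_list (map fst ps)"
    have "gamma_product G ps \<one> = 0" using ps
    proof (induction ps)
      case (Cons p ps)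
      \<comment> \<open>A factor of weight 0 leaves the whole weight to the tail, where the
        induction hypothesis applies; a factor of positive weight already vanishes at the
        identity.\<close>
      then show ?case using gamma_op_at_one[of "snd p" "fst p"]
        by (cases "fst p = 0") (auto simp: times_fun_apply)
    qed simp
    then show "gamma_product G ps \<in> augmentation_ideal G"
      using gamma_product_closed[OF ps(1)] by (simp add: augmentation_ideal_def)
  qed (auto simp: augmentation_ideal_def fun_apply_simps)
qed (rule augmentation_ideal_subset_gamma_1)

lemma trivial_character_in_gamma_0: "trivial_character G \<in> \<Gamma> 0"
  using gamma_product_in_filtration[of "[]" 0] by simp

lemma gamma_filtration_at_one:
  assumes "x \<in> \<Gamma> n" "n > 0"
  shows "x \<one> = 0"
  using assms gamma_filtration_antimono[of 1 n] gamma_filtration_1 by (auto simp: augmentation_ideal_def)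

lemma gamma_filtration_scale:
  assumes "x \<in> \<Gamma> n" "c \<in> \<int>"
  shows "(\<lambda>g. c * x g) \<in> \<Gamma> n"
proof -
  have nat: "(\<lambda>g. of_nat k * x g) \<in> \<Gamma> n" for k :: nat
  proof (induction k)
    case (Suc k)
    have "(\<lambda>g. of_nat (Suc k) * x g) = (\<lambda>g. of_nat k * x g) + x"
      by (simp add: fun_eq_iff distrib_right fun_apply_simps)
    then show ?case using gamma_filtration_add[OF Suc assms(1)] by simp
  qed (simp flip: zero_fun_def)
  obtain k where "c = of_int k" using assms(2) by (rule Ints_cases)
  then show ?thesis
  proof (cases k rule: int_cases2)
    case (nonneg n)
    then show ?thesis using nat[of n] \<open>c = of_int k\<close> by simp
  next
    case (nonpos m)
    have "(\<lambda>g. c * x g) = - (\<lambda>g. of_nat m * x g)" using nonpos \<open>c = of_int k\<close> by (simp add: fun_eq_iff)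
    then show ?thesis using nat[of m] by simp
  qed
qed

text \<open>The empty product contributes the trivial character and hence its integer multiples.
  Subtracting from \<open>x\<close> its degree leaves an element of the augmentation ideal, which
  lies in \<open>\<Gamma>\<^sup>1\<close>.\<close>

lemma gamma_filtration_0: "\<Gamma> 0 = carrier (character_ring G)"
proof
  show "carrier (character_ring G) \<subseteq> \<Gamma> 0"
  proof
    fix x assume x: "x \<in> carrier (character_ring G)"
    define c where "c = (\<lambda>g. x \<one> * trivial_character G g)"
    have c: "c \<in> \<Gamma> 0"
      unfolding c_def by (intro gamma_filtration_scale trivial_character_in_gamma_0 character_at_one_int x)
    then have "x - c \<in> augmentation_ideal G"
      using x gamma_filtration_closed[OF c] by (auto simp: augmentation_ideal_def c_def fun_apply_simps)
    then have "x - c \<in> \<Gamma> 0"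
      using augmentation_ideal_subset_gamma_1 gamma_filtration_antimono[of 0 1] by auto
    from gamma_filtration_add[OF this c] show "x \<in> \<Gamma> 0" by simp
  qed
qed (use gamma_filtration_closed in blast)

text \<open>On whatever \<open>\<rho>\<close> annihilates, multiplication by its degree \<open>m\<close> is multiplication by
  \<open>m - \<rho>\<close>, which lies in \<open>\<Gamma>\<^sup>1\<close>.\<close>
lemma gamma_filtration_annihilated:
  assumes \<rho>: "\<rho> \<in> carrier (character_ring G)" "\<rho> \<one> = of_nat m"
    and x: "x \<in> \<Gamma> n" "x * \<rho> = 0"
  shows "of_nat m * x \<in> \<Gamma> (Suc n)"
proof -
  define c where "c = (\<lambda>g. of_nat m * trivial_character G g)"
  have c: "c \<in> carrier (character_ring G)"
    using gamma_filtration_closed[OF gamma_filtration_scale[OF trivial_character_in_gamma_0]]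
    by (simp add: c_def)
  have "c - \<rho> \<in> augmentation_ideal G"
    using \<rho> c by (auto simp: augmentation_ideal_def c_def fun_apply_simps)
  then have "c - \<rho> \<in> \<Gamma> 1" using augmentation_ideal_subset_gamma_1 by blast
  from gamma_filtration_mult[OF x(1) this] have "x * (c - \<rho>) \<in> \<Gamma> (Suc n)" by simp
  moreover have "x * (c - \<rho>) = of_nat m * x"
    using character_ring_off_carrier[OF gamma_filtration_closed[OF x(1)]]
    by (auto simp: right_diff_distrib x(2) fun_eq_iff fun_apply_simps of_nat_mult_fun c_def trivial_character_def)
  ultimately show ?thesis by simp
qed

lemma gamma_filtration_order_mult:
  assumes "finite (carrier G)" "x \<in> \<Gamma> n" "x \<one> = 0"
  shows "of_nat (Coset.order G) * x \<in> \<Gamma> (Suc n)"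
  using assms(2,3)
  by (intro gamma_filtration_annihilated[OF regular_character_closed[OF assms(1)]])
    (auto simp: fun_eq_iff fun_apply_simps)

end

context group_hom
begin

lemma pullback_augmentation_ideal:
  "x \<in> augmentation_ideal H \<Longrightarrow> pullback_character G h x \<in> augmentation_ideal G"
  by (auto simp: augmentation_ideal_def pullback_character_def)
    (use pullback_character_closed in \<open>auto simp: pullback_character_def\<close>)

lemma pullback_gamma_product:
  assumes "snd ` set ps \<subseteq> augmentation_ideal H"
  shows "pullback_character G h (gamma_product H ps) =
    gamma_product G (map (apsnd (pullback_character G h)) ps)"
  using assms
  by (induction ps) (auto simp: pullback_gamma_op H.augmentation_ideal_closed)

lemma pullback_gamma_filtration:
  assumes "x \<in> gamma_filtration H n"
  shows "pullback_character G h x \<in> gamma_filtration G n"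
proof -
  have "gamma_filtration H n \<subseteq> {x. pullback_character G h x \<in> gamma_filtration G n}"
  proof (rule H.gamma_filtration_subsetI)
    fix ps :: "(nat \<times> ('c \<Rightarrow> complex)) list"
    assume ps: "snd ` set ps \<subseteq> augmentation_ideal H" "n \<le> sum_list (map fst ps)"
    let ?ps = "map (apsnd (pullback_character G h)) ps"
    have "map fst ?ps = map fst ps" by simp
    moreover have "snd ` set ?ps \<subseteq> augmentation_ideal G"
      using ps(1) pullback_augmentation_ideal by auto
    ultimately have "gamma_product G ?ps \<in> gamma_filtration G n"
      using ps(2) by (intro G.gamma_product_in_filtration) metis+
    then show "gamma_product H ps \<in> {x. pullback_character G h x \<in> gamma_filtration G n}"
      using pullback_gamma_product[OF ps(1)] by simp
  qed (simp_all add: G.gamma_filtration_diff)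
  then show ?thesis using assms by blast
qed

end

section \<open>The graded character ring\<close>

text \<open>Quotients by filtration steps and by the tensor relations both use cosets of an additive
  record; in both cases they reduce to this translate inside the ambient type.\<close>

definition coset :: "'a::ab_group_add set \<Rightarrow> 'a \<Rightarrow> 'a set"
  where "coset A x = (\<lambda>a. a + x) ` A"

lemma coset_0 [simp]: "coset A 0 = A"
  by (simp add: coset_def)

context
  fixes A :: "'a::ab_group_add set"
  assumes A: "0 \<in> A" "\<And>x y. x \<in> A \<Longrightarrow> y \<in> A \<Longrightarrow> x - y \<in> A"
begin

lemma mem_coset_iff: "z \<in> coset A x \<longleftrightarrow> z - x \<in> A"
  by (force simp: coset_def)

lemma coset_eq_iff: "coset A x = coset A y \<longleftrightarrow> x - y \<in> A"
proof
  assume "coset A x = coset A y"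
  then show "x - y \<in> A" using A(1) mem_coset_iff[of x x] mem_coset_iff[of x y] by simp
next
  assume xy: "x - y \<in> A"
  have "z - x \<in> A \<longleftrightarrow> z - y \<in> A" for z
    using diff_closed_imp_group_closed(2)[OF A, of "z - x" "x - y"] A(2)[of "z - y" "x - y"] xy by auto
  then show "coset A x = coset A y" by (auto simp: mem_coset_iff)
qed

lemma coset_add: "(\<Union>a\<in>coset A x. \<Union>b\<in>coset A y. {a + b}) = coset A (x + y)"
proof (intro equalityI subsetI)
  fix z assume "z \<in> (\<Union>a\<in>coset A x. \<Union>b\<in>coset A y. {a + b})"
  then obtain a b where "a - x \<in> A" "b - y \<in> A" "z = a + b" by (auto simp: mem_coset_iff)
  then show "z \<in> coset A (x + y)"
    using diff_closed_imp_group_closed(2)[OF A, of "a - x" "b - y"] by (simp add: mem_coset_iff algebra_simps)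
next
  fix z assume "z \<in> coset A (x + y)"
  then have "z - y \<in> coset A x" "y \<in> coset A y" by (simp_all add: mem_coset_iff A(1) algebra_simps)
  then show "z \<in> (\<Union>a\<in>coset A x. \<Union>b\<in>coset A y. {a + b})" by (metis (no_types, lifting) UN_iff diff_add_cancel insertI1)
qed

end

definition seq_mult :: "(nat \<Rightarrow> 'a::comm_semiring_0) \<Rightarrow> (nat \<Rightarrow> 'a) \<Rightarrow> nat \<Rightarrow> 'a"
  where "seq_mult u v = (\<lambda>n. \<Sum>i\<le>n. u i * v (n - i))"

lemma seq_mult_assoc:
  fixes u v w :: "nat \<Rightarrow> 'a::comm_semiring_0"
  shows "seq_mult (seq_mult u v) w = seq_mult u (seq_mult v w)"
proof -
  have "Abs_fps u * Abs_fps v * Abs_fps w = Abs_fps u * (Abs_fps v * Abs_fps w)"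
    by (rule mult.assoc)
  moreover have "Abs_fps u * Abs_fps v = Abs_fps (seq_mult u v)" for u v :: "nat \<Rightarrow> 'a"
    by (simp add: fps_eq_iff fps_mult_nth seq_mult_def atLeast0AtMost)
  ultimately show ?thesis by (simp add: fps_eq_iff fun_eq_iff)
qed

lemma seq_mult_distrib:
  "seq_mult (u + u') v = seq_mult u v + seq_mult u' v" "seq_mult u (v + v') = seq_mult u v + seq_mult u v'"
  by (simp_all add: seq_mult_def fun_eq_iff plus_fun_apply sum.distrib algebra_simps)

text \<open>Almost all terms of the sequence itself must vanish, although the direct sum asks this
  only of their classes; nothing is lost, because a trivial class can always be represented by
  0.\<close>

definition graded_reps :: "('a, 'm) monoid_scheme \<Rightarrow> (nat \<Rightarrow> 'a \<Rightarrow> complex) set"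
  where "graded_reps G = {u. (\<forall>n. u n \<in> gamma_filtration G n) \<and> finite {n. u n \<noteq> 0}}"

definition graded_class :: "('a, 'm) monoid_scheme \<Rightarrow> (nat \<Rightarrow> 'a \<Rightarrow> complex) \<Rightarrow> nat \<Rightarrow> ('a \<Rightarrow> complex) set"
  where "graded_class G u = (\<lambda>n. coset (gamma_filtration G (Suc n)) (u n))"

lemma graded_character_ring_mult:
  "x \<otimes>\<^bsub>graded_character_ring G\<^esub> y = (\<lambda>n. finprod (graded_piece G n)
    (\<lambda>i. rcoset_mult (character_ring G) (gamma_filtration G (Suc n)) (x i) (y (n - i))) {..n})"
  by (simp add: graded_character_ring_def Let_def)

context group
begin

lemma gamma_a_r_coset [simp]: "A +>\<^bsub>character_ring G\<^esub> x = coset A x"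
  by (auto simp: a_r_coset_def r_coset_def coset_def)

lemma gamma_coset_eq_iff:
  "coset (\<Gamma> n) x = coset (\<Gamma> n) y \<longleftrightarrow> x - y \<in> \<Gamma> n"
  by (rule coset_eq_iff) (auto intro: gamma_filtration_diff)

lemma graded_repsD: "u \<in> graded_reps G \<Longrightarrow> u n \<in> \<Gamma> n"
  by (simp add: graded_reps_def)

lemma graded_reps_finite: "u \<in> graded_reps G \<Longrightarrow> finite {n. u n \<noteq> 0}"
  by (simp add: graded_reps_def)

lemma graded_reps_zero [simp]: "0 \<in> graded_reps G"
  by (simp add: graded_reps_def zero_fun_apply)

lemma graded_reps_diff: "u \<in> graded_reps G \<Longrightarrow> v \<in> graded_reps G \<Longrightarrow> u - v \<in> graded_reps G"
  by (auto simp: graded_reps_def minus_apply gamma_filtration_diff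
      intro: finite_subset[of _ "{n. u n \<noteq> 0} \<union> {n. v n \<noteq> 0}"])

lemma graded_reps_add: "u \<in> graded_reps G \<Longrightarrow> v \<in> graded_reps G \<Longrightarrow> u + v \<in> graded_reps G"
  using diff_closed_imp_group_closed(2)[of "graded_reps G"] graded_reps_diff by simp

lemma graded_reps_uminus: "u \<in> graded_reps G \<Longrightarrow> - u \<in> graded_reps G"
  using diff_closed_imp_group_closed(1)[of "graded_reps G"] graded_reps_diff by simp

lemma graded_reps_seq_mult:
  assumes "u \<in> graded_reps G" "v \<in> graded_reps G"
  shows "seq_mult u v \<in> graded_reps G"
  unfolding graded_reps_def
proof (intro CollectI conjI allI)
  fix n show "seq_mult u v n \<in> \<Gamma> n"
    unfolding seq_mult_def
  proof (rule gamma_filtration_sum)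
    fix i assume "i \<in> {..n}"
    then show "u i * v (n - i) \<in> \<Gamma> n"
      using gamma_filtration_mult[OF graded_repsD[OF assms(1), of i] graded_repsD[OF assms(2), of "n - i"]]
      by simp
  qed
next
  let ?U = "{n. u n \<noteq> 0}" and ?V = "{n. v n \<noteq> 0}"
  have "{n. seq_mult u v n \<noteq> 0} \<subseteq> (\<lambda>(i, j). i + j) ` (?U \<times> ?V)"
  proof
    fix n assume "n \<in> {n. seq_mult u v n \<noteq> 0}"
    then obtain i where "i \<le> n" "u i * v (n - i) \<noteq> 0"
      unfolding seq_mult_def by (metis (mono_tags, lifting) atMost_iff mem_Collect_eq sum.neutral)
    then show "n \<in> (\<lambda>(i, j). i + j) ` (?U \<times> ?V)"
      by (intro image_eqI[of _ _ "(i, n - i)"]) auto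
  qed
  then show "finite {n. seq_mult u v n \<noteq> 0}"
    using graded_reps_finite[OF assms(1)] graded_reps_finite[OF assms(2)] finite_subset by blast
qed

lemma graded_class_eq_iff:
  "graded_class G u = graded_class G v \<longleftrightarrow> (\<forall>n. u n - v n \<in> \<Gamma> (Suc n))"
  by (simp add: graded_class_def fun_eq_iff[of "\<lambda>n. coset (\<Gamma> (Suc n)) (u n)"] gamma_coset_eq_iff)

abbreviation (input) "gamma_group n \<equiv> (add_monoid (character_ring G))\<lparr>carrier := \<Gamma> n\<rparr>"

lemma comm_group_gamma: "comm_group (gamma_group n)"
  by (rule comm_groupI)
    (auto simp: gamma_filtration_add add.assoc add.commute intro!: bexI[of _ "- x" for x])

lemma subgroup_gamma: "subgroup (\<Gamma> (Suc n)) (gamma_group n)"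
proof -
  interpret M: comm_group "gamma_group n" by (rule comm_group_gamma)
  have sub: "\<Gamma> (Suc n) \<subseteq> \<Gamma> n" by (rule gamma_filtration_antimono) simp
  show ?thesis
  proof (rule M.subgroupI)
    show "\<Gamma> (Suc n) \<noteq> {}" using gamma_filtration_zero by blast
    fix a assume a: "a \<in> \<Gamma> (Suc n)"
    have "inv\<^bsub>gamma_group n\<^esub> a = - a"
      using a sub by (intro M.inv_equality) auto
    then show "inv\<^bsub>gamma_group n\<^esub> a \<in> \<Gamma> (Suc n)" using a by simp
  qed (use sub in \<open>auto simp: gamma_filtration_add\<close>)
qed

lemma comm_group_graded_piece: "comm_group (graded_piece G n)"
  unfolding graded_piece_def
  by (rule comm_group.abelian_FactGroup[OF comm_group_gamma subgroup_gamma])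

lemma graded_piece_simps:
  "carrier (graded_piece G n) = coset (\<Gamma> (Suc n)) ` \<Gamma> n"
  "\<one>\<^bsub>graded_piece G n\<^esub> = coset (\<Gamma> (Suc n)) 0"
  by (auto simp: graded_piece_def FactGroup_def RCOSETS_def r_coset_def coset_def)

lemma graded_piece_mult:
  "coset (\<Gamma> (Suc n)) x \<otimes>\<^bsub>graded_piece G n\<^esub> coset (\<Gamma> (Suc n)) y =
    coset (\<Gamma> (Suc n)) (x + y)"
proof -
  have "coset (\<Gamma> (Suc n)) x \<otimes>\<^bsub>graded_piece G n\<^esub> coset (\<Gamma> (Suc n)) y =
      (\<Union>a\<in>coset (\<Gamma> (Suc n)) x. \<Union>b\<in>coset (\<Gamma> (Suc n)) y. {a + b})"
    by (simp add: graded_piece_def FactGroup_def set_mult_def)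
  also have "\<dots> = coset (\<Gamma> (Suc n)) (x + y)"
    by (rule coset_add[OF gamma_filtration_zero gamma_filtration_diff])
  finally show ?thesis .
qed

lemma finprod_graded_piece:
  assumes "finite A" "\<And>i. i \<in> A \<Longrightarrow> f i \<in> \<Gamma> n"
  shows "finprod (graded_piece G n) (\<lambda>i. coset (\<Gamma> (Suc n)) (f i)) A =
    coset (\<Gamma> (Suc n)) (sum f A)"
  using assms
proof (induction A rule: finite_induct)
  case empty
  interpret P: comm_group "graded_piece G n" by (rule comm_group_graded_piece)
  show ?case using P.finprod_empty graded_piece_simps(2) by simp
next
  case (insert a A)
  interpret P: comm_group "graded_piece G n" by (rule comm_group_graded_piece)
  show ?case using insert by (subst P.finprod_insert) (auto simp: graded_piece_simps(1) graded_piece_mult)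
qed

text \<open>Changing representatives alters the product by \<open>(a' - a) b' + a (b' - b)\<close>,
  and each summand lies in the filtration step after \<open>i + j\<close>. All cosets united in
  \<open>rcoset_mult\<close> are therefore equal.\<close>

lemma rcoset_mult_gamma:
  assumes a: "a \<in> \<Gamma> i" and b: "b \<in> \<Gamma> j"
  shows "rcoset_mult (character_ring G) (\<Gamma> (Suc (i + j)))
      (coset (\<Gamma> (Suc i)) a) (coset (\<Gamma> (Suc j)) b) =
    coset (\<Gamma> (Suc (i + j))) (a * b)"
proof -
  have eq: "coset (\<Gamma> (Suc (i + j))) (a' * b') = coset (\<Gamma> (Suc (i + j))) (a * b)"
    if "a' - a \<in> \<Gamma> (Suc i)" "b' - b \<in> \<Gamma> (Suc j)" for a' b'
  proof -
    have "b' \<in> \<Gamma> j"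
      using gamma_filtration_add[OF b, of "b' - b"] gamma_filtration_antimono[of j "Suc j"] that(2) by auto
    then have "(a' - a) * b' \<in> \<Gamma> (Suc (i + j))" "a * (b' - b) \<in> \<Gamma> (Suc (i + j))"
      using gamma_filtration_mult[OF that(1), of b' j] gamma_filtration_mult[OF a that(2)] by simp_all
    moreover have "a' * b' - a * b = (a' - a) * b' + a * (b' - b)" by (simp add: algebra_simps)
    ultimately show ?thesis using gamma_filtration_add gamma_coset_eq_iff by metis
  qed
  have mem: "z \<in> coset (\<Gamma> n) x \<Longrightarrow> z - x \<in> \<Gamma> n" for z x n
    by (simp add: mem_coset_iff gamma_filtration_diff)
  have "(\<Union>a'\<in>coset (\<Gamma> (Suc i)) a. \<Union>b'\<in>coset (\<Gamma> (Suc j)) b.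
      coset (\<Gamma> (Suc (i + j))) (a' * b')) =
    (\<Union>a'\<in>coset (\<Gamma> (Suc i)) a. \<Union>b'\<in>coset (\<Gamma> (Suc j)) b.
      coset (\<Gamma> (Suc (i + j))) (a * b))"
    by (intro SUP_cong refl eq mem)
  moreover have "a \<in> coset (\<Gamma> (Suc i)) a" "b \<in> coset (\<Gamma> (Suc j)) b"
    by (simp_all add: mem_coset_iff gamma_filtration_diff)
  then have "coset (\<Gamma> (Suc i)) a \<noteq> {}" "coset (\<Gamma> (Suc j)) b \<noteq> {}" by blast+
  ultimately show ?thesis by (simp add: rcoset_mult_def)
qed

lemma sum_group_graded_piece_carrier:
  "carrier (sum_group UNIV (graded_piece G)) = graded_class G ` graded_reps G"
proof -
  have grp: "group (graded_piece G n)" for n using comm_group_graded_piece by (rule comm_group.axioms(2))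
  have carr: "carrier (sum_group UNIV (graded_piece G)) =
      {x. (\<forall>n. x n \<in> carrier (graded_piece G n)) \<and> finite {n. x n \<noteq> \<one>\<^bsub>graded_piece G n\<^esub>}}"
    using carrier_sum_group[of UNIV "graded_piece G"] grp by auto
  show ?thesis
  proof (intro equalityI subsetI)
    fix x assume "x \<in> carrier (sum_group UNIV (graded_piece G))"
    then have x: "\<And>n. x n \<in> carrier (graded_piece G n)" "finite {n. x n \<noteq> \<one>\<^bsub>graded_piece G n\<^esub>}"
      unfolding carr by auto
    have "\<exists>f. f \<in> \<Gamma> n \<and> x n = coset (\<Gamma> (Suc n)) f \<and>
        (x n = \<one>\<^bsub>graded_piece G n\<^esub> \<longrightarrow> f = 0)" for n
    proof (cases "x n = \<one>\<^bsub>graded_piece G n\<^esub>")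
      case True
      then show ?thesis by (intro exI[of _ 0]) (simp add: graded_piece_simps)
    next
      case False
      then show ?thesis using x(1)[of n] unfolding graded_piece_simps by blast
    qed
    then obtain u where u: "\<And>n. u n \<in> \<Gamma> n"
      "\<And>n. x n = coset (\<Gamma> (Suc n)) (u n)" "\<And>n. x n = \<one>\<^bsub>graded_piece G n\<^esub> \<Longrightarrow> u n = 0"
      by metis
    have "{n. u n \<noteq> 0} \<subseteq> {n. x n \<noteq> \<one>\<^bsub>graded_piece G n\<^esub>}" using u(3) by auto
    then have "u \<in> graded_reps G" using u(1) x(2) finite_subset unfolding graded_reps_def by blast
    moreover have "x = graded_class G u" using u(2) by (auto simp: graded_class_def)
    ultimately show "x \<in> graded_class G ` graded_reps G" by blast
  next
    fix x assume "x \<in> graded_class G ` graded_reps G"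
    then obtain u where u: "u \<in> graded_reps G" "x = graded_class G u" by blast
    have "{n. x n \<noteq> \<one>\<^bsub>graded_piece G n\<^esub>} \<subseteq> {n. u n \<noteq> 0}"
      by (auto simp: u(2) graded_class_def graded_piece_simps)
    then have "finite {n. x n \<noteq> \<one>\<^bsub>graded_piece G n\<^esub>}" using graded_reps_finite[OF u(1)] finite_subset by blast
    then show "x \<in> carrier (sum_group UNIV (graded_piece G))"
      using graded_repsD[OF u(1)] unfolding carr
      by (auto simp: u(2) graded_class_def graded_piece_simps)
  qed
qed

abbreviation "gr \<equiv> graded_character_ring G"

lemma graded_ring_carrier: "carrier gr = graded_class G ` graded_reps G"
  by (simp add: graded_character_ring_def Let_def sum_group_graded_piece_carrier)

lemma graded_ring_add:
  "graded_class G u \<oplus>\<^bsub>gr\<^esub> graded_class G v = graded_class G (u + v)"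
  by (simp add: graded_character_ring_def Let_def graded_class_def graded_piece_mult plus_fun_apply restrict_def)

lemma graded_ring_zero: "\<zero>\<^bsub>gr\<^esub> = graded_class G 0"
  by (simp add: graded_character_ring_def Let_def graded_class_def graded_piece_simps zero_fun_apply restrict_def)

definition graded_unit :: "nat \<Rightarrow> 'a \<Rightarrow> complex"
  where "graded_unit = (\<lambda>n. if n = 0 then trivial_character G else 0)"

lemma graded_unit_closed [simp]: "graded_unit \<in> graded_reps G"
  by (auto simp: graded_reps_def graded_unit_def trivial_character_in_gamma_0
      intro: finite_subset[of _ "{0}"])

lemma graded_ring_one: "\<one>\<^bsub>gr\<^esub> = graded_class G graded_unit"
  by (simp add: graded_character_ring_def Let_def graded_class_def graded_piece_simps graded_unit_def fun_eq_iff)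

lemma graded_ring_mult:
  assumes "u \<in> graded_reps G" "v \<in> graded_reps G"
  shows "graded_class G u \<otimes>\<^bsub>gr\<^esub> graded_class G v = graded_class G (seq_mult u v)"
proof
  fix n
  interpret P: comm_group "graded_piece G n" by (rule comm_group_graded_piece)
  have prod: "u i * v (n - i) \<in> \<Gamma> n" if "i \<le> n" for i
    using gamma_filtration_mult[OF graded_repsD[OF assms(1), of i] graded_repsD[OF assms(2), of "n - i"]] that
    by simp
  have "(graded_class G u \<otimes>\<^bsub>gr\<^esub> graded_class G v) n =
    finprod (graded_piece G n) (\<lambda>i. coset (\<Gamma> (Suc n)) (u i * v (n - i))) {..n}"
    unfolding graded_character_ring_mult
  proof (rule P.finprod_cong')
    fix i assume "i \<in> {..n}"
    then show "rcoset_mult (character_ring G) (\<Gamma> (Suc n)) (graded_class G u i)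
        (graded_class G v (n - i)) = coset (\<Gamma> (Suc n)) (u i * v (n - i))"
      using rcoset_mult_gamma[OF graded_repsD[OF assms(1), of i] graded_repsD[OF assms(2), of "n - i"]]
      by (simp add: graded_class_def)
  qed (use prod in \<open>auto simp: graded_piece_simps\<close>)
  also have "\<dots> = graded_class G (seq_mult u v) n"
    using prod finprod_graded_piece[of "{..n}" "\<lambda>i. u i * v (n - i)" n]
    by (simp add: graded_class_def seq_mult_def)
  finally show "(graded_class G u \<otimes>\<^bsub>gr\<^esub> graded_class G v) n = graded_class G (seq_mult u v) n" .
qed

definition degree_reps :: "nat \<Rightarrow> (nat \<Rightarrow> 'a \<Rightarrow> complex) set"
  where "degree_reps n = {u \<in> graded_reps G. \<forall>m. m \<noteq> n \<longrightarrow> u m = 0}"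

lemma graded_ring_homogeneous: "homogeneous gr n = graded_class G ` degree_reps n"
proof (intro equalityI subsetI)
  fix x assume "x \<in> homogeneous gr n"
  then have x: "x \<in> graded_class G ` graded_reps G" "\<And>m. m \<noteq> n \<Longrightarrow> x m = coset (\<Gamma> (Suc m)) 0"
    by (auto simp: graded_character_ring_def Let_def sum_group_graded_piece_carrier graded_piece_simps)
  then obtain u where u: "u \<in> graded_reps G" "x = graded_class G u" by blast
  \<comment> \<open>Truncation to degree \<open>n\<close> changes no class, since the other
    components of \<open>x\<close> are trivial; the truncated sequence is literally zero
    there.\<close>
  define v where "v m = (if m = n then u m else 0)" for m
  have "v \<in> degree_reps n"
    using u(1) by (auto simp: degree_reps_def graded_reps_def v_def)
  moreover have "x = graded_class G v"
    using x(2) by (auto simp: u(2) graded_class_def v_def fun_eq_iff)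
  ultimately show "x \<in> graded_class G ` degree_reps n" by blast
next
  fix x assume "x \<in> graded_class G ` degree_reps n"
  then show "x \<in> homogeneous gr n"
    by (auto simp: graded_character_ring_def Let_def sum_group_graded_piece_carrier graded_piece_simps
        degree_reps_def graded_class_def)
qed

lemma seq_mult_unit:
  assumes "u \<in> graded_reps G"
  shows "seq_mult graded_unit u = u" "seq_mult u graded_unit = u"
proof -
  have triv: "trivial_character G * u n = u n" "u n * trivial_character G = u n" for n
    using gamma_filtration_closed[OF graded_repsD[OF assms]] by simp_all
  have "(\<Sum>i\<le>n. graded_unit i * u (n - i)) = (\<Sum>i\<in>{0}. graded_unit i * u (n - i))" for n
    by (rule sum.mono_neutral_right) (auto simp: graded_unit_def)
  then show "seq_mult graded_unit u = u" by (simp add: seq_mult_def graded_unit_def triv)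
  have "(\<Sum>i\<le>n. u i * graded_unit (n - i)) = (\<Sum>i\<in>{n}. u i * graded_unit (n - i))" for n
    by (rule sum.mono_neutral_right) (auto simp: graded_unit_def)
  then show "seq_mult u graded_unit = u" by (simp add: seq_mult_def graded_unit_def triv)
qed

lemma ring_graded_character_ring: "ring gr"
proof (rule ringI)
  show "abelian_group gr"
  proof (rule abelian_groupI)
    fix x assume "x \<in> carrier gr"
    then obtain u where u: "u \<in> graded_reps G" "x = graded_class G u" by (auto simp: graded_ring_carrier)
    then show "\<exists>y\<in>carrier gr. y \<oplus>\<^bsub>gr\<^esub> x = \<zero>\<^bsub>gr\<^esub>"
      by (intro bexI[of _ "graded_class G (- u)"])
        (auto simp: graded_ring_carrier graded_ring_add graded_ring_zero graded_reps_uminus)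
  qed (auto simp: graded_ring_carrier graded_ring_add graded_ring_zero add_ac
      intro!: imageI graded_reps_add)
  show "Group.monoid gr"
    by (rule monoidI)
      (auto simp: graded_ring_carrier graded_ring_mult graded_ring_one graded_reps_seq_mult
        seq_mult_assoc seq_mult_unit intro!: imageI graded_reps_seq_mult)
next
  fix x y z assume "x \<in> carrier gr" "y \<in> carrier gr" "z \<in> carrier gr"
  then obtain u v w where "u \<in> graded_reps G" "v \<in> graded_reps G" "w \<in> graded_reps G"
    and "x = graded_class G u" "y = graded_class G v" "z = graded_class G w"
    unfolding graded_ring_carrier by blast
  then show "(x \<oplus>\<^bsub>gr\<^esub> y) \<otimes>\<^bsub>gr\<^esub> z = x \<otimes>\<^bsub>gr\<^esub> z \<oplus>\<^bsub>gr\<^esub> y \<otimes>\<^bsub>gr\<^esub> z"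
    and "z \<otimes>\<^bsub>gr\<^esub> (x \<oplus>\<^bsub>gr\<^esub> y) = z \<otimes>\<^bsub>gr\<^esub> x \<oplus>\<^bsub>gr\<^esub> z \<otimes>\<^bsub>gr\<^esub> y"
    by (simp_all add: graded_ring_mult graded_ring_add graded_reps_add seq_mult_distrib)
qed

end

section \<open>Tensor products of rings\<close>

lemma free_pair_ring_simps:
  "carrier (free_pair_ring A B) = {c. Poly_Mapping.keys c \<subseteq> carrier A \<times> carrier B}"
  "ring.add (free_pair_ring A B) = (+)" "\<zero>\<^bsub>free_pair_ring A B\<^esub> = 0"
  "\<one>\<^bsub>free_pair_ring A B\<^esub> = frag_of (\<one>\<^bsub>A\<^esub>, \<one>\<^bsub>B\<^esub>)"
  by (simp_all add: free_pair_ring_def free_Abelian_group_def)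

lemma free_pair_ring_mult_of [simp]:
  "frag_of (a, b) \<otimes>\<^bsub>free_pair_ring A B\<^esub> frag_of (a', b') = frag_of (a \<otimes>\<^bsub>A\<^esub> a', b \<otimes>\<^bsub>B\<^esub> b')"
  by (simp add: free_pair_ring_def)

lemma frag_extend_diff_fun:
  fixes f g :: "'b \<Rightarrow> 'a \<Rightarrow>\<^sub>0 int"
  shows "frag_extend (\<lambda>p. f p - g p) c = frag_extend f c - frag_extend g c"
proof -
  have "frag_cmul k (a - b) = frag_cmul k a - frag_cmul k b" for k and a b :: "'a \<Rightarrow>\<^sub>0 int"
    by (rule poly_mapping_eqI) (simp add: lookup_minus right_diff_distrib)
  then show ?thesis by (simp add: frag_extend_def sum_subtractf)
qed

lemma free_pair_ring_mult_diff:
  "(c - c') \<otimes>\<^bsub>free_pair_ring A B\<^esub> d = c \<otimes>\<^bsub>free_pair_ring A B\<^esub> d - c' \<otimes>\<^bsub>free_pair_ring A B\<^esub> d"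
  "c \<otimes>\<^bsub>free_pair_ring A B\<^esub> (d - d') = c \<otimes>\<^bsub>free_pair_ring A B\<^esub> d - c \<otimes>\<^bsub>free_pair_ring A B\<^esub> d'"
  by (simp_all add: free_pair_ring_def frag_extend_diff case_prod_unfold frag_extend_diff_fun)

lemma free_pair_ring_mult_zero [simp]:
  "0 \<otimes>\<^bsub>free_pair_ring A B\<^esub> d = 0" "c \<otimes>\<^bsub>free_pair_ring A B\<^esub> 0 = 0"
  using free_pair_ring_mult_diff(1)[where c = 0 and c' = 0 and A = A and B = B and d = d]
    free_pair_ring_mult_diff(2)[where c = c and A = A and B = B and d = 0 and d' = 0] by simp_all

lemma free_pair_ring_mult_add:
  "(c + c') \<otimes>\<^bsub>free_pair_ring A B\<^esub> d = c \<otimes>\<^bsub>free_pair_ring A B\<^esub> d + c' \<otimes>\<^bsub>free_pair_ring A B\<^esub> d"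
  "c \<otimes>\<^bsub>free_pair_ring A B\<^esub> (d + d') = c \<otimes>\<^bsub>free_pair_ring A B\<^esub> d + c \<otimes>\<^bsub>free_pair_ring A B\<^esub> d'"
  using free_pair_ring_mult_diff(1)[where c = "c + c'" and c' = c' and A = A and B = B and d = d]
    free_pair_ring_mult_diff(2)[where c = c and A = A and B = B and d = "d + d'" and d' = d']
  by (simp_all add: algebra_simps)

locale tensor_product =
  A: Ring.ring A + B: Ring.ring B
  for A :: "('a, 'm) ring_scheme" and B :: "('b, 'n) ring_scheme"
begin

abbreviation "F \<equiv> free_pair_ring A B"
abbreviation "K \<equiv> tensor_kernel A B"
abbreviation "T \<equiv> tensor_ring A B"

lemma F_zero [simp]: "0 \<in> carrier F"
  by (simp add: free_pair_ring_simps)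

lemma F_diff: "x \<in> carrier F \<Longrightarrow> y \<in> carrier F \<Longrightarrow> x - y \<in> carrier F"
  using keys_diff[of x y] by (auto simp: free_pair_ring_simps)

lemma F_add: "x \<in> carrier F \<Longrightarrow> y \<in> carrier F \<Longrightarrow> x + y \<in> carrier F"
  by (rule diff_closed_imp_group_closed(2)[OF F_zero F_diff])

lemma F_frag_of: "a \<in> carrier A \<Longrightarrow> b \<in> carrier B \<Longrightarrow> frag_of (a, b) \<in> carrier F"
  by (simp add: free_pair_ring_simps)

lemma F_induct [consumes 1, case_names zero frag_of diff]:
  assumes "c \<in> carrier F" "P 0" "\<And>a b. a \<in> carrier A \<Longrightarrow> b \<in> carrier B \<Longrightarrow> P (frag_of (a, b))"
    "\<And>x y. P x \<Longrightarrow> P y \<Longrightarrow> P (x - y)"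
  shows "P c"
proof -
  have "Poly_Mapping.keys c \<subseteq> carrier A \<times> carrier B" using assms(1) by (simp add: free_pair_ring_simps)
  then show ?thesis by (induction c rule: frag_induction) (use assms in auto)
qed

lemma tensor_relations_closed: "tensor_relations A B \<subseteq> carrier F"
  by (auto simp: tensor_relations_def intro!: F_diff F_frag_of)

lemma tensor_kernel_eq: "K = group_closure (tensor_relations A B)"
  unfolding tensor_kernel_def
  by (rule generate_eq_group_closure) (use tensor_relations_closed in \<open>auto simp: free_pair_ring_simps(2,3) F_diff\<close>)

lemma K_zero [simp]: "0 \<in> K"
  by (simp add: tensor_kernel_eq)

lemma K_diff: "x \<in> K \<Longrightarrow> y \<in> K \<Longrightarrow> x - y \<in> K"
  by (simp add: tensor_kernel_eq group_closure.diff)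

lemma K_add: "x \<in> K \<Longrightarrow> y \<in> K \<Longrightarrow> x + y \<in> K"
  by (simp add: tensor_kernel_eq group_closure_add)

lemma K_uminus: "- x \<in> K \<longleftrightarrow> x \<in> K"
  by (simp add: tensor_kernel_eq)

lemma K_subsetI:
  assumes "tensor_relations A B \<subseteq> S" "0 \<in> S" "\<And>x y. x \<in> S \<Longrightarrow> y \<in> S \<Longrightarrow> x - y \<in> S"
  shows "K \<subseteq> S"
  unfolding tensor_kernel_eq using assms by (intro group_closure_subset) auto

lemma K_closed: "K \<subseteq> carrier F"
  by (rule K_subsetI[OF tensor_relations_closed]) (simp_all add: F_diff)

lemma tensor_add_left:
  "a \<in> carrier A \<Longrightarrow> a' \<in> carrier A \<Longrightarrow> b \<in> carrier B \<Longrightarrow>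
    frag_of (a \<oplus>\<^bsub>A\<^esub> a', b) - frag_of (a, b) - frag_of (a', b) \<in> K"
  unfolding tensor_kernel_eq by (rule group_closure.base) (auto simp: tensor_relations_def)

lemma tensor_add_right:
  "a \<in> carrier A \<Longrightarrow> b \<in> carrier B \<Longrightarrow> b' \<in> carrier B \<Longrightarrow>
    frag_of (a, b \<oplus>\<^bsub>B\<^esub> b') - frag_of (a, b) - frag_of (a, b') \<in> K"
  unfolding tensor_kernel_eq by (rule group_closure.base) (auto simp: tensor_relations_def)

text \<open>By additivity it suffices to multiply a defining relation by one generator
  \<open>(a, b)\<close>; distributivity in the factors turns the result into a relation of the same
  kind.\<close>

lemma K_ideal:
  assumes "x \<in> carrier F" "k \<in> K"
  shows "x \<otimes>\<^bsub>F\<^esub> k \<in> K" "k \<otimes>\<^bsub>F\<^esub> x \<in> K"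
proof -
  have "x \<otimes>\<^bsub>F\<^esub> k \<in> K \<and> k \<otimes>\<^bsub>F\<^esub> x \<in> K"
    using assms(1)
  proof (induction x rule: F_induct)
    case (frag_of a b)
    have "K \<subseteq> {k. frag_of (a, b) \<otimes>\<^bsub>F\<^esub> k \<in> K \<and> k \<otimes>\<^bsub>F\<^esub> frag_of (a, b) \<in> K}"
    proof (rule K_subsetI)
      show "tensor_relations A B \<subseteq> {k. frag_of (a, b) \<otimes>\<^bsub>F\<^esub> k \<in> K \<and> k \<otimes>\<^bsub>F\<^esub> frag_of (a, b) \<in> K}"
        using frag_of
        by (auto simp: tensor_relations_def free_pair_ring_mult_diff A.l_distr A.r_distr B.l_distr B.r_distr
            intro!: tensor_add_left tensor_add_right)
    qed (auto simp: free_pair_ring_mult_diff K_diff)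
    then show ?case using assms(2) by blast
  qed (auto simp: free_pair_ring_mult_diff K_diff)
  then show "x \<otimes>\<^bsub>F\<^esub> k \<in> K" "k \<otimes>\<^bsub>F\<^esub> x \<in> K" by auto
qed

lemma K_coset_eq_iff: "coset K x = coset K y \<longleftrightarrow> x - y \<in> K"
  by (rule coset_eq_iff[OF K_zero K_diff])

lemma K_mem_coset_iff: "z \<in> coset K x \<longleftrightarrow> z - x \<in> K"
  by (rule mem_coset_iff[OF K_zero K_diff])

lemma F_a_r_coset [simp]: "S +>\<^bsub>F\<^esub> x = coset S x"
  by (auto simp: a_r_coset_def r_coset_def coset_def free_pair_ring_simps(2))

lemma rcoset_mult_K:
  assumes x: "x \<in> carrier F" and y: "y \<in> carrier F"
  shows "rcoset_mult F K (coset K x) (coset K y) = coset K (x \<otimes>\<^bsub>F\<^esub> y)"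
proof -
  have eq: "coset K (x' \<otimes>\<^bsub>F\<^esub> y') = coset K (x \<otimes>\<^bsub>F\<^esub> y)" if "x' - x \<in> K" "y' - y \<in> K" for x' y'
  proof -
    have "y' \<in> carrier F" using F_add[OF y, of "y' - y"] that(2) K_closed by auto
    then have "(x' - x) \<otimes>\<^bsub>F\<^esub> y' + x \<otimes>\<^bsub>F\<^esub> (y' - y) \<in> K"
      using that x by (intro K_add K_ideal)
    then show ?thesis by (simp add: K_coset_eq_iff free_pair_ring_mult_diff)
  qed
  have "(\<Union>x'\<in>coset K x. \<Union>y'\<in>coset K y. coset K (x' \<otimes>\<^bsub>F\<^esub> y')) =
      (\<Union>x'\<in>coset K x. \<Union>y'\<in>coset K y. coset K (x \<otimes>\<^bsub>F\<^esub> y))"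
    by (intro SUP_cong refl eq) (simp_all add: K_mem_coset_iff)
  moreover have "x \<in> coset K x" "y \<in> coset K y" by (simp_all add: K_mem_coset_iff)
  then have "coset K x \<noteq> {}" "coset K y \<noteq> {}" by blast+
  ultimately show ?thesis by (simp add: rcoset_mult_def)
qed

lemma tensor_ring_carrier: "carrier T = coset K ` carrier F"
  by (auto simp: tensor_ring_def FactRing_def A_RCOSETS_def RCOSETS_def r_coset_def coset_def
      free_pair_ring_simps(2))

lemma tensor_ring_add: "coset K x \<oplus>\<^bsub>T\<^esub> coset K y = coset K (x + y)"
  using coset_add[OF K_zero K_diff, where x = x and y = y]
  by (simp add: tensor_ring_def FactRing_def set_add_def set_mult_def free_pair_ring_simps(2))

lemma tensor_ring_mult:
  "x \<in> carrier F \<Longrightarrow> y \<in> carrier F \<Longrightarrow> coset K x \<otimes>\<^bsub>T\<^esub> coset K y = coset K (x \<otimes>\<^bsub>F\<^esub> y)"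
  by (simp add: tensor_ring_def FactRing_def rcoset_mult_K)

lemma tensor_ring_one: "\<one>\<^bsub>T\<^esub> = coset K (frag_of (\<one>\<^bsub>A\<^esub>, \<one>\<^bsub>B\<^esub>))"
  by (simp add: tensor_ring_def FactRing_def free_pair_ring_simps(4))

lemma tensor_ring_zero: "\<zero>\<^bsub>T\<^esub> = coset K 0"
  by (simp add: tensor_ring_def FactRing_def)

lemma group_tensor_ring: "group (add_monoid T)"
proof (rule groupI)
  show "\<one>\<^bsub>add_monoid T\<^esub> \<in> carrier (add_monoid T)"
    using imageI[OF F_zero, of "coset K"] by (simp add: tensor_ring_carrier tensor_ring_zero)
  fix x assume "x \<in> carrier (add_monoid T)"
  then obtain c where c: "c \<in> carrier F" "x = coset K c" by (auto simp: tensor_ring_carrier)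
  show "\<one>\<^bsub>add_monoid T\<^esub> \<otimes>\<^bsub>add_monoid T\<^esub> x = x"
    using tensor_ring_add[of 0 c] by (simp add: c(2) tensor_ring_zero)
  show "\<exists>y\<in>carrier (add_monoid T). y \<otimes>\<^bsub>add_monoid T\<^esub> x = \<one>\<^bsub>add_monoid T\<^esub>"
    using tensor_ring_add[of "- c" c] diff_closed_imp_group_closed(1)[OF F_zero F_diff c(1)]
    by (intro bexI[of _ "coset K (- c)"]) (auto simp: c(2) tensor_ring_zero tensor_ring_carrier)
qed (auto simp: tensor_ring_carrier tensor_ring_add add.assoc intro!: imageI F_add)

text \<open>Transfers the subgroups that grade the tensor ring to the free group, so that
  homogeneity can be examined on formal sums.\<close>

lemma generate_tensor_ring:
  assumes X: "X \<subseteq> carrier F"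
  shows "generate (add_monoid T) (coset K ` X) = coset K ` group_closure X"
proof -
  interpret T: group "add_monoid T" by (rule group_tensor_ring)
  have sub: "coset K ` X \<subseteq> carrier (add_monoid T)" using X by (auto simp: tensor_ring_carrier)
  have XF: "group_closure X \<subseteq> carrier F" by (rule group_closure_subset) (use X in \<open>auto simp: F_diff\<close>)
  have minus: "inv\<^bsub>add_monoid T\<^esub> (coset K x) = coset K (- x)" if "x \<in> carrier F" for x
    using that diff_closed_imp_group_closed(1)[OF F_zero F_diff that]
    by (intro T.inv_equality) (auto simp: tensor_ring_carrier tensor_ring_add tensor_ring_zero)
  show ?thesis
  proof (intro equalityI subsetI)
    fix z assume "z \<in> generate (add_monoid T) (coset K ` X)"
    then show "z \<in> coset K ` group_closure X"
    proof induction
      case one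
      show ?case using imageI[OF zero_in_group_closure, of "coset K" X] by (simp add: tensor_ring_zero)
    next
      case (incl h)
      then show ?case by (auto intro: group_closure.base)
    next
      case (inv h)
      then obtain x where x: "x \<in> X" "h = coset K x" by blast
      then have "inv\<^bsub>add_monoid T\<^esub> h = coset K (- x)" using X minus by blast
      moreover have "- x \<in> group_closure X" using x by (simp add: group_closure.base)
      ultimately show ?case by simp
    next
      case (eng h1 h2)
      then show ?case by (auto simp: tensor_ring_add group_closure_add)
    qed
  next
    fix z assume "z \<in> coset K ` group_closure X"
    then obtain x where x: "x \<in> group_closure X" "z = coset K x" by blast
    from x(1) have "coset K x \<in> generate (add_monoid T) (coset K ` X)"
    proof induction
      case (base s)
      \<comment> \<open>\<open>group_closure\<close> admits 0 among its base elements even when 0 is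
        not in \<open>X\<close>.\<close>
      show ?case
      proof (cases "s = 0")
        case True
        then show ?thesis using generate.one[of "add_monoid T" "coset K ` X"] by (simp add: tensor_ring_zero)
      next
        case False
        then show ?thesis using base by (auto intro!: generate.incl)
      qed
    next
      case (diff s t)
      have "inv\<^bsub>add_monoid T\<^esub> (coset K t) \<in> generate (add_monoid T) (coset K ` X)"
        using T.generate_m_inv_closed[OF sub diff.IH(2)] .
      then have "coset K (- t) \<in> generate (add_monoid T) (coset K ` X)"
        using minus[OF subsetD[OF XF diff.hyps(2)]] by simp
      from generate.eng[OF diff.IH(1) this] show ?case by (simp add: tensor_ring_add)
    qed
    then show "z \<in> generate (add_monoid T) (coset K ` X)" by (simp add: x(2))
  qed
qed

end

lemma graded_tensor_simps:
  "carrier (graded_tensor A B) = carrier (tensor_ring A B)"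
  "ring.add (graded_tensor A B) = ring.add (tensor_ring A B)"
  "monoid.mult (graded_tensor A B) = monoid.mult (tensor_ring A B)"
  "monoid.one (graded_tensor A B) = monoid.one (tensor_ring A B)"
  "homogeneous (graded_tensor A B) n = generate (add_monoid (tensor_ring A B))
    {pure_tensor A B a b | a b i j. a \<in> homogeneous A i \<and> b \<in> homogeneous B j \<and> i + j = n}"
  by (simp_all add: graded_tensor_def ring.defs graded_ring.defs)

section \<open>Groups of coprime orders\<close>

text \<open>The scalars are degrees of virtual characters, read off as complex values at the
  identity; that they are integers is a separate hypothesis wherever the filtration must be
  preserved.\<close>

definition seq_scale :: "complex \<Rightarrow> (nat \<Rightarrow> 'a \<Rightarrow> complex) \<Rightarrow> nat \<Rightarrow> 'a \<Rightarrow> complex"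
  where "seq_scale c u = (\<lambda>n g. c * u n g)"

lemma seq_scale_diff: "seq_scale (a - b) u = seq_scale a u - seq_scale b u"
  by (simp add: seq_scale_def fun_eq_iff minus_apply left_diff_distrib)

definition seq_positive :: "(nat \<Rightarrow> 'a::zero) \<Rightarrow> nat \<Rightarrow> 'a"
  where "seq_positive u = (\<lambda>n. if n = 0 then 0 else u n)"

lemma seq_positive_0 [simp]: "seq_positive u 0 = 0" "seq_positive 0 = 0"
  by (auto simp: seq_positive_def zero_fun_apply)

lemma seq_positive_diff: "seq_positive (u - v :: nat \<Rightarrow> 'a::ab_group_add) = seq_positive u - seq_positive v"
  by (auto simp: seq_positive_def minus_apply)

text \<open>Each factor is split into its degree-0 part (\<open>d\<close>) and its positive part. Of
  the four products only that of the two degree-0 parts can reach degree 0; the other three form the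
  right-hand side.\<close>

lemma seq_positive_seq_mult:
  fixes u v :: "nat \<Rightarrow> 'a::comm_semiring_0"
  shows "seq_positive (seq_mult u v) =
    (\<lambda>n. u 0 * seq_positive v n + seq_positive u n * v 0) + seq_mult (seq_positive u) (seq_positive v)"
proof
  fix n
  define d where "d w = (\<lambda>n::nat. if n = 0 then w 0 else 0)" for w :: "nat \<Rightarrow> 'a"
  have split: "w = d w + seq_positive w" for w
    by (auto simp: d_def seq_positive_def plus_fun_apply)
  have l: "seq_mult (d u) w n = u 0 * w n" for w
  proof -
    have "(\<Sum>i\<le>n. d u i * w (n - i)) = (\<Sum>i\<in>{0}. d u i * w (n - i))"
      by (rule sum.mono_neutral_right) (auto simp: d_def)
    then show ?thesis by (simp add: seq_mult_def d_def)
  qed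
  have r: "seq_mult w (d v) n = w n * v 0" for w
  proof -
    have "(\<Sum>i\<le>n. w i * d v (n - i)) = (\<Sum>i\<in>{n}. w i * d v (n - i))"
      by (rule sum.mono_neutral_right) (auto simp: d_def)
    then show ?thesis by (simp add: seq_mult_def d_def)
  qed
  have "seq_mult u v n = seq_mult (d u + seq_positive u) (d v + seq_positive v) n"
    by (simp flip: split)
  also have "\<dots> = seq_mult (d u) (d v + seq_positive v) n + seq_mult (seq_positive u) (d v + seq_positive v) n"
    by (simp only: seq_mult_distrib(1) plus_fun_apply)
  also have "\<dots> = u 0 * d v n + u 0 * seq_positive v n +
      (seq_mult (seq_positive u) (d v) n + seq_mult (seq_positive u) (seq_positive v) n)"
    by (simp only: l seq_mult_distrib(2) plus_fun_apply)
  also have "\<dots> = u 0 * d v n + u 0 * seq_positive v n + seq_positive u n * v 0 +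
      seq_mult (seq_positive u) (seq_positive v) n"
    by (simp only: r add.assoc)
  finally have eq: "seq_mult u v n = u 0 * d v n + u 0 * seq_positive v n + seq_positive u n * v 0 +
      seq_mult (seq_positive u) (seq_positive v) n" .
  show "seq_positive (seq_mult u v) n =
    ((\<lambda>n. u 0 * seq_positive v n + seq_positive u n * v 0) + seq_mult (seq_positive u) (seq_positive v)) n"
  proof (cases "n = 0")
    case True
    then show ?thesis by (simp add: plus_fun_apply seq_mult_def)
  next
    case False
    then have "seq_positive (seq_mult u v) n = seq_mult u v n" "d v n = 0"
      by (simp_all add: seq_positive_def d_def)
    then show ?thesis by (simp add: eq plus_fun_apply)
  qed
qed

context group
begin

lemma graded_unit_nth [simp]: "graded_unit 0 = trivial_character G" "n \<noteq> 0 \<Longrightarrow> graded_unit n = 0"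
  by (simp_all add: graded_unit_def)

lemma graded_reps_scale:
  assumes "u \<in> graded_reps G" "c \<in> \<int>"
  shows "seq_scale c u \<in> graded_reps G"
proof -
  have "{n. seq_scale c u n \<noteq> 0} \<subseteq> {n. u n \<noteq> 0}" by (auto simp: seq_scale_def fun_eq_iff zero_fun_apply)
  from finite_subset[OF this graded_reps_finite[OF assms(1)]]
  have "finite {n. seq_scale c u n \<noteq> 0}" .
  moreover have "seq_scale c u n \<in> \<Gamma> n" for n
    unfolding seq_scale_def by (rule gamma_filtration_scale[OF graded_repsD[OF assms(1)] assms(2)])
  ultimately show ?thesis by (simp add: graded_reps_def)
qed

lemma graded_reps_positive:
  assumes "u \<in> graded_reps G"
  shows "seq_positive u \<in> graded_reps G"
proof -
  have "{n. seq_positive u n \<noteq> 0} \<subseteq> {n. u n \<noteq> 0}" by (auto simp: seq_positive_def)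
  from finite_subset[OF this graded_reps_finite[OF assms]]
  have "finite {n. seq_positive u n \<noteq> 0}" .
  moreover have "seq_positive u n \<in> \<Gamma> n" for n
    using graded_repsD[OF assms] by (simp add: seq_positive_def)
  ultimately show ?thesis by (simp add: graded_reps_def)
qed

lemma graded_reps_at_one_int: "u \<in> graded_reps G \<Longrightarrow> u n \<one> \<in> \<int>"
  by (rule character_at_one_int[OF gamma_filtration_closed[OF graded_repsD]])

lemma gamma_1_iff: "x \<in> \<Gamma> 0 \<Longrightarrow> x \<in> \<Gamma> (Suc 0) \<longleftrightarrow> x \<one> = 0"
  using gamma_filtration_1 by (simp add: augmentation_ideal_def gamma_filtration_0)

text \<open>Evaluation at the identity identifies \<open>\<Gamma>\<^sup>0 / \<Gamma>\<^sup>1\<close>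
  with the integers: modulo \<open>\<Gamma>\<^sup>1\<close> a virtual character may be replaced by
  its degree.\<close>

lemma scaled_unit_diff:
  assumes "x \<in> \<Gamma> 0"
  shows "x - (\<lambda>g. x \<one> * trivial_character G g) \<in> \<Gamma> (Suc 0)"
proof -
  have "x \<one> \<in> \<int>" using assms by (simp add: character_at_one_int gamma_filtration_0)
  then have "(\<lambda>g. x \<one> * trivial_character G g) \<in> \<Gamma> 0"
    by (intro gamma_filtration_scale trivial_character_in_gamma_0)
  then show ?thesis
    using assms by (subst gamma_1_iff) (auto simp: gamma_filtration_diff minus_apply)
qed

lemma graded_class_split:
  assumes "u \<in> graded_reps G"
  shows "graded_class G u = graded_class G (seq_scale (u 0 \<one>) graded_unit + seq_positive u)"
  unfolding graded_class_eq_iff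
proof
  fix n
  show "u n - (seq_scale (u 0 \<one>) graded_unit + seq_positive u) n \<in> \<Gamma> (Suc n)"
  proof (cases "n = 0")
    case True
    have "seq_scale (u 0 \<one>) graded_unit 0 = (\<lambda>g. u 0 \<one> * trivial_character G g)"
      by (simp add: seq_scale_def graded_unit_def)
    then show ?thesis using scaled_unit_diff[OF graded_repsD[OF assms, of 0]] True
      by (simp add: plus_fun_apply)
  next
    case False
    have "seq_scale (u 0 \<one>) graded_unit n = 0"
      using False by (auto simp: seq_scale_def graded_unit_def zero_fun_apply)
    then show ?thesis using False by (simp add: plus_fun_apply seq_positive_def)
  qed
qed

lemma degree_repsI:
  "u \<in> graded_reps G \<Longrightarrow> (\<And>m. m \<noteq> n \<Longrightarrow> u m = 0) \<Longrightarrow> u \<in> degree_reps n"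
  by (simp add: degree_reps_def)

lemma graded_class_order_multiple:
  assumes fin: "finite (carrier G)" and u: "u \<in> graded_reps G" "u 0 = 0"
  shows "graded_class G (\<Sum>i<Coset.order G. u) = graded_class G 0"
  unfolding graded_class_eq_iff
proof
  fix n
  have "u n \<one> = 0"
    using u gamma_filtration_at_one[OF graded_repsD[OF u(1), of n]] by (cases "n = 0") (simp_all add: zero_fun_apply)
  then have "of_nat (Coset.order G) * u n \<in> \<Gamma> (Suc n)"
    by (intro gamma_filtration_order_mult fin graded_repsD u)
  moreover have "(\<Sum>i<k. u) n = of_nat k * u n" for k :: nat
    by (induction k)
      (simp_all add: plus_fun_apply[of u] plus_fun_apply[of "sum f A" for f A] zero_fun_apply[of n] distrib_right add.commute
        del: sum_constant of_nat_fun_apply)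
  ultimately show "(\<Sum>i<Coset.order G. u) n - 0 n \<in> \<Gamma> (Suc n)"
    by (simp add: zero_fun_apply)
qed

end

context group_hom
begin

definition pullback_seq :: "(nat \<Rightarrow> 'c \<Rightarrow> complex) \<Rightarrow> nat \<Rightarrow> 'a \<Rightarrow> complex"
  where "pullback_seq u = (\<lambda>n. pullback_character G h (u n))"

lemma pullback_seq_closed:
  assumes "u \<in> graded_reps H"
  shows "pullback_seq u \<in> graded_reps G"
proof -
  have "{n. pullback_seq u n \<noteq> 0} \<subseteq> {n. u n \<noteq> 0}"
    by (auto simp: pullback_seq_def)
  from finite_subset[OF this H.graded_reps_finite[OF assms]]
  have "finite {n. pullback_seq u n \<noteq> 0}" .
  moreover have "pullback_seq u n \<in> gamma_filtration G n" for n
    unfolding pullback_seq_def by (rule pullback_gamma_filtration[OF H.graded_repsD[OF assms]])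
  ultimately show ?thesis by (simp add: graded_reps_def)
qed

lemma pullback_seq_diff: "pullback_seq (u - v) = pullback_seq u - pullback_seq v"
proof
  fix n show "pullback_seq (u - v) n = (pullback_seq u - pullback_seq v) n"
    by (simp only: pullback_seq_def minus_apply pullback_character_simps)
qed

lemma pullback_seq_mult: "pullback_seq (seq_mult u v) = seq_mult (pullback_seq u) (pullback_seq v)"
proof -
  have sum: "pullback_character G h (sum f A) = (\<Sum>i\<in>A. pullback_character G h (f i))"
    for f :: "nat \<Rightarrow> 'c \<Rightarrow> complex" and A
    by (induction A rule: infinite_finite_induct) simp_all
  show ?thesis by (simp add: pullback_seq_def seq_mult_def sum)
qed

lemma pullback_seq_unit: "pullback_seq H.graded_unit = G.graded_unit"
  by (auto simp: pullback_seq_def H.graded_unit_def G.graded_unit_def)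

lemma pullback_graded_class_cong:
  "graded_class H u = graded_class H v \<Longrightarrow> graded_class G (pullback_seq u) = graded_class G (pullback_seq v)"
  unfolding G.graded_class_eq_iff H.graded_class_eq_iff
proof
  fix n assume "\<forall>n. u n - v n \<in> gamma_filtration H (Suc n)"
  then have "pullback_character G h (u n - v n) \<in> gamma_filtration G (Suc n)"
    by (intro pullback_gamma_filtration) blast
  then show "pullback_seq u n - pullback_seq v n \<in> gamma_filtration G (Suc n)"
    by (simp add: pullback_seq_def)
qed

end

section \<open>Restriction and inflation for a direct product\<close>

locale coprime_groups = G: group G + H: group H
  for G :: "('a, 'm) monoid_scheme" and H :: "('b, 'n) monoid_scheme" +
  assumes finite_G: "finite (carrier G)" and finite_H: "finite (carrier H)"
    and coprime_orders: "coprime (Coset.order G) (Coset.order H)"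
begin

abbreviation "P \<equiv> G \<times>\<times> H"

sublocale P: group P
  by (rule DirProd_group[OF G.is_group H.is_group])

sublocale resG: group_hom G P "\<lambda>g. (g, \<one>\<^bsub>H\<^esub>)"
  by unfold_locales (auto simp: hom_def)

sublocale resH: group_hom H P "\<lambda>h. (\<one>\<^bsub>G\<^esub>, h)"
  by unfold_locales (auto simp: hom_def)

sublocale infG: group_hom P G fst
  by unfold_locales (auto simp: hom_def)

sublocale infH: group_hom P H snd
  by unfold_locales (auto simp: hom_def)

text \<open>These loop with \<open>one_DirProd\<close>.\<close>
declare resG.hom_one [simp del] resH.hom_one [simp del]

abbreviation "restG \<equiv> pullback_character G (\<lambda>g. (g, \<one>\<^bsub>H\<^esub>))"
abbreviation "restH \<equiv> pullback_character H (\<lambda>h. (\<one>\<^bsub>G\<^esub>, h))"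
abbreviation "inflG \<equiv> pullback_character P fst"
abbreviation "inflH \<equiv> pullback_character P snd"

text \<open>A virtual character vanishing on both factors is killed by the inflations of the two regular
  characters, so both orders push it one step further down the filtration.\<close>
lemma rest_zero_imp_gamma:
  assumes z: "z \<in> carrier (character_ring P)" "restG z = 0" "restH z = 0"
  shows "z \<in> gamma_filtration P n"
proof (induction n)
  case 0
  show ?case using z(1) by (simp add: P.gamma_filtration_0)
next
  case (Suc n)
  have zG: "z (g, \<one>\<^bsub>H\<^esub>) = 0" if "g \<in> carrier G" for g
    using fun_cong[OF z(2), of g] that by (simp add: pullback_character_def zero_fun_apply)
  have zH: "z (\<one>\<^bsub>G\<^esub>, h) = 0" if "h \<in> carrier H" for h
    using fun_cong[OF z(3), of h] that by (simp add: pullback_character_def zero_fun_apply)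
  have off: "z p = 0" if "p \<notin> carrier P" for p using character_ring_off_carrier[OF z(1) that] .
  let ?\<rho>G = "inflG (\<lambda>g. if g = \<one>\<^bsub>G\<^esub> then of_nat (Coset.order G) else 0)"
  let ?\<rho>H = "inflH (\<lambda>h. if h = \<one>\<^bsub>H\<^esub> then of_nat (Coset.order H) else 0)"
  \<comment> \<open>The inflated regular character of \<open>G\<close> is supported on the pairs
    with first entry \<open>\<one>\<close>, that of \<open>H\<close> on the pairs with second entry
    \<open>\<one>\<close>; on both sets \<open>z\<close> vanishes.\<close>
  have zero: "z * ?\<rho>G = 0" "z * ?\<rho>H = 0"
    using zG zH off by (auto simp: pullback_character_def fun_eq_iff fun_apply_simps)
  have closed: "?\<rho>G \<in> carrier (character_ring P)" "?\<rho>H \<in> carrier (character_ring P)"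
    using G.regular_character_closed[OF finite_G] H.regular_character_closed[OF finite_H] by blast+
  have deg: "?\<rho>G \<one>\<^bsub>P\<^esub> = of_nat (Coset.order G)" "?\<rho>H \<one>\<^bsub>P\<^esub> = of_nat (Coset.order H)"
    by (simp_all add: pullback_character_def)
  have "of_nat (Coset.order G) * z \<in> gamma_filtration P (Suc n)"
    "of_nat (Coset.order H) * z \<in> gamma_filtration P (Suc n)"
    using P.gamma_filtration_annihilated[OF closed(1) deg(1) Suc zero(1)]
      P.gamma_filtration_annihilated[OF closed(2) deg(2) Suc zero(2)] .
  then have mem: "(\<Sum>i<Coset.order G. z) \<in> gamma_filtration P (Suc n)"
    "(\<Sum>i<Coset.order H. z) \<in> gamma_filtration P (Suc n)" by simp_all
  have "Coset.order G > 0" using finite_G by (simp add: G.order_gt_0_iff_finite)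
  from coprime_multiples_mem[OF P.gamma_filtration_zero P.gamma_filtration_diff mem coprime_orders this]
  show ?case .
qed

text \<open>Subtract from \<open>z\<close> the inflations of its two restrictions. Either inflation,
  restricted to the other factor, becomes the constant \<open>z \<one> = 0\<close>; so the
  difference restricts to 0 on both factors and lies in every filtration step, while the inflations
  lie in step \<open>n\<close> by hypothesis.\<close>

lemma rest_gamma_imp_gamma:
  assumes z: "z \<in> carrier (character_ring P)" "z \<one>\<^bsub>P\<^esub> = 0"
    and rest: "restG z \<in> gamma_filtration G n" "restH z \<in> gamma_filtration H n"
  shows "z \<in> gamma_filtration P n"
proof -
  let ?y = "z - inflG (restG z) - inflH (restH z)"
  have infl: "inflG (restG z) \<in> gamma_filtration P n" "inflH (restH z) \<in> gamma_filtration P n"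
    using rest infG.pullback_gamma_filtration infH.pullback_gamma_filtration by auto
  have "restG ?y = 0" "restH ?y = 0"
    using z(2) by (auto simp: pullback_character_def fun_eq_iff fun_apply_simps)
  moreover have "?y \<in> carrier (character_ring P)"
    using z(1) infl[THEN P.gamma_filtration_closed] by (intro character_ring_diff_closed)
  ultimately have "?y \<in> gamma_filtration P n" by (intro rest_zero_imp_gamma)
  then have "?y + (inflG (restG z) + inflH (restH z)) \<in> gamma_filtration P n"
    using infl by (intro P.gamma_filtration_add)
  then show ?thesis by simp
qed

end

text \<open>The additive extension of \<open>f\<close> to formal sums, with complex functions as
  values. It provides functionals on the free group whose values on the tensor relations can be
  located in the filtration.\<close>

definition frag_eval :: "('p \<Rightarrow> 'a \<Rightarrow> complex) \<Rightarrow> ('p \<Rightarrow>\<^sub>0 int) \<Rightarrow> 'a \<Rightarrow> complex"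
  where "frag_eval f c = (\<lambda>x. \<Sum>p\<in>Poly_Mapping.keys c. of_int (Poly_Mapping.lookup c p) * f p x)"

lemma frag_eval_of [simp]: "frag_eval f (frag_of p) = f p"
  by (simp add: frag_eval_def)

lemma frag_eval_superset:
  assumes "finite S" "Poly_Mapping.keys c \<subseteq> S"
  shows "frag_eval f c x = (\<Sum>p\<in>S. of_int (Poly_Mapping.lookup c p) * f p x)"
  unfolding frag_eval_def using assms
  by (intro sum.mono_neutral_left) (auto simp: in_keys_iff)

lemma frag_eval_diff: "frag_eval f (c - d) = frag_eval f c - frag_eval f d"
proof
  fix x
  let ?S = "Poly_Mapping.keys c \<union> Poly_Mapping.keys d"
  have "frag_eval f (c - d) x = (\<Sum>p\<in>?S. of_int (Poly_Mapping.lookup (c - d) p) * f p x)"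
    using keys_diff[of c d] by (intro frag_eval_superset) auto
  also have "\<dots> = (\<Sum>p\<in>?S. of_int (Poly_Mapping.lookup c p) * f p x) - (\<Sum>p\<in>?S. of_int (Poly_Mapping.lookup d p) * f p x)"
    by (simp add: lookup_minus left_diff_distrib sum_subtractf)
  also have "\<dots> = (frag_eval f c - frag_eval f d) x"
    by (simp add: frag_eval_superset[of ?S] minus_apply)
  finally show "frag_eval f (c - d) x = (frag_eval f c - frag_eval f d) x" .
qed

lemma frag_eval_0 [simp]: "frag_eval f 0 = 0"
  using frag_eval_diff[of f 0 0] by simp

lemma frag_eval_add: "frag_eval f (c + d) = frag_eval f c + frag_eval f d"
  using frag_eval_diff[of f "c + d" d] by simp

context group
begin

definition graded_rep :: "(nat \<Rightarrow> ('a \<Rightarrow> complex) set) \<Rightarrow> nat \<Rightarrow> 'a \<Rightarrow> complex"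
  where "graded_rep x = (SOME u. u \<in> graded_reps G \<and> graded_class G u = x)"

lemma graded_rep_class:
  assumes "u \<in> graded_reps G"
  shows "graded_rep (graded_class G u) \<in> graded_reps G"
    and "graded_class G (graded_rep (graded_class G u)) = graded_class G u"
  using someI[of "\<lambda>v. v \<in> graded_reps G \<and> graded_class G v = graded_class G u" u] assms
  unfolding graded_rep_def by auto

lemma graded_rep_diff:
  assumes "u \<in> graded_reps G"
  shows "graded_rep (graded_class G u) n - u n \<in> gamma_filtration G (Suc n)"
  using graded_rep_class(2)[OF assms] unfolding graded_class_eq_iff by blast

lemma graded_rep_at_one:
  assumes "u \<in> graded_reps G"
  shows "graded_rep (graded_class G u) 0 \<one> = u 0 \<one>"
proof -
  have "(graded_rep (graded_class G u) 0 - u 0) \<one> = 0"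
    by (rule gamma_filtration_at_one[OF graded_rep_diff[OF assms]]) simp
  then show ?thesis by (simp add: minus_apply)
qed

lemma graded_rep_mem_iff:
  assumes "u \<in> graded_reps G"
  shows "graded_rep (graded_class G u) n \<in> gamma_filtration G (Suc n) \<longleftrightarrow> u n \<in> gamma_filtration G (Suc n)"
proof
  assume "graded_rep (graded_class G u) n \<in> gamma_filtration G (Suc n)"
  from gamma_filtration_diff[OF this graded_rep_diff[OF assms, of n]]
  show "u n \<in> gamma_filtration G (Suc n)" by simp
next
  assume "u n \<in> gamma_filtration G (Suc n)"
  from gamma_filtration_add[OF graded_rep_diff[OF assms, of n] this]
  show "graded_rep (graded_class G u) n \<in> gamma_filtration G (Suc n)" by simp
qed

text \<open>The choice behind \<open>graded_rep\<close> need not be additive, but each chosen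
  sequence agrees with the given one modulo the next filtration step, and the given ones do add
  up.\<close>

lemma graded_rep_add_diff:
  assumes "u \<in> graded_reps G" "v \<in> graded_reps G"
  shows "graded_rep (graded_class G (u + v)) n - graded_rep (graded_class G u) n -
    graded_rep (graded_class G v) n \<in> gamma_filtration G (Suc n)"
proof -
  let ?r = "\<lambda>u. graded_rep (graded_class G u) n"
  have "(?r (u + v) - (u + v) n) - (?r u - u n) - (?r v - v n) \<in> gamma_filtration G (Suc n)"
    using assms graded_reps_add by (intro gamma_filtration_diff graded_rep_diff)
  then show ?thesis by (simp add: plus_fun_apply[of u] algebra_simps)
qed

end

section \<open>Tensors modulo the bilinearity relations\<close>

context coprime_groups
begin

sublocale TP: tensor_product G.gr H.gr
  by (intro tensor_product.intro G.ring_graded_character_ring H.ring_graded_character_ring)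

abbreviation "SG \<equiv> graded_reps G"
abbreviation "SH \<equiv> graded_reps H"
abbreviation "SP \<equiv> graded_reps P"
abbreviation "K \<equiv> TP.K"
abbreviation "F \<equiv> TP.F"

definition tens :: "(nat \<Rightarrow> 'a \<Rightarrow> complex) \<Rightarrow> (nat \<Rightarrow> 'b \<Rightarrow> complex) \<Rightarrow>
    (((nat \<Rightarrow> ('a \<Rightarrow> complex) set) \<times> (nat \<Rightarrow> ('b \<Rightarrow> complex) set)) \<Rightarrow>\<^sub>0 int)"
  where "tens u v = frag_of (graded_class G u, graded_class H v)"

lemma tens_closed: "u \<in> SG \<Longrightarrow> v \<in> SH \<Longrightarrow> tens u v \<in> carrier F"
  unfolding tens_def by (intro TP.F_frag_of) (auto simp: G.graded_ring_carrier H.graded_ring_carrier)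

definition kcong (infix "\<approx>\<^sub>K" 50) where "x \<approx>\<^sub>K y \<longleftrightarrow> x - y \<in> K"

lemma kcong_refl [simp]: "x \<approx>\<^sub>K x"
  by (simp add: kcong_def)

lemma kcong_trans [trans]: "x \<approx>\<^sub>K y \<Longrightarrow> y \<approx>\<^sub>K z \<Longrightarrow> x \<approx>\<^sub>K z"
  using TP.K_add[of "x - y" "y - z"] by (simp add: kcong_def)

lemma kcong_sym: "x \<approx>\<^sub>K y \<Longrightarrow> y \<approx>\<^sub>K x"
  using TP.K_uminus[of "x - y"] by (simp add: kcong_def)

lemma kcong_add: "x \<approx>\<^sub>K y \<Longrightarrow> x' \<approx>\<^sub>K y' \<Longrightarrow> x + x' \<approx>\<^sub>K y + y'"
  using TP.K_add[of "x - y" "x' - y'"] by (simp add: kcong_def algebra_simps)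

lemma kcong_diff: "x \<approx>\<^sub>K y \<Longrightarrow> x' \<approx>\<^sub>K y' \<Longrightarrow> x - x' \<approx>\<^sub>K y - y'"
  using TP.K_diff[of "x - y" "x' - y'"] by (simp add: kcong_def algebra_simps)

lemma kcong_0_iff: "x \<approx>\<^sub>K 0 \<longleftrightarrow> x \<in> K"
  by (simp add: kcong_def)

lemma tens_add_left: "u \<in> SG \<Longrightarrow> u' \<in> SG \<Longrightarrow> v \<in> SH \<Longrightarrow> tens (u + u') v \<approx>\<^sub>K tens u v + tens u' v"
  using TP.tensor_add_left[of "graded_class G u" "graded_class G u'" "graded_class H v"]
  by (simp add: kcong_def tens_def G.graded_ring_carrier H.graded_ring_carrier G.graded_ring_add diff_diff_eq)

lemma tens_add_right: "u \<in> SG \<Longrightarrow> v \<in> SH \<Longrightarrow> v' \<in> SH \<Longrightarrow> tens u (v + v') \<approx>\<^sub>K tens u v + tens u v'"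
  using TP.tensor_add_right[of "graded_class G u" "graded_class H v" "graded_class H v'"]
  by (simp add: kcong_def tens_def G.graded_ring_carrier H.graded_ring_carrier H.graded_ring_add diff_diff_eq)

lemma tens_diff_left:
  assumes "u \<in> SG" "u' \<in> SG" "v \<in> SH"
  shows "tens (u - u') v \<approx>\<^sub>K tens u v - tens u' v"
  using kcong_sym[OF tens_add_left[OF G.graded_reps_diff[OF assms(1,2)] assms(2,3)]]
  by (simp add: kcong_def algebra_simps)

lemma tens_diff_right:
  assumes "u \<in> SG" "v \<in> SH" "v' \<in> SH"
  shows "tens u (v - v') \<approx>\<^sub>K tens u v - tens u v'"
  using kcong_sym[OF tens_add_right[OF assms(1) H.graded_reps_diff[OF assms(2,3)] assms(3)]]
  by (simp add: kcong_def algebra_simps)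

lemma tens_zero: "v \<in> SH \<Longrightarrow> tens 0 v \<approx>\<^sub>K 0" "u \<in> SG \<Longrightarrow> tens u 0 \<approx>\<^sub>K 0"
  using tens_diff_left[of 0 0 v] tens_diff_right[of u 0 0] by simp_all

text \<open>The integers that may cross the tensor sign include 1 and are closed under differences,
  hence are all of them.\<close>

lemma tens_scale:
  assumes u: "u \<in> SG" and v: "v \<in> SH" and "c \<in> \<int>"
  shows "tens (seq_scale c u) v \<approx>\<^sub>K tens u (seq_scale c v)"
proof -
  let ?Q = "\<lambda>k::int. tens (seq_scale (of_int k) u) v \<approx>\<^sub>K tens u (seq_scale (of_int k) v)"
  have scale: "seq_scale (of_int k) u \<in> SG" "seq_scale (of_int k) v \<in> SH" for k
    using u v G.graded_reps_scale H.graded_reps_scale by simp_all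
  have diff: "?Q (k - l)" if "?Q k" "?Q l" for k l
  proof -
    have "tens (seq_scale (of_int (k - l)) u) v \<approx>\<^sub>K tens (seq_scale (of_int k) u) v - tens (seq_scale (of_int l) u) v"
      "tens u (seq_scale (of_int (k - l)) v) \<approx>\<^sub>K tens u (seq_scale (of_int k) v) - tens u (seq_scale (of_int l) v)"
      using tens_diff_left[OF scale(1)[of k] scale(1)[of l] v] tens_diff_right[OF u scale(2)[of k] scale(2)[of l]]
      by (simp_all add: seq_scale_diff)
    then show ?thesis using kcong_diff[OF that] kcong_trans kcong_sym by blast
  qed
  have one: "?Q 1" by (simp add: seq_scale_def)
  have zero: "?Q 0" using diff[OF one one] by simp
  have neg: "?Q (- 1)" using diff[OF zero one] by simp
  have "?Q k" for k
  proof (induction k rule: int_induct[of _ 0])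
    case (step1 i)
    then show ?case using diff[OF step1(2) neg] by simp
  next
    case (step2 i)
    then show ?case using diff[OF step2(2) one] by simp
  qed (use zero in simp)
  then show ?thesis using \<open>c \<in> \<int>\<close> by (auto elim: Ints_cases)
qed

text \<open>Elements of positive degree in the two factors are torsion of coprime orders.\<close>
lemma tens_positive:
  assumes u: "u \<in> SG" "u 0 = 0" and v: "v \<in> SH" "v 0 = 0"
  shows "tens u v \<approx>\<^sub>K 0"
proof -
  \<comment> \<open>Multiples of the tensor are moved into the left factor, and below into the right
    one. At the order of \<open>G\<close>, respectively of \<open>H\<close>, that factor has class
    0, so both multiples of the tensor lie in \<open>K\<close>.\<close>
  have left: "(\<Sum>i<k. u) \<in> SG \<and> (\<Sum>i<k. tens u v) \<approx>\<^sub>K tens (\<Sum>i<k. u) v" for k :: nat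
  proof (induction k)
    case 0
    then show ?case using kcong_sym[OF tens_zero(1)[OF v(1)]] by simp
  next
    case (Suc k)
    have "(\<Sum>i<k. tens u v) + tens u v \<approx>\<^sub>K tens (\<Sum>i<k. u) v + tens u v"
      using Suc by (intro kcong_add kcong_refl) blast
    also have "\<dots> \<approx>\<^sub>K tens ((\<Sum>i<k. u) + u) v" using Suc u(1) v(1) by (intro kcong_sym[OF tens_add_left]) auto
    finally show ?case using Suc G.graded_reps_add[OF _ u(1)] by (simp del: sum_constant)
  qed
  have right: "(\<Sum>i<k. v) \<in> SH \<and> (\<Sum>i<k. tens u v) \<approx>\<^sub>K tens u (\<Sum>i<k. v)" for k :: nat
  proof (induction k)
    case 0
    then show ?case using kcong_sym[OF tens_zero(2)[OF u(1)]] by simp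
  next
    case (Suc k)
    have "(\<Sum>i<k. tens u v) + tens u v \<approx>\<^sub>K tens u (\<Sum>i<k. v) + tens u v"
      using Suc by (intro kcong_add kcong_refl) blast
    also have "\<dots> \<approx>\<^sub>K tens u ((\<Sum>i<k. v) + v)" using Suc u(1) v(1) by (intro kcong_sym[OF tens_add_right]) auto
    finally show ?case using Suc H.graded_reps_add[OF _ v(1)] by (simp del: sum_constant)
  qed
  have eq: "tens (\<Sum>i<Coset.order G. u) v = tens 0 v" "tens u (\<Sum>i<Coset.order H. v) = tens u 0"
    unfolding tens_def using G.graded_class_order_multiple[OF finite_G u] H.graded_class_order_multiple[OF finite_H v]
    by simp_all
  have mem: "(\<Sum>i<Coset.order G. tens u v) \<in> K" "(\<Sum>i<Coset.order H. tens u v) \<in> K"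
    unfolding kcong_0_iff[symmetric]
    using kcong_trans[OF conjunct2[OF left[of "Coset.order G"]], unfolded eq, OF tens_zero(1)[OF v(1)]]
      kcong_trans[OF conjunct2[OF right[of "Coset.order H"]], unfolded eq, OF tens_zero(2)[OF u(1)]] .
  have "Coset.order G > 0" using finite_G by (simp add: G.order_gt_0_iff_finite)
  from coprime_multiples_mem[OF TP.K_zero TP.K_diff mem coprime_orders this]
  show ?thesis by (simp add: kcong_0_iff)
qed

text \<open>Split \<open>u\<close> into its degree times the unit and its positive part. The
  positive part vanishes against \<open>v\<close>, which has no component in degree 0, and the
  integral degree crosses over to \<open>v\<close>.\<close>

lemma tens_left_unit:
  assumes u: "u \<in> SG" and v: "v \<in> SH" "v 0 = 0"
  shows "tens u v \<approx>\<^sub>K tens G.graded_unit (seq_scale (u 0 \<one>\<^bsub>G\<^esub>) v)"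
proof -
  let ?c = "u 0 \<one>\<^bsub>G\<^esub>"
  have c: "?c \<in> \<int>" by (rule G.graded_reps_at_one_int[OF u])
  have S: "seq_scale ?c G.graded_unit \<in> SG" "seq_positive u \<in> SG"
    using u c by (simp_all add: G.graded_reps_scale G.graded_reps_positive)
  have "tens u v = tens (seq_scale ?c G.graded_unit + seq_positive u) v"
    unfolding tens_def using G.graded_class_split[OF u] by simp
  also have "tens (seq_scale ?c G.graded_unit + seq_positive u) v \<approx>\<^sub>K
      tens (seq_scale ?c G.graded_unit) v + tens (seq_positive u) v"
    by (rule tens_add_left[OF S v(1)])
  also have "\<dots> \<approx>\<^sub>K tens G.graded_unit (seq_scale ?c v) + 0"
    using tens_positive[OF S(2) _ v] c v by (intro kcong_add tens_scale) simp_all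
  finally show ?thesis by simp
qed

text \<open>The same splitting, applied to \<open>v\<close>; the positive part of \<open>v\<close>
  survives, because \<open>u\<close> may have a component in degree 0.\<close>

lemma tens_right_unit:
  assumes u: "u \<in> SG" and v: "v \<in> SH"
  shows "tens u v \<approx>\<^sub>K tens (seq_scale (v 0 \<one>\<^bsub>H\<^esub>) u) H.graded_unit + tens u (seq_positive v)"
proof -
  let ?c = "v 0 \<one>\<^bsub>H\<^esub>"
  have c: "?c \<in> \<int>" by (rule H.graded_reps_at_one_int[OF v])
  have S: "seq_scale ?c H.graded_unit \<in> SH" "seq_positive v \<in> SH"
    using v c by (simp_all add: H.graded_reps_scale H.graded_reps_positive)
  have "tens u v = tens u (seq_scale ?c H.graded_unit + seq_positive v)"
    unfolding tens_def using H.graded_class_split[OF v] by simp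
  also have "tens u (seq_scale ?c H.graded_unit + seq_positive v) \<approx>\<^sub>K
      tens u (seq_scale ?c H.graded_unit) + tens u (seq_positive v)"
    by (rule tens_add_right[OF u S])
  also have "\<dots> \<approx>\<^sub>K tens (seq_scale ?c u) H.graded_unit + tens u (seq_positive v)"
    using c u by (intro kcong_add kcong_sym[OF tens_scale] kcong_refl) simp_all
  finally show ?thesis .
qed

text \<open>The isomorphism on the level of representatives and formal sums. The degree of
  \<open>w\<close> shows up in both restrictions; dropping degree 0 from the second summand counts
  it once.\<close>

definition split_rep :: "(nat \<Rightarrow> 'a \<times> 'b \<Rightarrow> complex) \<Rightarrow>
    (((nat \<Rightarrow> ('a \<Rightarrow> complex) set) \<times> (nat \<Rightarrow> ('b \<Rightarrow> complex) set)) \<Rightarrow>\<^sub>0 int)"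
  where "split_rep w = tens (resG.pullback_seq w) H.graded_unit +
    tens G.graded_unit (seq_positive (resH.pullback_seq w))"

lemma split_rep_parts:
  assumes "w \<in> SP"
  shows "resG.pullback_seq w \<in> SG" "resH.pullback_seq w \<in> SH" "seq_positive (resH.pullback_seq w) \<in> SH"
  using assms resG.pullback_seq_closed resH.pullback_seq_closed H.graded_reps_positive by blast+

lemma split_rep_closed: "w \<in> SP \<Longrightarrow> split_rep w \<in> carrier F"
  unfolding split_rep_def by (intro TP.F_add tens_closed split_rep_parts) simp_all

text \<open>There is equality and not just congruence, because \<open>tens\<close> sees its
  arguments only through their classes.\<close>

lemma split_rep_cong:
  assumes "graded_class P w = graded_class P w'"
  shows "split_rep w = split_rep w'"
proof -
  have "graded_class H (seq_positive (resH.pullback_seq w)) = graded_class H (seq_positive (resH.pullback_seq w'))"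
    using resH.pullback_graded_class_cong[OF assms]
    by (auto simp: H.graded_class_eq_iff seq_positive_def)
  then show ?thesis
    unfolding split_rep_def tens_def using resG.pullback_graded_class_cong[OF assms] by simp
qed

lemma split_rep_diff:
  assumes "w \<in> SP" "w' \<in> SP"
  shows "split_rep (w - w') \<approx>\<^sub>K split_rep w - split_rep w'"
proof -
  note S = split_rep_parts[OF assms(1)] split_rep_parts[OF assms(2)]
  have "split_rep (w - w') \<approx>\<^sub>K
      (tens (resG.pullback_seq w) H.graded_unit - tens (resG.pullback_seq w') H.graded_unit) +
      (tens G.graded_unit (seq_positive (resH.pullback_seq w)) - tens G.graded_unit (seq_positive (resH.pullback_seq w')))"
    unfolding split_rep_def resG.pullback_seq_diff resH.pullback_seq_diff seq_positive_diff
    using S by (intro kcong_add tens_diff_left tens_diff_right) simp_all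
  also have "\<dots> = split_rep w - split_rep w'" by (simp add: split_rep_def algebra_simps)
  finally show ?thesis .
qed

lemma split_rep_zero: "split_rep 0 \<approx>\<^sub>K 0"
  using split_rep_diff[of 0 0] by simp

lemma split_rep_add:
  assumes "w \<in> SP" "w' \<in> SP"
  shows "split_rep (w + w') \<approx>\<^sub>K split_rep w + split_rep w'"
  using kcong_sym[OF split_rep_diff[OF P.graded_reps_add[OF assms] assms(2)]]
  by (simp add: kcong_def algebra_simps)

lemma split_rep_unit: "split_rep P.graded_unit \<approx>\<^sub>K tens G.graded_unit H.graded_unit"
proof -
  have "seq_positive H.graded_unit = 0"
    by (auto simp: seq_positive_def H.graded_unit_def zero_fun_apply)
  then show ?thesis using kcong_add[OF kcong_refl tens_zero(2)[OF G.graded_unit_closed], of "tens G.graded_unit H.graded_unit"]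
    by (simp add: split_rep_def resG.pullback_seq_unit resH.pullback_seq_unit)
qed

lemma tens_mult:
  assumes "u \<in> SG" "u' \<in> SG" "v \<in> SH" "v' \<in> SH"
  shows "tens u v \<otimes>\<^bsub>F\<^esub> tens u' v' = tens (seq_mult u u') (seq_mult v v')"
  using assms by (simp add: tens_def G.graded_ring_mult H.graded_ring_mult)

text \<open>Expanding the right side gives \<open>u u' \<otimes> 1\<close>,
  \<open>u' \<otimes> p\<close>, \<open>u \<otimes> p'\<close> and \<open>1 \<otimes> p p'\<close>.
  On the left, the positive part of \<open>v v'\<close> has the class of
  \<open>c p' + c' p + p p'\<close>, and \<open>1 \<otimes> c p'\<close> may be replaced by
  \<open>u \<otimes> p'\<close>, since the positive part of \<open>u\<close> vanishes against
  \<open>p'\<close>. The sides match because the two restrictions of \<open>w\<close> have the same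
  degree \<open>c\<close>.\<close>

lemma split_rep_mult:
  assumes w: "w \<in> SP" "w' \<in> SP"
  shows "split_rep (seq_mult w w') \<approx>\<^sub>K split_rep w \<otimes>\<^bsub>F\<^esub> split_rep w'"
proof -
  define u u' where "u = resG.pullback_seq w" and "u' = resG.pullback_seq w'"
  define v v' where "v = resH.pullback_seq w" and "v' = resH.pullback_seq w'"
  define p p' where "p = seq_positive v" and "p' = seq_positive v'"
  define c c' where "c = w 0 \<one>\<^bsub>P\<^esub>" and "c' = w' 0 \<one>\<^bsub>P\<^esub>"
  have S: "u \<in> SG" "u' \<in> SG" "v \<in> SH" "v' \<in> SH" "p \<in> SH" "p' \<in> SH"
    using split_rep_parts w by (simp_all add: u_def u'_def v_def v'_def p_def p'_def)
  have c: "u 0 \<one>\<^bsub>G\<^esub> = c" "u' 0 \<one>\<^bsub>G\<^esub> = c'" "v 0 \<one>\<^bsub>H\<^esub> = c" "v' 0 \<one>\<^bsub>H\<^esub> = c'"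
    by (simp_all add: u_def u'_def v_def v'_def c_def c'_def resG.pullback_seq_def resH.pullback_seq_def
        pullback_character_def)
  have cint: "c \<in> \<int>" "c' \<in> \<int>" using P.graded_reps_at_one_int w by (simp_all add: c_def c'_def)
  have p0: "p 0 = 0" "p' 0 = 0" by (simp_all add: p_def p'_def)
  let ?e = "G.graded_unit" and ?f = "H.graded_unit"
  \<comment> \<open>\<open>v 0\<close> differs from its degree \<open>c\<close> by an element of
    \<open>\<Gamma>\<^sup>1\<close>, and multiplying that difference by \<open>p' n\<close> leads
    into the filtration step \<open>n + 1\<close>; likewise for \<open>v' 0\<close> and
    \<open>p n\<close>.\<close>
  have class_eq: "graded_class H (seq_positive (seq_mult v v')) =
      graded_class H (seq_scale c p' + seq_scale c' p + seq_mult p p')"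
    unfolding H.graded_class_eq_iff
  proof
    fix n
    have scale: "(\<lambda>h. a * trivial_character H h) * x = (\<lambda>h. a * x h)"
      "x * (\<lambda>h. a * trivial_character H h) = (\<lambda>h. a * x h)" if "x \<in> gamma_filtration H n" for a x
      using character_ring_off_carrier[OF H.gamma_filtration_closed[OF that]]
      by (auto simp: fun_eq_iff times_fun_apply trivial_character_def)
    have "(v 0 - (\<lambda>h. c * trivial_character H h)) * p' n \<in> gamma_filtration H (Suc 0 + n)"
      "p n * (v' 0 - (\<lambda>h. c' * trivial_character H h)) \<in> gamma_filtration H (n + Suc 0)"
      using H.scaled_unit_diff[OF H.graded_repsD[OF S(3), of 0]] H.scaled_unit_diff[OF H.graded_repsD[OF S(4), of 0]]
        H.graded_repsD[OF S(5), of n] H.graded_repsD[OF S(6), of n]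
      unfolding c by (blast intro: H.gamma_filtration_mult)+
    then have "(v 0 * p' n - (\<lambda>h. c * p' n h)) + (p n * v' 0 - (\<lambda>h. c' * p n h)) \<in> gamma_filtration H (Suc n)"
      using scale H.graded_repsD[OF S(5), of n] H.graded_repsD[OF S(6), of n]
      by (intro H.gamma_filtration_add) (simp_all add: left_diff_distrib right_diff_distrib)
    moreover have "seq_positive (seq_mult v v') n - (seq_scale c p' + seq_scale c' p + seq_mult p p') n =
        (v 0 * p' n - (\<lambda>h. c * p' n h)) + (p n * v' 0 - (\<lambda>h. c' * p n h))"
      unfolding seq_positive_seq_mult p_def[symmetric] p'_def[symmetric]
      by (simp add: plus_fun_apply[of _ _ n] seq_scale_def algebra_simps)
    ultimately show "seq_positive (seq_mult v v') n - (seq_scale c p' + seq_scale c' p + seq_mult p p') n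
        \<in> gamma_filtration H (Suc n)" by simp
  qed
  have S': "seq_scale c p' \<in> SH" "seq_scale c' p \<in> SH" "seq_mult p p' \<in> SH" "seq_mult u u' \<in> SG"
    using S cint by (simp_all add: H.graded_reps_scale H.graded_reps_seq_mult G.graded_reps_seq_mult)
  have unit: "seq_mult ?e x = x" "seq_mult x ?e = x" if "x \<in> SG" for x using G.seq_mult_unit[OF that] .
  have unit': "seq_mult ?f x = x" "seq_mult x ?f = x" if "x \<in> SH" for x using H.seq_mult_unit[OF that] .
  have 0: "split_rep (seq_mult w w') =
      tens (seq_mult u u') ?f + tens ?e (seq_scale c p' + seq_scale c' p + seq_mult p p')"
    unfolding split_rep_def resG.pullback_seq_mult resH.pullback_seq_mult u_def[symmetric] u'_def[symmetric]
      v_def[symmetric] v'_def[symmetric] tens_def[of ?e] class_eq ..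
  have 1: "split_rep (seq_mult w w') \<approx>\<^sub>K tens (seq_mult u u') ?f +
      (tens ?e (seq_scale c p') + tens ?e (seq_scale c' p) + tens ?e (seq_mult p p'))"
    unfolding 0
    by (rule kcong_add[OF kcong_refl
          kcong_trans[OF tens_add_right[OF G.graded_unit_closed H.graded_reps_add[OF S'(1,2)] S'(3)]
            kcong_add[OF tens_add_right[OF G.graded_unit_closed S'(1,2)] kcong_refl]]])
  have f1: "tens ?e (seq_scale c p') \<approx>\<^sub>K tens u p'"
    using kcong_sym[OF tens_left_unit[OF S(1,6) p0(2)]] by (simp only: c)
  have f2: "tens ?e (seq_scale c' p) \<approx>\<^sub>K tens u' p"
    using kcong_sym[OF tens_left_unit[OF S(2,5) p0(1)]] by (simp only: c)
  have 2: "tens (seq_mult u u') ?f + (tens ?e (seq_scale c p') + tens ?e (seq_scale c' p) + tens ?e (seq_mult p p'))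
      \<approx>\<^sub>K tens (seq_mult u u') ?f + (tens u p' + tens u' p + tens ?e (seq_mult p p'))"
    by (rule kcong_add[OF kcong_refl kcong_add[OF kcong_add[OF f1 f2] kcong_refl]])
  have "split_rep w \<otimes>\<^bsub>F\<^esub> split_rep w' = (tens u ?f + tens ?e p) \<otimes>\<^bsub>F\<^esub> (tens u' ?f + tens ?e p')"
    by (simp only: split_rep_def u_def u'_def v_def v'_def p_def p'_def)
  also have "\<dots> = tens u ?f \<otimes>\<^bsub>F\<^esub> tens u' ?f + tens ?e p \<otimes>\<^bsub>F\<^esub> tens u' ?f +
      (tens u ?f \<otimes>\<^bsub>F\<^esub> tens ?e p' + tens ?e p \<otimes>\<^bsub>F\<^esub> tens ?e p')"
    by (simp only: free_pair_ring_mult_add)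
  also have "tens u ?f \<otimes>\<^bsub>F\<^esub> tens u' ?f = tens (seq_mult u u') ?f"
    by (simp only: tens_mult[OF S(1,2) H.graded_unit_closed H.graded_unit_closed] unit'[OF H.graded_unit_closed])
  also have "tens ?e p \<otimes>\<^bsub>F\<^esub> tens u' ?f = tens u' p"
    by (simp only: tens_mult[OF G.graded_unit_closed S(2,5) H.graded_unit_closed] unit[OF S(2)] unit'[OF S(5)])
  also have "tens u ?f \<otimes>\<^bsub>F\<^esub> tens ?e p' = tens u p'"
    by (simp only: tens_mult[OF S(1) G.graded_unit_closed H.graded_unit_closed S(6)] unit[OF S(1)] unit'[OF S(6)])
  also have "tens ?e p \<otimes>\<^bsub>F\<^esub> tens ?e p' = tens ?e (seq_mult p p')"
    by (simp only: tens_mult[OF G.graded_unit_closed G.graded_unit_closed S(5,6)] unit[OF G.graded_unit_closed])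
  finally have 3: "split_rep w \<otimes>\<^bsub>F\<^esub> split_rep w' =
      tens (seq_mult u u') ?f + (tens u p' + tens u' p + tens ?e (seq_mult p p'))"
    by (simp only: add_ac)
  show ?thesis unfolding 3 by (rule kcong_trans[OF 1 2])
qed

end

section \<open>Functionals on tensors and injectivity\<close>

context coprime_groups
begin

text \<open>The functional sends \<open>a \<otimes> b\<close> to the degree of \<open>b\<close>
  times component \<open>n\<close> of \<open>a\<close>. On relations in the left factor only the
  additivity defect of the chosen representatives remains, one filtration step down; on relations in
  the right factor the value is exactly 0, since the degree depends only on the class and is
  additive.\<close>

lemma frag_eval_K_left:
  assumes "c \<in> K"
  shows "frag_eval (\<lambda>p g. H.graded_rep (snd p) 0 \<one>\<^bsub>H\<^esub> * G.graded_rep (fst p) n g) c \<in> gamma_filtration G (Suc n)"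
proof -
  let ?f = "\<lambda>p g. H.graded_rep (snd p) 0 \<one>\<^bsub>H\<^esub> * G.graded_rep (fst p) n g"
  have "K \<subseteq> {c. frag_eval ?f c \<in> gamma_filtration G (Suc n)}"
  proof (rule TP.K_subsetI)
    show "tensor_relations G.gr H.gr \<subseteq>
        {c. frag_eval ?f c \<in> gamma_filtration G (Suc n)}"
    proof
      fix c assume "c \<in> tensor_relations G.gr H.gr"
      then consider
          (left) u u' v where "u \<in> SG" "u' \<in> SG" "v \<in> SH" "c = tens (u + u') v - tens u v - tens u' v"
        | (right) u v v' where "u \<in> SG" "v \<in> SH" "v' \<in> SH" "c = tens u (v + v') - tens u v - tens u v'"
        unfolding tensor_relations_def G.graded_ring_carrier H.graded_ring_carrier tens_def
        by (auto simp: G.graded_ring_add H.graded_ring_add)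
      then show "c \<in> {c. frag_eval ?f c \<in> gamma_filtration G (Suc n)}"
      proof cases
        case left
        let ?r = "\<lambda>u. G.graded_rep (graded_class G u) n"
        have "frag_eval ?f c = (\<lambda>g. v 0 \<one>\<^bsub>H\<^esub> * (?r (u + u') - ?r u - ?r u') g)"
          using left(3) by (simp add: left(4) tens_def frag_eval_diff fun_eq_iff minus_apply
              H.graded_rep_at_one right_diff_distrib)
        moreover have "v 0 \<one>\<^bsub>H\<^esub> \<in> \<int>" by (rule H.graded_reps_at_one_int[OF left(3)])
        ultimately show ?thesis
          using G.gamma_filtration_scale[OF G.graded_rep_add_diff[OF left(1,2), of n]] by simp
      next
        case right
        have "frag_eval ?f c = 0"
          using right(2,3) H.graded_reps_add[OF right(2,3)]
          by (simp add: right(4) tens_def frag_eval_diff fun_eq_iff minus_apply zero_fun_apply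
              H.graded_rep_at_one plus_fun_apply distrib_right)
        then show ?thesis by simp
      qed
    qed
  qed (simp_all add: frag_eval_diff G.gamma_filtration_diff)
  then show ?thesis using assms by blast
qed

text \<open>The mirror image, reading off the components of the right factor weighted by the degree
  of the left one.\<close>

lemma frag_eval_K_right:
  assumes "c \<in> K"
  shows "frag_eval (\<lambda>p h. G.graded_rep (fst p) 0 \<one>\<^bsub>G\<^esub> * H.graded_rep (snd p) n h) c \<in> gamma_filtration H (Suc n)"
proof -
  let ?f = "\<lambda>p h. G.graded_rep (fst p) 0 \<one>\<^bsub>G\<^esub> * H.graded_rep (snd p) n h"
  have "K \<subseteq> {c. frag_eval ?f c \<in> gamma_filtration H (Suc n)}"
  proof (rule TP.K_subsetI)
    show "tensor_relations G.gr H.gr \<subseteq>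
        {c. frag_eval ?f c \<in> gamma_filtration H (Suc n)}"
    proof
      fix c assume "c \<in> tensor_relations G.gr H.gr"
      then consider
          (left) u u' v where "u \<in> SG" "u' \<in> SG" "v \<in> SH" "c = tens (u + u') v - tens u v - tens u' v"
        | (right) u v v' where "u \<in> SG" "v \<in> SH" "v' \<in> SH" "c = tens u (v + v') - tens u v - tens u v'"
        unfolding tensor_relations_def G.graded_ring_carrier H.graded_ring_carrier tens_def
        by (auto simp: G.graded_ring_add H.graded_ring_add)
      then show "c \<in> {c. frag_eval ?f c \<in> gamma_filtration H (Suc n)}"
      proof cases
        case left
        have "frag_eval ?f c = 0"
          using left(1,2) G.graded_reps_add[OF left(1,2)]
          by (simp add: left(4) tens_def frag_eval_diff fun_eq_iff minus_apply zero_fun_apply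
              G.graded_rep_at_one plus_fun_apply distrib_right)
        then show ?thesis by simp
      next
        case right
        let ?r = "\<lambda>v. H.graded_rep (graded_class H v) n"
        have "frag_eval ?f c = (\<lambda>h. u 0 \<one>\<^bsub>G\<^esub> * (?r (v + v') - ?r v - ?r v') h)"
          using right(1) by (simp add: right(4) tens_def frag_eval_diff fun_eq_iff minus_apply
              G.graded_rep_at_one right_diff_distrib)
        moreover have "u 0 \<one>\<^bsub>G\<^esub> \<in> \<int>" by (rule G.graded_reps_at_one_int[OF right(1)])
        ultimately show ?thesis
          using H.gamma_filtration_scale[OF H.graded_rep_add_diff[OF right(2,3), of n]] by simp
      qed
    qed
  qed (simp_all add: frag_eval_diff H.gamma_filtration_diff)
  then show ?thesis using assms by blast
qed

text \<open>Modulo the next filtration step, the first functional reads off component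
  \<open>n\<close> of the restriction of \<open>w\<close> to \<open>G\<close>, and for
  \<open>n > 0\<close> the second one does the same for \<open>H\<close>. Once both restrictions of
  \<open>w n\<close> lie in that step, so does \<open>w n\<close>; in degree 0 the value at the
  identity decides.\<close>

lemma split_rep_injective:
  assumes w: "w \<in> SP" and K: "split_rep w \<in> K"
  shows "w n \<in> gamma_filtration P (Suc n)"
proof -
  define u where "u = resG.pullback_seq w"
  define v where "v = resH.pullback_seq w"
  have S: "u \<in> SG" "seq_positive v \<in> SH" using split_rep_parts[OF w] by (simp_all add: u_def v_def)
  have split: "split_rep w = tens u H.graded_unit + tens G.graded_unit (seq_positive v)"
    by (simp add: split_rep_def u_def v_def)
  \<comment> \<open>The second summand drops out, because a positive part has degree 0; in the first
    one the unit has degree 1.\<close>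
  have "frag_eval (\<lambda>p g. H.graded_rep (snd p) 0 \<one>\<^bsub>H\<^esub> * G.graded_rep (fst p) n g) (split_rep w) =
      G.graded_rep (graded_class G u) n"
    using S by (simp add: split tens_def frag_eval_add H.graded_rep_at_one fun_eq_iff plus_fun_apply
        zero_fun_apply)
  then have u: "u n \<in> gamma_filtration G (Suc n)"
    using frag_eval_K_left[OF K, of n] G.graded_rep_mem_iff[OF S(1)] by simp
  show ?thesis
  proof (cases "n = 0")
    case True
    have "u 0 \<one>\<^bsub>G\<^esub> = 0" using G.gamma_filtration_at_one[OF u] True by simp
    then have "w 0 \<one>\<^bsub>P\<^esub> = 0" by (simp add: u_def resG.pullback_seq_def pullback_character_def)
    then show ?thesis using P.gamma_1_iff[OF P.graded_repsD[OF w, of 0]] True by simp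
  next
    case False
    let ?f = "\<lambda>p h. G.graded_rep (fst p) 0 \<one>\<^bsub>G\<^esub> * H.graded_rep (snd p) n h"
    \<comment> \<open>The representative chosen for the class of the unit need not vanish in degree
      \<open>n\<close>, but it lies in the next filtration step.\<close>
    have "H.graded_unit n \<in> gamma_filtration H (Suc n)" using False by simp
    then have "H.graded_rep (graded_class H H.graded_unit) n \<in> gamma_filtration H (Suc n)"
      by (simp add: H.graded_rep_mem_iff)
    moreover have "u 0 \<one>\<^bsub>G\<^esub> \<in> \<int>" by (rule G.graded_reps_at_one_int[OF S(1)])
    ultimately have "(\<lambda>h. u 0 \<one>\<^bsub>G\<^esub> * H.graded_rep (graded_class H H.graded_unit) n h) \<in> gamma_filtration H (Suc n)"
      by (rule H.gamma_filtration_scale)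
    moreover have "frag_eval ?f (split_rep w) =
        (\<lambda>h. u 0 \<one>\<^bsub>G\<^esub> * H.graded_rep (graded_class H H.graded_unit) n h) +
        H.graded_rep (graded_class H (seq_positive v)) n"
      using S by (simp add: split tens_def frag_eval_add G.graded_rep_at_one fun_eq_iff plus_fun_apply)
    ultimately have "H.graded_rep (graded_class H (seq_positive v)) n \<in> gamma_filtration H (Suc n)"
      using H.gamma_filtration_diff[OF frag_eval_K_right[OF K, of n]] by force
    then have "seq_positive v n \<in> gamma_filtration H (Suc n)" using H.graded_rep_mem_iff[OF S(2)] by simp
    then have v: "v n \<in> gamma_filtration H (Suc n)" using False by (simp add: seq_positive_def)
    have "w n \<in> carrier (character_ring P)" by (rule P.gamma_filtration_closed[OF P.graded_repsD[OF w]])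
    moreover have "w n \<one>\<^bsub>P\<^esub> = 0" using P.gamma_filtration_at_one[OF P.graded_repsD[OF w, of n]] False by simp
    ultimately show ?thesis
      using u v by (intro rest_gamma_imp_gamma) (simp_all add: u_def v_def resG.pullback_seq_def resH.pullback_seq_def)
  qed
qed

text \<open>A preimage of \<open>u \<otimes> v\<close>, suggested by
  \<open>u \<otimes> v = b u \<otimes> 1 + 1 \<otimes> a v_+\<close> with \<open>a\<close> and
  \<open>b\<close> the degrees of \<open>u\<close> and \<open>v\<close>: in positive degrees both
  summands are inflated and added, while degree 0 carries only the constant
  \<open>a b\<close>.\<close>

definition joint_seq :: "(nat \<Rightarrow> 'a \<Rightarrow> complex) \<Rightarrow> (nat \<Rightarrow> 'b \<Rightarrow> complex) \<Rightarrow> nat \<Rightarrow> 'a \<times> 'b \<Rightarrow> complex"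
  where "joint_seq u v = (\<lambda>n. if n = 0 then (\<lambda>p. u 0 \<one>\<^bsub>G\<^esub> * v 0 \<one>\<^bsub>H\<^esub> * trivial_character P p)
    else (\<lambda>p. v 0 \<one>\<^bsub>H\<^esub> * inflG (u n) p) + (\<lambda>p. u 0 \<one>\<^bsub>G\<^esub> * inflH (v n) p))"

lemma joint_seq_closed:
  assumes u: "u \<in> SG" and v: "v \<in> SH"
  shows "joint_seq u v \<in> SP"
proof -
  have int: "u 0 \<one>\<^bsub>G\<^esub> \<in> \<int>" "v 0 \<one>\<^bsub>H\<^esub> \<in> \<int>"
    using G.graded_reps_at_one_int[OF u] H.graded_reps_at_one_int[OF v] by auto
  have "joint_seq u v n \<in> gamma_filtration P n" for n
  proof (cases "n = 0")
    case True
    then show ?thesis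
      using P.gamma_filtration_scale[OF P.trivial_character_in_gamma_0 Ints_mult[OF int]]
      by (simp add: joint_seq_def)
  next
    case False
    have "inflG (u n) \<in> gamma_filtration P n" "inflH (v n) \<in> gamma_filtration P n"
      by (rule infG.pullback_gamma_filtration[OF G.graded_repsD[OF u]],
          rule infH.pullback_gamma_filtration[OF H.graded_repsD[OF v]])
    then show ?thesis
      using False P.gamma_filtration_add P.gamma_filtration_scale int by (simp add: joint_seq_def)
  qed
  moreover have "{n. joint_seq u v n \<noteq> 0} \<subseteq> {0} \<union> ({n. u n \<noteq> 0} \<union> {n. v n \<noteq> 0})"
    by (auto simp: joint_seq_def fun_eq_iff zero_fun_apply plus_fun_apply pullback_character_def split: if_splits)
  then have "finite {n. joint_seq u v n \<noteq> 0}"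
    using G.graded_reps_finite[OF u] H.graded_reps_finite[OF v] finite_subset by fastforce
  ultimately show ?thesis by (simp add: graded_reps_def)
qed

text \<open>If both degrees are positive, both scalars vanish and the sequence is 0; otherwise one
  factor is concentrated in degree 0, and the sequence sits in the degree of the other.\<close>

lemma joint_seq_degree:
  assumes u: "u \<in> G.degree_reps i" and v: "v \<in> H.degree_reps j"
  shows "joint_seq u v \<in> P.degree_reps (i + j)"
proof (rule P.degree_repsI)
  show "joint_seq u v \<in> SP" using u v by (intro joint_seq_closed) (simp_all add: G.degree_reps_def H.degree_reps_def)
  have z: "m \<noteq> i \<Longrightarrow> u m = 0" "m \<noteq> j \<Longrightarrow> v m = 0" for m
    using u v by (auto simp: G.degree_reps_def H.degree_reps_def)
  fix m assume m: "m \<noteq> i + j"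
  show "joint_seq u v m = 0"
  proof (cases "m = 0")
    case True
    then have "u 0 = 0 \<or> v 0 = 0" using z[of 0] m by auto
    then show ?thesis using True by (auto simp: joint_seq_def zero_fun_apply fun_eq_iff)
  next
    case False
    have "v 0 = 0 \<or> u m = 0" using z(1)[of m] z(2)[of 0] m by (cases "m = i") auto
    moreover have "u 0 = 0 \<or> v m = 0" using z(1)[of 0] z(2)[of m] m by (cases "m = j") auto
    ultimately show ?thesis using False
      by (auto simp: joint_seq_def zero_fun_apply plus_fun_apply fun_eq_iff pullback_character_def)
  qed
qed

text \<open>An inflated component restricts on the other factor to its value at the identity, which
  is 0 in positive degree; there the restrictions of \<open>joint_seq u v\<close> are
  \<open>b u\<close> and \<open>a v\<close>. In degree 0 the restriction to \<open>G\<close> agrees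
  with \<open>b u\<close> only modulo \<open>\<Gamma>\<^sup>1\<close>, which suffices for classes,
  and the one to \<open>H\<close> is discarded.\<close>

lemma tens_eq_split_rep:
  assumes u: "u \<in> SG" and v: "v \<in> SH"
  shows "tens u v \<approx>\<^sub>K split_rep (joint_seq u v)"
proof -
  let ?a = "u 0 \<one>\<^bsub>G\<^esub>" and ?b = "v 0 \<one>\<^bsub>H\<^esub>"
  have int: "?a \<in> \<int>" "?b \<in> \<int>"
    using G.graded_reps_at_one_int[OF u] H.graded_reps_at_one_int[OF v] by auto
  have at_one: "u n \<one>\<^bsub>G\<^esub> = 0" "v n \<one>\<^bsub>H\<^esub> = 0" if "n \<noteq> 0" for n
    using G.gamma_filtration_at_one[OF G.graded_repsD[OF u, of n]]
      H.gamma_filtration_at_one[OF H.graded_repsD[OF v, of n]] that by simp_all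
  have off: "g \<notin> carrier G \<Longrightarrow> u n g = 0" "h \<notin> carrier H \<Longrightarrow> v n h = 0" for n g h
    using character_ring_off_carrier[OF G.gamma_filtration_closed[OF G.graded_repsD[OF u, of n]]]
      character_ring_off_carrier[OF H.gamma_filtration_closed[OF H.graded_repsD[OF v, of n]]] by auto
  have "graded_class G (resG.pullback_seq (joint_seq u v)) = graded_class G (seq_scale ?b u)"
    unfolding G.graded_class_eq_iff
  proof
    fix n
    show "resG.pullback_seq (joint_seq u v) n - seq_scale ?b u n \<in> gamma_filtration G (Suc n)"
    proof (cases "n = 0")
      case True
      have "resG.pullback_seq (joint_seq u v) 0 - seq_scale ?b u 0 =
          - (\<lambda>g. ?b * (u 0 - (\<lambda>g. ?a * trivial_character G g)) g)"
        using off(1)[of _ 0]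
        by (auto simp: resG.pullback_seq_def joint_seq_def seq_scale_def pullback_character_def fun_eq_iff
            minus_apply trivial_character_def algebra_simps)
      then show ?thesis
        using True G.gamma_filtration_scale[OF G.scaled_unit_diff[OF G.graded_repsD[OF u, of 0]] int(2)] by simp
    next
      case False
      then have "resG.pullback_seq (joint_seq u v) n = seq_scale ?b u n"
        using off(1)[of _ n] at_one(2)[of n]
        by (auto simp: resG.pullback_seq_def joint_seq_def seq_scale_def pullback_character_def fun_eq_iff
            plus_fun_apply)
      then show ?thesis by simp
    qed
  qed
  then have G: "tens (resG.pullback_seq (joint_seq u v)) H.graded_unit = tens (seq_scale ?b u) H.graded_unit"
    by (simp add: tens_def)
  have H: "seq_positive (resH.pullback_seq (joint_seq u v)) = seq_scale ?a (seq_positive v)"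
    using off(2) at_one(1)
    by (auto simp: resH.pullback_seq_def joint_seq_def seq_scale_def seq_positive_def pullback_character_def
        fun_eq_iff plus_fun_apply zero_fun_apply)
  have "tens u (seq_positive v) \<approx>\<^sub>K tens G.graded_unit (seq_scale ?a (seq_positive v))"
    by (rule tens_left_unit[OF u H.graded_reps_positive[OF v]]) simp
  then have "tens (seq_scale ?b u) H.graded_unit + tens u (seq_positive v) \<approx>\<^sub>K split_rep (joint_seq u v)"
    unfolding split_rep_def G H by (rule kcong_add[OF kcong_refl])
  with tens_right_unit[OF u v] show ?thesis by (rule kcong_trans)
qed

section \<open>The isomorphism of graded rings\<close>

definition tensor_iso where
  "tensor_iso x = coset K (split_rep (P.graded_rep x))"

lemma tensor_iso_class:
  assumes "w \<in> SP"
  shows "tensor_iso (graded_class P w) = coset K (split_rep w)"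
  unfolding tensor_iso_def using split_rep_cong[OF P.graded_rep_class(2)[OF assms]] by simp

lemma coset_kcong: "x \<approx>\<^sub>K y \<Longrightarrow> coset K x = coset K y"
  by (simp add: kcong_def TP.K_coset_eq_iff)

lemma pure_tensor_eq: "pure_tensor G.gr H.gr
    (graded_class G u) (graded_class H v) = coset K (tens u v)"
  by (simp add: pure_tensor_def tens_def)

definition degree_tensors where
  "degree_tensors n = {tens u v | u v i j. u \<in> G.degree_reps i \<and> v \<in> H.degree_reps j \<and> i + j = n}"

lemma graded_tensor_homogeneous:
  "homogeneous (graded_tensor G.gr H.gr) n =
    coset K ` group_closure (degree_tensors n)"
proof -
  have "degree_tensors n \<subseteq> carrier F"
    using tens_closed by (auto simp: degree_tensors_def G.degree_reps_def H.degree_reps_def)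
  from TP.generate_tensor_ring[OF this]
  have "generate (add_monoid TP.T) (coset K ` degree_tensors n) = coset K ` group_closure (degree_tensors n)" .
  moreover have "{pure_tensor G.gr H.gr a b | a b i j.
      a \<in> homogeneous G.gr i \<and> b \<in> homogeneous H.gr j \<and> i + j = n} =
    coset K ` degree_tensors n"
    unfolding G.graded_ring_homogeneous H.graded_ring_homogeneous degree_tensors_def
    by (auto simp: pure_tensor_eq image_iff) (metis pure_tensor_eq)+
  ultimately show ?thesis by (simp add: graded_tensor_simps)
qed

lemma split_rep_degree:
  assumes "w \<in> P.degree_reps n"
  shows "split_rep w \<in> group_closure (degree_tensors n)"
proof -
  have w: "w \<in> SP" "\<And>m. m \<noteq> n \<Longrightarrow> w m = 0" using assms by (auto simp: P.degree_reps_def)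
  note S = split_rep_parts[OF w(1)]
  have "resG.pullback_seq w \<in> G.degree_reps n" "seq_positive (resH.pullback_seq w) \<in> H.degree_reps n"
    using S w(2) by (auto intro!: G.degree_repsI H.degree_repsI
        simp: resG.pullback_seq_def resH.pullback_seq_def seq_positive_def)
  moreover have "G.graded_unit \<in> G.degree_reps 0" "H.graded_unit \<in> H.degree_reps 0"
    by (auto intro!: G.degree_repsI H.degree_repsI)
  ultimately have "tens (resG.pullback_seq w) H.graded_unit \<in> degree_tensors n"
    "tens G.graded_unit (seq_positive (resH.pullback_seq w)) \<in> degree_tensors n"
    unfolding degree_tensors_def by force+
  then show ?thesis unfolding split_rep_def by (intro group_closure_add group_closure.base) simp_all
qed

text \<open>Surjectivity within one degree: homogeneous pure tensors have homogeneous preimages, and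
  differences of preimages serve the differences.\<close>

lemma degree_tensors_split_rep:
  assumes "c \<in> group_closure (degree_tensors n)"
  shows "\<exists>w\<in>P.degree_reps n. c \<approx>\<^sub>K split_rep w"
  using assms
proof induction
  case (base s)
  show ?case
  proof (cases "s = 0")
    case True
    have "0 \<in> P.degree_reps n" by (rule P.degree_repsI) (simp_all add: zero_fun_apply)
    then show ?thesis using True kcong_sym[OF split_rep_zero] by blast
  next
    case False
    then obtain u v i j where s: "s = tens u v" "u \<in> G.degree_reps i" "v \<in> H.degree_reps j" "i + j = n"
      using base by (auto simp: degree_tensors_def)
    then have "tens u v \<approx>\<^sub>K split_rep (joint_seq u v)"
      by (intro tens_eq_split_rep) (simp_all add: G.degree_reps_def H.degree_reps_def)
    then show ?thesis using joint_seq_degree[OF s(2,3)] s by auto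
  qed
next
  case (diff s t)
  then obtain w w' where w: "w \<in> P.degree_reps n" "s \<approx>\<^sub>K split_rep w" "w' \<in> P.degree_reps n" "t \<approx>\<^sub>K split_rep w'"
    by blast
  then have "w - w' \<in> P.degree_reps n" by (simp add: P.degree_reps_def P.graded_reps_diff minus_apply)
  moreover have "split_rep (w - w') \<approx>\<^sub>K split_rep w - split_rep w'"
    using w by (intro split_rep_diff) (simp_all add: P.degree_reps_def)
  ultimately show ?case using kcong_trans[OF kcong_diff[OF w(2,4)] kcong_sym] by blast
qed

lemma tensor_iso_hom:
  "tensor_iso \<in> Ring.ring_hom P.gr (graded_tensor G.gr H.gr)"
proof (rule Ring.ring_hom_memI)
  fix x assume "x \<in> carrier P.gr"
  then obtain w where w: "w \<in> SP" "x = graded_class P w" by (auto simp: P.graded_ring_carrier)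
  then show "tensor_iso x \<in> carrier (graded_tensor G.gr H.gr)"
    using split_rep_closed by (simp add: tensor_iso_class graded_tensor_simps TP.tensor_ring_carrier)
next
  fix x y assume "x \<in> carrier P.gr" "y \<in> carrier P.gr"
  then obtain w w' where w: "w \<in> SP" "x = graded_class P w" "w' \<in> SP" "y = graded_class P w'"
    by (auto simp: P.graded_ring_carrier)
  show "tensor_iso (x \<otimes>\<^bsub>P.gr\<^esub> y) =
      tensor_iso x \<otimes>\<^bsub>graded_tensor G.gr H.gr\<^esub> tensor_iso y"
    using coset_kcong[OF split_rep_mult[OF w(1,3)]] w(1,3) split_rep_closed
    by (simp add: w(2,4) P.graded_ring_mult P.graded_reps_seq_mult tensor_iso_class graded_tensor_simps
        TP.tensor_ring_mult)
  show "tensor_iso (x \<oplus>\<^bsub>P.gr\<^esub> y) =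
      tensor_iso x \<oplus>\<^bsub>graded_tensor G.gr H.gr\<^esub> tensor_iso y"
    using coset_kcong[OF split_rep_add[OF w(1,3)]] w(1,3)
    by (simp add: w(2,4) P.graded_ring_add P.graded_reps_add tensor_iso_class graded_tensor_simps
        TP.tensor_ring_add)
next
  show "tensor_iso \<one>\<^bsub>P.gr\<^esub> =
      \<one>\<^bsub>graded_tensor G.gr H.gr\<^esub>"
    using coset_kcong[OF split_rep_unit]
    by (simp add: P.graded_ring_one tensor_iso_class graded_tensor_simps TP.tensor_ring_one tens_def
        G.graded_ring_one H.graded_ring_one)
qed

lemma tensor_iso_bij:
  "bij_betw tensor_iso (carrier P.gr)
    (carrier (graded_tensor G.gr H.gr))"
proof (rule bij_betw_imageI)
  show "inj_on tensor_iso (carrier P.gr)"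
  proof (rule inj_onI)
    fix x y assume "x \<in> carrier P.gr" "y \<in> carrier P.gr"
      and eq: "tensor_iso x = tensor_iso y"
    then obtain w w' where w: "w \<in> SP" "x = graded_class P w" "w' \<in> SP" "y = graded_class P w'"
      by (auto simp: P.graded_ring_carrier)
    have "split_rep w - split_rep w' \<in> K"
      using eq w by (simp add: tensor_iso_class TP.K_coset_eq_iff)
    then have "split_rep (w - w') \<in> K"
      using kcong_trans[OF split_rep_diff[OF w(1,3)]] by (simp flip: kcong_0_iff)
    then have "(w - w') n \<in> gamma_filtration P (Suc n)" for n
      by (intro split_rep_injective P.graded_reps_diff w)
    then show "x = y" by (simp add: w(2,4) P.graded_class_eq_iff minus_apply)
  qed
  \<comment> \<open>Pure tensors have explicit preimages, and the sums reached modulo the relations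
    are closed under differences.\<close>
  have surj: "\<exists>w\<in>SP. c \<approx>\<^sub>K split_rep w" if "c \<in> carrier F" for c
    using that
  proof (induction c rule: TP.F_induct)
    case zero
    then show ?case using kcong_sym[OF split_rep_zero] P.graded_reps_zero by blast
  next
    case (frag_of a b)
    then obtain u v where uv: "u \<in> SG" "v \<in> SH" and ab: "a = graded_class G u" "b = graded_class H v"
      by (auto simp: G.graded_ring_carrier H.graded_ring_carrier)
    then show ?case using tens_eq_split_rep[OF uv] joint_seq_closed[OF uv] by (auto simp: tens_def)
  next
    case (diff x y)
    then obtain w w' where w: "w \<in> SP" "x \<approx>\<^sub>K split_rep w" "w' \<in> SP" "y \<approx>\<^sub>K split_rep w'" by blast
    then show ?case
      using kcong_trans[OF kcong_diff[OF w(2,4)] kcong_sym[OF split_rep_diff[OF w(1,3)]]] P.graded_reps_diff by blast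
  qed
  show "tensor_iso ` carrier P.gr =
      carrier (graded_tensor G.gr H.gr)"
  proof (intro equalityI subsetI)
    fix z assume "z \<in> carrier (graded_tensor G.gr H.gr)"
    then obtain c where "c \<in> carrier F" "z = coset K c"
      by (auto simp: graded_tensor_simps TP.tensor_ring_carrier)
    then obtain w where "w \<in> SP" "z = coset K (split_rep w)" using surj coset_kcong by blast
    then have "z = tensor_iso (graded_class P w)" "graded_class P w \<in> carrier P.gr"
      by (simp_all add: tensor_iso_class P.graded_ring_carrier)
    then show "z \<in> tensor_iso ` carrier P.gr" by blast
  qed (auto intro: Ring.ring_hom_closed[OF tensor_iso_hom])
qed

lemma tensor_iso_homogeneous:
  "tensor_iso ` homogeneous P.gr n =
    homogeneous (graded_tensor G.gr H.gr) n"
proof -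
  have "tensor_iso ` graded_class P ` P.degree_reps n = (\<lambda>w. coset K (split_rep w)) ` P.degree_reps n"
    unfolding image_image by (rule image_cong) (simp_all add: tensor_iso_class P.degree_reps_def)
  also have "\<dots> = coset K ` group_closure (degree_tensors n)"
  proof (intro equalityI subsetI)
    fix z assume "z \<in> coset K ` group_closure (degree_tensors n)"
    then show "z \<in> (\<lambda>w. coset K (split_rep w)) ` P.degree_reps n"
      using degree_tensors_split_rep coset_kcong by blast
  qed (use split_rep_degree in blast)
  finally show ?thesis unfolding P.graded_ring_homogeneous graded_tensor_homogeneous .
qed

end

theorem corollary4p2:
  fixes G :: "('a, 'm) monoid_scheme" and H :: "('b, 'n) monoid_scheme"
  assumes "Group.group G" and "finite (carrier G)"
    and "Group.group H" and "finite (carrier H)"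
    and "coprime (Coset.order G) (Coset.order H)"
  shows "graded_ring_iso
           (graded_character_ring (G \<times>\<times> H))
           (graded_tensor (graded_character_ring G) (graded_character_ring H)) \<noteq> {}"
proof -
  interpret coprime_groups G H
    using assms by (intro coprime_groups.intro coprime_groups_axioms.intro)
  have "tensor_iso \<in> graded_ring_iso (graded_character_ring (G \<times>\<times> H))
      (graded_tensor (graded_character_ring G) (graded_character_ring H))"
    unfolding graded_ring_iso_def ring_iso_def
    using tensor_iso_hom tensor_iso_bij tensor_iso_homogeneous by blast
  then show ?thesis by blast
qed

end
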